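(* Let $\gamma\in(1/3,1/2)$ and $\kappa\in(1/3,\gamma)$. Assume the rough driver hypothesis (H) below holds for $\gamma$, let $a_0\in\mathbb R^d$, and let $\sigma:\mathbb R^d\to\mathbb R^{n,d}$ be of class $C^3$, bounded and with bounded derivatives up to order $3$. Then there exists a unique $\tilde y\in\tilde{\mathcal Q}^\kappa([0,T];\mathbb R^d)$ with $\tilde y_0=0$ such that, for all $0\le s\le t\le T$, $$(\tilde\delta\tilde y)_{ts}=\mathcal J_{ts}\big(\tilde d x\,\sigma(y)\big),\qquad\text{where } y_v=a_0+\int_0^\infty \hat\phi(\eta)\,\tilde y_v(\eta)\,d\eta,$$ the integral being the convolutional rough integral of the controlled path $\sigma(y)$ described in the context.
   Context: Fix $T>0$ and a measurable $\hat\phi:(0,\infty)\to\mathbb R$. For a finite-dimensional space $V$ of vectors or matrices (Euclidean norm), $\mathcal L_1(V)$ is the space of measurable $g:[0,\infty)\to V$ with $\mathcal N[g;\mathcal L_1]=\int_0^\infty|\hat\phi(\xi)|(1+\xi)\|g(\xi)\|\,d\xi<\infty$. For an interval $I=[\ell_1,\ell_2]\subset[0,T]$ and $k\ge1$, $\tilde{\mathcal C}_k(I;V)$ is the set of continuous maps from $\{(t_1,\dots,t_k)\in I^k: t_1\ge\dots\ge t_k\}$ to $\mathcal L_1(V)$, written $(t_1,\dots,t_k)\mapsto A_{t_1\dots t_k}(\xi)$. Put $a_{ts}(\xi)=e^{-\xi(t-s)}-1$ and define $(\tilde\delta f)_{ts}(\xi)=f_t(\xi)-e^{-\xi(t-s)}f_s(\xi)$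 for $f\in\tilde{\mathcal C}_1$, $(\tilde\delta B)_{tus}(\xi)=B_{ts}(\xi)-B_{tu}(\xi)-e^{-\xi(t-u)}B_{us}(\xi)$ for $B\in\tilde{\mathcal C}_2$ ($t\ge u\ge s$). Norms: $\mathcal N[B;\tilde{\mathcal C}_2^\mu(I)]=\sup_{s<t}\mathcal N[B_{ts};\mathcal L_1]/|t-s|^\mu$; for $h\in\tilde{\mathcal C}_3$, $\mathcal N[h;\tilde{\mathcal C}_3^\mu(I)]=\inf\sum_i\sup_{s<u<t}\mathcal N[h^i_{tus};\mathcal L_1]|t-u|^{-\rho_i}|u-s|^{-(\mu-\rho_i)}$, the infimum over decompositions $h=\sum_ih^i$ and $\rho_i\in(0,\mu)$; for $f\in\tilde{\mathcal C}_1$, $\mathcal N[f;\tilde{\mathcal C}_1^\mu(I)]=\mathcal N[\tilde\delta f;\tilde{\mathcal C}_2^\mu(I)]$; $\tilde{\mathcal C}_k^\mu$ denotes elements of finite norm. For ordinary paths $z:I\to W$ and two-parameter $r$: $\delta z_{ts}=z_t-z_s$, $\mathcal N[z;\mathcal C_1^0]=\sup_s\|z_s\|$, $\mathcal N[z;\mathcal C_1^\mu]=\sup_{s\ne t}\|z_t-z_s\|/|t-s|^\mu$, $\mathcal N[r;\mathcal C_2^\mu]=\sup_{s\ne t}\|r_{ts}\|/|t-s|^\mu$. For matrices, $A\cdot B=\mathrm{Tr}(AB^* )$, and for $u,v\in\mathbb R^{1,n}$, $(u\otimes v)_{ij}=u_iv_j$. Convolutional sewing map: for $\mu>1$ and each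 $\tilde h\in\tilde{\mathcal C}_3^\mu(I;V)$ of the form $\tilde h=\tilde\delta B$ with $B\in\tilde{\mathcal C}_2(I;V)$, there is a unique $\tilde\Lambda\tilde h\in\tilde{\mathcal C}^\mu_2(I;V)$ with $\tilde\delta(\tilde\Lambda\tilde h)=\tilde h$. Hypothesis (H): $\tilde x^1\in\tilde{\mathcal C}_2^\gamma([0,T];\mathbb R^{1,n})$, $\tilde x^2\in\tilde{\mathcal C}_2^{2\gamma}([0,T];\mathbb R^{n,n})$, $\tilde x^3\in\tilde{\mathcal C}_3^{3\gamma}([0,T];\mathbb R^{n,n})$ are given with $\tilde\delta\tilde x^1=0$ and $(\tilde\delta\tilde x^2)_{tus}=\tilde x^1_{tu}\otimes x^1_{us}+\tilde x^3_{tus}$, where $x^1_{ts}=\int_0^\infty\tilde x^1_{ts}(\xi)\hat\phi(\xi)d\xi$. (For a smooth path $x$: $\tilde x^1_{ts}(\xi)=\int_s^te^{-\xi(t-v)}dx_v$, $\tilde x^2_{ts}(\xi)=\int_s^te^{-\xi(t-v)}dx_v\otimes x^1_{vs}$, $\tilde x^3_{tus}(\xi)=\int_u^te^{-\xi(t-v)}dx_v\otimes(x^1_{vs}-x^1_{vu}-x^1_{us})$.) Controlled paths: $\mathcal Q^\kappa(I;\mathbb R^k)$ is the set of $y:I\to\mathbb R^k$ with $(\delta y)_{ts}=(x^1_{ts}\zeta_s)^*+r_{ts}$, $\zeta\in\mathcal C_1^\kappa(I;\mathbb R^{n,k})$, $r\in\mathcal C_2^{2\kappa}(I;\mathbb R^k)$.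 $\tilde{\mathcal Q}^\kappa(I;\mathbb R^k)$ is the set of $\tilde y\in\tilde{\mathcal C}_1(I;\mathbb R^k)$ with $(\tilde\delta\tilde y)_{ts}(\xi)=(\tilde x^1_{ts}(\xi)\zeta_s)^*+\tilde r_{ts}(\xi)$, $\zeta\in\mathcal C_1^\kappa(I;\mathbb R^{n,k})$, $\tilde r\in\tilde{\mathcal C}_2^{2\kappa}(I;\mathbb R^k)$. Integral: for $z\in\mathcal Q^\kappa(I;\mathbb R^n)$ with decomposition $(\zeta,r)$, $\mathcal J_{ts}(\tilde dx\,z)=\tilde x^1_{ts}z_s+\tilde x^2_{ts}\cdot\zeta_s^*+(\tilde\Lambda h)_{ts}$, with $h_{tus}=\tilde x^1_{tu}r_{us}+\tilde x^2_{tu}\cdot(\zeta_u-\zeta_s)^*-\tilde x^3_{tus}\cdot\zeta_s^*$; for $\mathbb R^{n,l}$-valued $z$ whose columns $z^{(j)}$ are controlled, $\mathcal J(\tilde dx\,z)$ is $\mathbb R^l$-valued with $j$-th coordinate $\mathcal J(\tilde dx\,z^{(j)})$. Controlled structure of $\sigma(y)$: if $(\tilde\delta\tilde y)=(\tilde x^1\zeta)^*+\tilde r$, then $(\delta y)_{ts}=(x^1_{ts}\zeta_s)^*+r^y_{ts}$ with $r^y_{ts}=\int_0^\infty\hat\phi(\xi)[\tilde r_{ts}(\xi)+a_{ts}(\xi)\tilde y_s(\xi)]d\xi$, and the $j$-th column $\sigma^{(j)}(y)$ is decomposed with $\zeta^{(j)}_s=\zeta_s(D\sigma^{(j)}(y_s))^*$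 and remainder $\sigma^{(j)}(y_t)-\sigma^{(j)}(y_s)-(x^1_{ts}\zeta^{(j)}_s)^*$.
   Formalization: The derivative ζ in the decomposition of the solution ỹ is fixed to be σ(y); with an arbitrary ζ the integral depends on the choice and uniqueness fails, e.g. for x̃¹=0, x̃³=0 and a nonzero x̃² with δ̃x̃²=0. Uniqueness is equality in L₁ for each t. *)

theory Defs
  imports "HOL-Analysis.Analysis"
begin

definition L1N :: "(real \<Rightarrow> real) \<Rightarrow> (real \<Rightarrow> 'v::real_normed_vector) \<Rightarrow> ennreal" where
  "L1N phi g = (\<integral>\<^sup>+ \<xi>. indicator {0..} \<xi> * ennreal (\<bar>phi \<xi>\<bar> * (1 + \<xi>) * norm (g \<xi>)) \<partial>lborel)"

definition inL1 :: "(real \<Rightarrow> real) \<Rightarrow> (real \<Rightarrow> 'v::real_normed_vector) \<Rightarrow> bool" where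
  "inL1 phi g \<longleftrightarrow> set_borel_measurable lborel {0..} g \<and> L1N phi g < \<infinity>"

definition cdelta1 :: "(real \<Rightarrow> real \<Rightarrow> 'v::real_vector) \<Rightarrow> real \<Rightarrow> real \<Rightarrow> real \<Rightarrow> 'v" where
  "cdelta1 f t s \<xi> = f t \<xi> - exp (- \<xi> * (t - s)) *\<^sub>R f s \<xi>"

definition cdelta2 :: "(real \<Rightarrow> real \<Rightarrow> real \<Rightarrow> 'v::real_vector) \<Rightarrow> real \<Rightarrow> real \<Rightarrow> real \<Rightarrow> real \<Rightarrow> 'v" where
  "cdelta2 B t u s \<xi> = B t s \<xi> - B t u \<xi> - exp (- \<xi> * (t - u)) *\<^sub>R B u s \<xi>"

definition tC1 :: "(real \<Rightarrow> real) \<Rightarrow> real set \<Rightarrow> (real \<Rightarrow> real \<Rightarrow> 'v::real_normed_vector) \<Rightarrow> bool" where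
  "tC1 phi I f \<longleftrightarrow>
     (\<forall>t\<in>I. inL1 phi (f t)) \<and>
     (\<forall>t\<in>I. \<forall>e>0. \<exists>d>0. \<forall>t'\<in>I. \<bar>t' - t\<bar> < d \<longrightarrow>
        L1N phi (\<lambda>\<xi>. f t' \<xi> - f t \<xi>) < ennreal e)"

definition tC2 :: "(real \<Rightarrow> real) \<Rightarrow> real set \<Rightarrow> (real \<Rightarrow> real \<Rightarrow> real \<Rightarrow> 'v::real_normed_vector) \<Rightarrow> bool" where
  "tC2 phi I B \<longleftrightarrow>
     (\<forall>t\<in>I. \<forall>s\<in>I. s \<le> t \<longrightarrow> inL1 phi (B t s)) \<and>
     (\<forall>t\<in>I. \<forall>s\<in>I. s \<le> t \<longrightarrow> (\<forall>e>0. \<exists>d>0. \<forall>t'\<in>I. \<forall>s'\<in>I. s' \<le> t' \<longrightarrow>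
        \<bar>t' - t\<bar> + \<bar>s' - s\<bar> < d \<longrightarrow> L1N phi (\<lambda>\<xi>. B t' s' \<xi> - B t s \<xi>) < ennreal e))"

definition tC3 :: "(real \<Rightarrow> real) \<Rightarrow> real set \<Rightarrow> (real \<Rightarrow> real \<Rightarrow> real \<Rightarrow> real \<Rightarrow> 'v::real_normed_vector) \<Rightarrow> bool" where
  "tC3 phi I h \<longleftrightarrow>
     (\<forall>t\<in>I. \<forall>u\<in>I. \<forall>s\<in>I. s \<le> u \<and> u \<le> t \<longrightarrow> inL1 phi (h t u s)) \<and>
     (\<forall>t\<in>I. \<forall>u\<in>I. \<forall>s\<in>I. s \<le> u \<and> u \<le> t \<longrightarrow> (\<forall>e>0. \<exists>d>0. \<forall>t'\<in>I. \<forall>u'\<in>I. \<forall>s'\<in>I.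
        s' \<le> u' \<and> u' \<le> t' \<longrightarrow> \<bar>t' - t\<bar> + \<bar>u' - u\<bar> + \<bar>s' - s\<bar> < d \<longrightarrow>
        L1N phi (\<lambda>\<xi>. h t' u' s' \<xi> - h t u s \<xi>) < ennreal e))"

definition tC2mu :: "(real \<Rightarrow> real) \<Rightarrow> real set \<Rightarrow> real \<Rightarrow> (real \<Rightarrow> real \<Rightarrow> real \<Rightarrow> 'v::real_normed_vector) \<Rightarrow> bool" where
  "tC2mu phi I \<mu> B \<longleftrightarrow> tC2 phi I B \<and>
     (\<exists>C. \<forall>t\<in>I. \<forall>s\<in>I. s < t \<longrightarrow> L1N phi (B t s) \<le> ennreal (C * (t - s) powr \<mu>))"

definition tC3mu :: "(real \<Rightarrow> real) \<Rightarrow> real set \<Rightarrow> real \<Rightarrow> (real \<Rightarrow> real \<Rightarrow> real \<Rightarrow> real \<Rightarrow> 'v::real_normed_vector) \<Rightarrow> bool" where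
  "tC3mu phi I \<mu> h \<longleftrightarrow> tC3 phi I h \<and>
     (\<exists>(m::nat) hs \<rho>.
        (\<forall>t\<in>I. \<forall>u\<in>I. \<forall>s\<in>I. s \<le> u \<and> u \<le> t \<longrightarrow> (\<forall>\<xi>. h t u s \<xi> = (\<Sum>i<m. hs i t u s \<xi>))) \<and>
        (\<forall>i<m. 0 < \<rho> i \<and> \<rho> i < \<mu> \<and> tC3 phi I (hs i) \<and>
           (\<exists>C. \<forall>t\<in>I. \<forall>u\<in>I. \<forall>s\<in>I. s < u \<and> u < t \<longrightarrow>
              L1N phi (hs i t u s) \<le> ennreal (C * (t - u) powr \<rho> i * (u - s) powr (\<mu> - \<rho> i)))))"

definition tC1mu :: "(real \<Rightarrow> real) \<Rightarrow> real set \<Rightarrow> real \<Rightarrow> (real \<Rightarrow> real \<Rightarrow> 'v::real_normed_vector) \<Rightarrow> bool" where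
  "tC1mu phi I \<mu> f \<longleftrightarrow> tC1 phi I f \<and> tC2mu phi I \<mu> (cdelta1 f)"

definition holder1 :: "real set \<Rightarrow> real \<Rightarrow> (real \<Rightarrow> 'w::real_normed_vector) \<Rightarrow> bool" where
  "holder1 I \<mu> z \<longleftrightarrow> (\<exists>C. \<forall>t\<in>I. \<forall>s\<in>I. norm (z t - z s) \<le> C * \<bar>t - s\<bar> powr \<mu>)"

definition holder2 :: "real set \<Rightarrow> real \<Rightarrow> (real \<Rightarrow> real \<Rightarrow> 'w::real_normed_vector) \<Rightarrow> bool" where
  "holder2 I \<mu> r \<longleftrightarrow> (\<exists>C. \<forall>t\<in>I. \<forall>s\<in>I. norm (r t s) \<le> C * \<bar>t - s\<bar> powr \<mu>)"

text \<open>The unique element of tilde C_2^mu whose convolutional increment is h (equalities in L_1,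
  i.e. up to N-null functions).\<close>
definition csew :: "(real \<Rightarrow> real) \<Rightarrow> real set \<Rightarrow> real \<Rightarrow> (real \<Rightarrow> real \<Rightarrow> real \<Rightarrow> real \<Rightarrow> 'v::real_normed_vector)
    \<Rightarrow> real \<Rightarrow> real \<Rightarrow> real \<Rightarrow> 'v" where
  "csew phi I \<mu> h = (SOME B. tC2mu phi I \<mu> B \<and>
      (\<forall>t\<in>I. \<forall>u\<in>I. \<forall>s\<in>I. s \<le> u \<and> u \<le> t \<longrightarrow>
         L1N phi (\<lambda>\<xi>. cdelta2 B t u s \<xi> - h t u s \<xi>) = 0))"

definition mdot :: "real^'n^'m \<Rightarrow> real^'n^'m \<Rightarrow> real" where
  "mdot A B = (\<Sum>i\<in>UNIV. \<Sum>j\<in>UNIV. A$i$j * B$i$j)"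

definition outer :: "real^'n \<Rightarrow> real^'m \<Rightarrow> real^'m^'n" where
  "outer u v = (\<chi> i j. u$i * v$j)"

definition phint :: "(real \<Rightarrow> real) \<Rightarrow> (real \<Rightarrow> 'v::{banach,second_countable_topology}) \<Rightarrow> 'v" where
  "phint phi g = (LINT \<xi>:{0<..}|lborel. phi \<xi> *\<^sub>R g \<xi>)"

definition hypH :: "(real \<Rightarrow> real) \<Rightarrow> real \<Rightarrow> real
   \<Rightarrow> (real \<Rightarrow> real \<Rightarrow> real \<Rightarrow> real^'n)
   \<Rightarrow> (real \<Rightarrow> real \<Rightarrow> real \<Rightarrow> real^'n^'n)
   \<Rightarrow> (real \<Rightarrow> real \<Rightarrow> real \<Rightarrow> real \<Rightarrow> real^'n^'n) \<Rightarrow> bool" where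
  "hypH phi T \<gamma> x1 x2 x3 \<longleftrightarrow>
     tC2mu phi {0..T} \<gamma> x1 \<and> tC2mu phi {0..T} (2*\<gamma>) x2 \<and> tC3mu phi {0..T} (3*\<gamma>) x3 \<and>
     (\<forall>t\<in>{0..T}. \<forall>u\<in>{0..T}. \<forall>s\<in>{0..T}. s \<le> u \<and> u \<le> t \<longrightarrow>
        L1N phi (cdelta2 x1 t u s) = 0) \<and>
     (\<forall>t\<in>{0..T}. \<forall>u\<in>{0..T}. \<forall>s\<in>{0..T}. s \<le> u \<and> u \<le> t \<longrightarrow>
        L1N phi (\<lambda>\<xi>. cdelta2 x2 t u s \<xi> - (outer (x1 t u \<xi>) (phint phi (x1 u s)) + x3 t u s \<xi>)) = 0)"

definition ctrl :: "(real \<Rightarrow> real) \<Rightarrow> real set \<Rightarrow> real \<Rightarrow> (real \<Rightarrow> real \<Rightarrow> real \<Rightarrow> real^'n)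
   \<Rightarrow> (real \<Rightarrow> real^'k) \<Rightarrow> (real \<Rightarrow> real^'k^'n) \<Rightarrow> (real \<Rightarrow> real \<Rightarrow> real^'k) \<Rightarrow> bool" where
  "ctrl phi I \<kappa> x1 z \<zeta> r \<longleftrightarrow> holder1 I \<kappa> \<zeta> \<and> holder2 I (2*\<kappa>) r \<and>
     (\<forall>t\<in>I. \<forall>s\<in>I. s \<le> t \<longrightarrow> z t - z s = phint phi (x1 t s) v* \<zeta> s + r t s)"

definition Jh :: "(real \<Rightarrow> real \<Rightarrow> real \<Rightarrow> real^'n) \<Rightarrow> (real \<Rightarrow> real \<Rightarrow> real \<Rightarrow> real^'n^'n)
   \<Rightarrow> (real \<Rightarrow> real \<Rightarrow> real \<Rightarrow> real \<Rightarrow> real^'n^'n)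
   \<Rightarrow> (real \<Rightarrow> real^'n^'n) \<Rightarrow> (real \<Rightarrow> real \<Rightarrow> real^'n) \<Rightarrow> real \<Rightarrow> real \<Rightarrow> real \<Rightarrow> real \<Rightarrow> real" where
  "Jh x1 x2 x3 \<zeta> r t u s \<xi> =
     x1 t u \<xi> \<bullet> r u s + mdot (x2 t u \<xi>) (transpose (\<zeta> u - \<zeta> s)) - mdot (x3 t u s \<xi>) (transpose (\<zeta> s))"

definition Jint :: "(real \<Rightarrow> real) \<Rightarrow> real set \<Rightarrow> real \<Rightarrow> (real \<Rightarrow> real \<Rightarrow> real \<Rightarrow> real^'n)
   \<Rightarrow> (real \<Rightarrow> real \<Rightarrow> real \<Rightarrow> real^'n^'n) \<Rightarrow> (real \<Rightarrow> real \<Rightarrow> real \<Rightarrow> real \<Rightarrow> real^'n^'n)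
   \<Rightarrow> (real \<Rightarrow> real^'n) \<Rightarrow> (real \<Rightarrow> real^'n^'n) \<Rightarrow> (real \<Rightarrow> real \<Rightarrow> real^'n)
   \<Rightarrow> real \<Rightarrow> real \<Rightarrow> real \<Rightarrow> real" where
  "Jint phi I \<kappa> x1 x2 x3 z \<zeta> r t s \<xi> =
     x1 t s \<xi> \<bullet> z s + mdot (x2 t s \<xi>) (transpose (\<zeta> s))
     + csew phi I (3*\<kappa>) (Jh x1 x2 x3 \<zeta> r) t s \<xi>"

definition Dcol :: "(real^'d \<Rightarrow> real^'d^'n) \<Rightarrow> 'd \<Rightarrow> real^'d \<Rightarrow> real^'d^'n" where
  "Dcol \<sigma> j y = matrix (\<lambda>v. column j (frechet_derivative \<sigma> (at y) v))"

definition ypath :: "(real \<Rightarrow> real) \<Rightarrow> real^'d \<Rightarrow> (real \<Rightarrow> real \<Rightarrow> real^'d) \<Rightarrow> real \<Rightarrow> real^'d" where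
  "ypath phi a0 yt v = a0 + phint phi (yt v)"

definition sig_zeta :: "(real \<Rightarrow> real) \<Rightarrow> real^'d \<Rightarrow> (real^'d \<Rightarrow> real^'d^'n) \<Rightarrow> (real \<Rightarrow> real \<Rightarrow> real^'d)
   \<Rightarrow> (real \<Rightarrow> real^'d^'n) \<Rightarrow> 'd \<Rightarrow> real \<Rightarrow> real^'n^'n" where
  "sig_zeta phi a0 \<sigma> yt \<zeta> j s = \<zeta> s ** transpose (Dcol \<sigma> j (ypath phi a0 yt s))"

definition sig_rem :: "(real \<Rightarrow> real) \<Rightarrow> real^'d \<Rightarrow> (real^'d \<Rightarrow> real^'d^'n) \<Rightarrow> (real \<Rightarrow> real \<Rightarrow> real \<Rightarrow> real^'n)
   \<Rightarrow> (real \<Rightarrow> real \<Rightarrow> real^'d) \<Rightarrow> (real \<Rightarrow> real^'d^'n) \<Rightarrow> 'd \<Rightarrow> real \<Rightarrow> real \<Rightarrow> real^'n" where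
  "sig_rem phi a0 \<sigma> x1 yt \<zeta> j t s =
     column j (\<sigma> (ypath phi a0 yt t)) - column j (\<sigma> (ypath phi a0 yt s))
     - phint phi (x1 t s) v* sig_zeta phi a0 \<sigma> yt \<zeta> j s"

definition Jsig :: "(real \<Rightarrow> real) \<Rightarrow> real \<Rightarrow> real \<Rightarrow> (real \<Rightarrow> real \<Rightarrow> real \<Rightarrow> real^'n)
   \<Rightarrow> (real \<Rightarrow> real \<Rightarrow> real \<Rightarrow> real^'n^'n) \<Rightarrow> (real \<Rightarrow> real \<Rightarrow> real \<Rightarrow> real \<Rightarrow> real^'n^'n)
   \<Rightarrow> real^'d \<Rightarrow> (real^'d \<Rightarrow> real^'d^'n) \<Rightarrow> (real \<Rightarrow> real \<Rightarrow> real^'d) \<Rightarrow> (real \<Rightarrow> real^'d^'n)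
   \<Rightarrow> real \<Rightarrow> real \<Rightarrow> real \<Rightarrow> real^'d" where
  "Jsig phi T \<kappa> x1 x2 x3 a0 \<sigma> yt \<zeta> t s \<xi> =
     (\<chi> j. Jint phi {0..T} \<kappa> x1 x2 x3
        (\<lambda>v. column j (\<sigma> (ypath phi a0 yt v)))
        (sig_zeta phi a0 \<sigma> yt \<zeta> j)
        (sig_rem phi a0 \<sigma> x1 yt \<zeta> j) t s \<xi>)"

definition tQ :: "(real \<Rightarrow> real) \<Rightarrow> real set \<Rightarrow> real \<Rightarrow> (real \<Rightarrow> real \<Rightarrow> real \<Rightarrow> real^'n)
   \<Rightarrow> (real \<Rightarrow> real \<Rightarrow> real^'d) \<Rightarrow> (real \<Rightarrow> real^'d^'n) \<Rightarrow> bool" where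
  "tQ phi I \<kappa> x1 yt \<zeta> \<longleftrightarrow> tC1 phi I yt \<and> holder1 I \<kappa> \<zeta> \<and>
     tC2mu phi I (2*\<kappa>) (\<lambda>t s \<xi>. cdelta1 yt t s \<xi> - x1 t s \<xi> v* \<zeta> s)"

definition is_solution :: "(real \<Rightarrow> real) \<Rightarrow> real \<Rightarrow> real \<Rightarrow> (real \<Rightarrow> real \<Rightarrow> real \<Rightarrow> real^'n)
   \<Rightarrow> (real \<Rightarrow> real \<Rightarrow> real \<Rightarrow> real^'n^'n) \<Rightarrow> (real \<Rightarrow> real \<Rightarrow> real \<Rightarrow> real \<Rightarrow> real^'n^'n)
   \<Rightarrow> real^'d \<Rightarrow> (real^'d \<Rightarrow> real^'d^'n) \<Rightarrow> (real \<Rightarrow> real \<Rightarrow> real^'d) \<Rightarrow> bool" where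
  "is_solution phi T \<kappa> x1 x2 x3 a0 \<sigma> yt \<longleftrightarrow>
     (let \<zeta> = (\<lambda>v. \<sigma> (ypath phi a0 yt v)) in
       tQ phi {0..T} \<kappa> x1 yt \<zeta> \<and>
       L1N phi (yt 0) = 0 \<and>
       (\<forall>t\<in>{0..T}. \<forall>s\<in>{0..T}. s \<le> t \<longrightarrow>
          L1N phi (\<lambda>\<xi>. cdelta1 yt t s \<xi> - Jsig phi T \<kappa> x1 x2 x3 a0 \<sigma> yt \<zeta> t s \<xi>) = 0))"

definition C3b :: "(real^'d \<Rightarrow> real^'d^'n) \<Rightarrow> bool" where
  "C3b \<sigma> \<longleftrightarrow> (\<exists>(D1 :: real^'d \<Rightarrow> ((real^'d) \<Rightarrow>\<^sub>L (real^'d^'n)))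
      (D2 :: real^'d \<Rightarrow> ((real^'d) \<Rightarrow>\<^sub>L ((real^'d) \<Rightarrow>\<^sub>L (real^'d^'n))))
      (D3 :: real^'d \<Rightarrow> ((real^'d) \<Rightarrow>\<^sub>L ((real^'d) \<Rightarrow>\<^sub>L ((real^'d) \<Rightarrow>\<^sub>L (real^'d^'n))))).
     (\<forall>y. (\<sigma> has_derivative blinfun_apply (D1 y)) (at y)) \<and>
     (\<forall>y. (D1 has_derivative blinfun_apply (D2 y)) (at y)) \<and>
     (\<forall>y. (D2 has_derivative blinfun_apply (D3 y)) (at y)) \<and>
     continuous_on UNIV D3 \<and>
     bounded (range \<sigma>) \<and> bounded (range D1) \<and> bounded (range D2) \<and> bounded (range D3))"

end

theory Submission
  imports Defs
begin

text \<open>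
  Multiplying by \<open>\<bar>phi \<xi>\<bar> (1 + \<xi>)\<close> embeds the weighted \<open>L\<^sub>1\<close> space into the Banach space of integrable
  classes, where multiplication by \<open>exp (- \<xi> t)\<close> is a strongly continuous contraction semigroup \<open>S\<close>.
  By the uniqueness of the sewing map, \<open>yt\<close> solves the equation iff the residual
  \<open>R\<^sub>t\<^sub>s = Y\<^sub>t - S\<^sub>t\<^sub>-\<^sub>s Y\<^sub>s - A\<^sub>t\<^sub>s \<sigma>(y\<^sub>s) - X\<^sub>t\<^sub>s (\<sigma> \<sigma>')(y\<^sub>s)\<close> is of order \<open>\<bar>t - s\<bar>\<close> to the power
  \<open>3\<kappa> > 1\<close>, where \<open>A\<close> and \<open>X\<close> come from \<open>x1\<close> and \<open>x2\<close> (Davie's formulation). The defect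
  \<open>R\<^sub>t\<^sub>s - R\<^sub>t\<^sub>u - S\<^sub>t\<^sub>-\<^sub>u R\<^sub>u\<^sub>s\<close> is of order \<open>3\<gamma>\<close>, so splitting intervals in the middle bounds \<open>R\<close> along
  every grid by its one-step values. The unbounded drift \<open>(S\<^sub>t\<^sub>-\<^sub>s - 1) Y\<^sub>s\<close> contributes at most
  \<open>\<bar>t - s\<bar> \<parallel>Y\<^sub>s\<parallel>\<close> to the observed path, which is still affordable when \<open>\<parallel>Y\<parallel>\<close> is as large as the number
  of blocks of length \<open>\<epsilon>\<close> times \<open>\<epsilon>\<close> to the power \<open>\<gamma>\<close>: the Euler schemes are bounded on the whole of
  \<open>[0, T]\<close>. The same argument applied to the difference of two discrete paths gives a stability
  estimate, which makes the dyadic Euler schemes converge and identifies any two solutions.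
\<close>

section \<open>Semigroups and sewing\<close>

text \<open>The drift creates a circle: bounding the residual requires a bound on the state, and
  bounding the state requires a bound on the residual. A local argument whose length depends on the
  size of the state need not reach \<open>T\<close>. The Euler scheme breaks the circle because its
  one-step residuals vanish, so both bounds can be carried together along the grid, with a block
  length fixed in advance. \<open>csew\<close> is a choice operator and says nothing until some
  element with its two properties is known. For existence the residual is that element. For
  uniqueness a solution is only known to be controlled, so a sewing theorem for controlled
  integrands is proved too, by the same splitting argument. Euler schemes have residuals of order
  3\<gamma>, an arbitrary solution only of order 3\<kappa>. Stability therefore admits any order
  above 1 and turns half of the surplus over 1 into a positive power of the step. Limits are taken
  in a space of classes, and a class charging frequencies of weight zero is represented by no
  function. A projection removes that part at the end.\<close>

lemma discrete_sewing:
  fixes Q :: "nat \<Rightarrow> nat \<Rightarrow> real" and \<mu> h q :: real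
  assumes \<mu>: "\<mu> > 1" and h: "h > 0" and q: "q \<ge> 0"
    and one: "\<And>i. a \<le> i \<Longrightarrow> i < b \<Longrightarrow> Q (Suc i) i \<le> q * h powr \<mu>"
    and split: "\<And>i k j. a \<le> j \<Longrightarrow> j < k \<Longrightarrow> k < i \<Longrightarrow> i \<le> b \<Longrightarrow> i \<le> j + p \<Longrightarrow>
        Q k j \<le> q * (real (k - j) * h) powr \<mu> \<Longrightarrow>
        Q i j \<le> Q i k + Q k j + (1 - (2/3) powr (\<mu> - 1)) * q * (real (i - j) * h) powr \<mu>"
  shows "a \<le> j \<Longrightarrow> j < i \<Longrightarrow> i \<le> b \<Longrightarrow> i \<le> j + p \<Longrightarrow> Q i j \<le> q * (real (i - j) * h) powr \<mu>"
proof (induction "i - j" arbitrary: i j rule: less_induct)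
  case less
  show ?case
  proof (cases "i = Suc j")
    case True
    then show ?thesis using one[of j] less.prems by simp
  next
    case False
    \<comment> \<open>The integer midpoint leaves two pieces of at most two thirds of the length,
      the worst case being three steps. Their powers add up to at most
      \<open>(2/3) powr (\<mu> - 1)\<close> times that of the whole; the factor in
      \<open>split\<close> is exactly what is left over.\<close>
    define k where "k = (i + j) div 2"
    have k: "j < k" "k < i" "3 * (k - j) \<le> 2 * (i - j)" "3 * (i - k) \<le> 2 * (i - j)"
      using False less.prems unfolding k_def by linarith+
    \<comment> \<open>\<open>split\<close> is handed this bound because in the rough system the
      defect is itself estimated through the residual on the left piece.\<close>
    have 1: "Q k j \<le> q * (real (k - j) * h) powr \<mu>"
      by (rule less.hyps) (use k less.prems in auto)
    have 2: "Q i k \<le> q * (real (i - k) * h) powr \<mu>"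
      by (rule less.hyps) (use k less.prems in auto)
    define d where "d = real (i - j) * h"
    have d: "d > 0" using h less.prems by (simp add: d_def)
    have bd: "(real m * h) powr \<mu> \<le> real m * h * ((2/3) powr (\<mu> - 1) * d powr (\<mu> - 1))"
      if "0 < m" "3 * m \<le> 2 * (i - j)" for m
    proof -
      have pos: "real m * h > 0" using that h by simp
      have "real m \<le> 2/3 * real (i - j)" using that(2) by linarith
      then have le: "real m * h \<le> 2/3 * d" using h unfolding d_def by (simp add: mult_right_mono)
      have "(real m * h) powr \<mu> = real m * h * (real m * h) powr (\<mu> - 1)"
        using pos by (simp add: powr_diff)
      also have "\<dots> \<le> real m * h * (2/3 * d) powr (\<mu> - 1)"
        using pos le \<mu> by (intro mult_left_mono powr_mono2) auto
      also have "(2/3 * d) powr (\<mu> - 1) = (2/3) powr (\<mu> - 1) * d powr (\<mu> - 1)"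
        using d powr_mult[of "2/3" d "\<mu> - 1"] by simp
      finally show ?thesis .
    qed
    have dsum: "real (k - j) * h + real (i - k) * h = d"
      using k by (simp add: d_def of_nat_diff algebra_simps)
    have "(real (k - j) * h) powr \<mu> + (real (i - k) * h) powr \<mu>
       \<le> (real (k - j) * h + real (i - k) * h) * ((2/3) powr (\<mu> - 1) * d powr (\<mu> - 1))"
      using bd[of "k - j"] bd[of "i - k"] k by (simp add: distrib_right)
    also have "\<dots> = (2/3) powr (\<mu> - 1) * d powr \<mu>"
      using d unfolding dsum by (simp add: powr_diff)
    finally have "q * (real (k - j) * h) powr \<mu> + q * (real (i - k) * h) powr \<mu> \<le> q * ((2/3) powr (\<mu> - 1) * d powr \<mu>)"
      using q by (simp add: distrib_left[symmetric] mult_left_mono)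
    then show ?thesis
      using 1 2 split[OF less.prems(1) k(1,2) less.prems(3,4) 1] unfolding d_def[symmetric]
      by (simp add: algebra_simps)
  qed
qed

section \<open>Dyadic grid points below a time\<close>

definition dyadic_index :: "nat \<Rightarrow> real \<Rightarrow> nat" where
  "dyadic_index n t = nat \<lfloor>2 ^ n * t\<rfloor>"

lemma dyadic_index_le: "0 \<le> t \<Longrightarrow> real (dyadic_index n t) / 2 ^ n \<le> t"
  unfolding dyadic_index_def by (simp add: divide_le_eq mult.commute)

lemma dyadic_index_gt: "0 \<le> t \<Longrightarrow> t < real (dyadic_index n t) / 2 ^ n + 1 / 2 ^ n"
  unfolding dyadic_index_def
  by (simp add: add_divide_distrib[symmetric] less_divide_eq mult.commute)

lemma dyadic_index_mono: "s \<le> t \<Longrightarrow> dyadic_index n s \<le> dyadic_index n t"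
  unfolding dyadic_index_def by (intro nat_mono floor_mono) simp

text \<open>Refining either keeps the last grid point before \<open>t\<close> or moves it by one
  fine step. These are the two cases in which \<open>dyadic_limit\<close> compares consecutive
  levels.\<close>

lemma dyadic_index_Suc:
  assumes "0 \<le> t"
  shows "dyadic_index (Suc n) t = 2 * dyadic_index n t \<or> dyadic_index (Suc n) t = 2 * dyadic_index n t + 1"
proof -
  have "\<lfloor>2 * (2 ^ n * t)\<rfloor> = 2 * \<lfloor>2 ^ n * t\<rfloor> \<or> \<lfloor>2 * (2 ^ n * t)\<rfloor> = 2 * \<lfloor>2 ^ n * t\<rfloor> + 1"
    by linarith
  moreover have "\<lfloor>2 ^ n * t\<rfloor> \<ge> 0" using assms by simp
  ultimately show ?thesis unfolding dyadic_index_def by (auto simp: mult.assoc nat_add_distrib nat_mult_distrib)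
qed

lemma dyadic_index_tendsto:
  assumes "0 \<le> t"
  shows "(\<lambda>n. real (dyadic_index n t) / 2 ^ n) \<longlonglongrightarrow> t"
proof (rule tendsto_sandwich)
  show "(\<lambda>n. t - (1/2) ^ n) \<longlonglongrightarrow> t"
    using tendsto_diff[OF tendsto_const LIMSEQ_power_zero[of "1/2::real"]] by simp
  show "\<forall>\<^sub>F n in sequentially. t - (1/2) ^ n \<le> real (dyadic_index n t) / 2 ^ n"
    using dyadic_index_gt[OF assms] by (intro always_eventually allI) (smt (verit) power_one_over)
qed (use dyadic_index_le[OF assms] in auto)

text \<open>Only the semigroup law is restricted to nonnegative times. Asking the rest for every
  real time spares side conditions, and a concrete semigroup can be truncated at zero to satisfy
  it.\<close>

locale contraction_semigroup =
  fixes S :: "real \<Rightarrow> 'e::banach \<Rightarrow> 'e"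
  assumes S_linear: "linear (S t)"
    and norm_S: "norm (S t x) \<le> norm x"
    and S_0 [simp]: "S 0 x = x"
    and S_add: "0 \<le> s \<Longrightarrow> 0 \<le> t \<Longrightarrow> S (s + t) x = S s (S t x)"
    and S_cont: "continuous_on UNIV (\<lambda>t. S t x)"
begin

lemmas S_diff = linear_diff[OF S_linear]
lemmas S_plus = linear_add[OF S_linear]
lemmas S_zero [simp] = linear_0[OF S_linear]

lemma S_S: "s \<le> u \<Longrightarrow> u \<le> t \<Longrightarrow> S (t - u) (S (u - s) x) = S (t - s) x"
  using S_add[of "t - u" "u - s" x] by simp

text \<open>Strong continuity handles the moving time and contractivity, uniform in time, the moving
  vector; together they give joint continuity.\<close>

lemma tendsto_S:
  assumes "(f \<longlongrightarrow> t) net" "(g \<longlongrightarrow> x) net"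
  shows "((\<lambda>n. S (f n) (g n)) \<longlongrightarrow> S t x) net"
proof -
  have "((\<lambda>n. S (f n) x) \<longlongrightarrow> S t x) net"
    using S_cont[of x] assms(1) isCont_tendsto_compose[where g="\<lambda>t. S t x"]
    by (auto simp: continuous_on_eq_continuous_at)
  moreover have "((\<lambda>n. S (f n) (g n - x)) \<longlongrightarrow> 0) net"
  proof (rule Lim_null_comparison)
    show "((\<lambda>n. norm (g n - x)) \<longlongrightarrow> 0) net"
      using assms(2) by (simp add: LIM_zero tendsto_norm_zero)
  qed (auto intro: always_eventually simp: norm_S)
  ultimately show ?thesis
    using tendsto_add by (fastforce simp: S_diff)
qed

text \<open>The semigroup is only strongly continuous: near \<open>t0\<close> the path is compared with the orbit of \<open>Y r\<close>
  for one fixed earlier time \<open>r\<close>.\<close>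
lemma continuous_on_path:
  fixes Y :: "real \<Rightarrow> 'e"
  assumes \<alpha>: "\<alpha> > 0"
    and inc: "\<And>s t. 0 \<le> s \<Longrightarrow> s \<le> t \<Longrightarrow> t \<le> T \<Longrightarrow> norm (Y t - S (t - s) (Y s)) \<le> C * (t - s) powr \<alpha>"
  shows "continuous_on {0..T} Y"
proof (rule continuous_onI)
  fix t0 e :: real
  assume t0: "t0 \<in> {0..T}" and e: "0 < e"
  have C: "\<bar>C\<bar> \<ge> C" "\<bar>C\<bar> \<ge> 0" by auto
  have "((\<lambda>d. \<bar>C\<bar> * d powr \<alpha>) \<longlongrightarrow> \<bar>C\<bar> * 0 powr \<alpha>) (at 0 within {0..})"
    using \<alpha> by (intro tendsto_intros tendsto_powr') (auto simp: eventually_at_filter)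
  then have "\<forall>\<^sub>F d in at 0 within {0..}. \<bar>C\<bar> * d powr \<alpha> < e/3"
    using e \<alpha> by (intro order_tendstoD(2)) auto
  then obtain \<eta>0 where \<eta>0: "\<eta>0 > 0" "\<And>d. d \<ge> 0 \<Longrightarrow> d \<noteq> 0 \<Longrightarrow> d < \<eta>0 \<Longrightarrow> \<bar>C\<bar> * d powr \<alpha> < e/3"
    unfolding eventually_at by (auto simp: dist_real_def)
  define \<eta> where "\<eta> = \<eta>0 / 2"
  have "\<eta> > 0" using \<eta>0 by (simp add: \<eta>_def)
  moreover have "\<bar>C\<bar> * d powr \<alpha> < e/3" if "d \<ge> 0" "d \<le> \<eta>" for d
    using \<eta>0(1) \<eta>0(2)[of d] that e by (cases "d = 0") (auto simp: \<eta>_def)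
  ultimately have \<eta>: "\<eta> > 0" "\<And>d. d \<ge> 0 \<Longrightarrow> d \<le> \<eta> \<Longrightarrow> \<bar>C\<bar> * d powr \<alpha> < e/3"
    by auto
  define r where "r = max 0 (t0 - \<eta>/2)"
  have r: "0 \<le> r" "r \<le> t0" "t0 - r \<le> \<eta>/2" using t0 \<eta>(1) by (auto simp: r_def max_def)
  have "((\<lambda>u. u - r) \<longlongrightarrow> t0 - r) (at t0)"
    by (intro tendsto_intros)
  then have "isCont (\<lambda>u. S (u - r) (Y r)) t0"
    unfolding isCont_def by (intro tendsto_S tendsto_const)
  then obtain d where d: "d > 0" "\<And>u. dist u t0 < d \<Longrightarrow> dist (S (u - r) (Y r)) (S (t0 - r) (Y r)) < e/3"
    using e unfolding continuous_at_eps_delta by (metis divide_pos_pos zero_less_numeral)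
  show "\<exists>d>0. \<forall>x'\<in>{0..T}. dist x' t0 < d \<longrightarrow> dist (Y x') (Y t0) \<le> e"
  proof (intro exI[of _ "min d (\<eta>/2)"] conjI ballI impI)
    show "0 < min d (\<eta>/2)" using d \<eta> by simp
    fix u assume u: "u \<in> {0..T}" "dist u t0 < min d (\<eta>/2)"
    have ur: "r \<le> u" "u - r \<le> \<eta>"
      using u(1) u(2) t0 \<eta>(1) unfolding r_def dist_real_def max_def by (auto split: if_splits simp: abs_if)
    have 1: "norm (Y u - S (u - r) (Y r)) < e/3"
      using inc[of r u] \<eta>(2)[of "u - r"] ur u r C
      by (smt (verit) atLeastAtMost_iff mult_right_mono powr_ge_zero)
    have 2: "norm (Y t0 - S (t0 - r) (Y r)) < e/3"
      using inc[of r t0] \<eta>(2)[of "t0 - r"] r t0 C \<eta>(1)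
      by (smt (verit) atLeastAtMost_iff mult_right_mono powr_ge_zero field_sum_of_halves)
    have 3: "norm (S (u - r) (Y r) - S (t0 - r) (Y r)) < e/3"
      using d(2)[of u] u by (simp add: dist_norm)
    have "Y u - Y t0 = (Y u - S (u - r) (Y r)) + (S (u - r) (Y r) - S (t0 - r) (Y r)) - (Y t0 - S (t0 - r) (Y r))"
      by simp
    also have "norm \<dots> \<le> norm (Y u - S (u - r) (Y r)) + norm (S (u - r) (Y r) - S (t0 - r) (Y r)) + norm (Y t0 - S (t0 - r) (Y r))"
      by (rule order_trans[OF norm_triangle_ineq4 add_right_mono[OF norm_triangle_ineq]])
    finally show "dist (Y u) (Y t0) \<le> e" using 1 2 3 by (simp add: dist_norm)
  qed
qed

text \<open>Over \<open>N\<close> equal steps contractivity merely adds up the increments, so the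
  norm at \<open>t\<close> is at most a constant times \<open>N * (l / N) powr \<mu>\<close>, which
  tends to 0 because \<mu> > 1. This is the uniqueness half of sewing.\<close>

lemma small_increments_zero:
  fixes D :: "real \<Rightarrow> 'e"
  assumes \<mu>: "\<mu> > 1" and "a \<le> t" and D0: "D a = 0"
    and inc: "\<And>s u. a \<le> s \<Longrightarrow> s \<le> u \<Longrightarrow> u \<le> t \<Longrightarrow> norm (D u - S (u - s) (D s)) \<le> C * (u - s) powr \<mu>"
  shows "D t = 0"
proof (cases "a = t")
  case True then show ?thesis using D0 by simp
next
  case False
  define l where "l = t - a"
  have l: "l > 0" using False assms by (simp add: l_def)
  have bd: "norm (D t) \<le> C * l powr \<mu> * real N powr (1 - \<mu>)" if N: "N > 0" for N :: nat
  proof -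
    have "norm (D (a + real k * (l / N))) \<le> real k * (C * (l / N) powr \<mu>)" if "k \<le> N" for k
      using that
    proof (induction k)
      case 0 then show ?case using D0 by simp
    next
      case (Suc k)
      have k0: "real k * (l / N) \<ge> 0" "l / N \<ge> 0" using l by auto
      have kk: "real k * (l / N) + l / N \<le> l"
        using Suc.prems N l by (simp add: field_simps) (metis of_nat_Suc of_nat_le_iff add.commute mult_left_mono less_eq_real_def distrib_left mult.commute mult.right_neutral)
      let ?s = "a + real k * (l / N)" and ?u = "a + real (Suc k) * (l / N)"
      have us: "?u - ?s = l / N" by (simp add: algebra_simps add_divide_distrib)
      have "norm (D ?u - S (?u - ?s) (D ?s)) \<le> C * (?u - ?s) powr \<mu>"
      proof (rule inc)
        show "a \<le> ?s" using k0 by simp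
        show "?s \<le> ?u" "?u \<le> t" using us k0 kk l_def by linarith+
      qed
      then have "norm (D ?u - S (l / N) (D ?s)) \<le> C * (l / N) powr \<mu>" unfolding us .
      moreover have "norm (D ?u) \<le> norm (D ?u - S (l / N) (D ?s)) + norm (D ?s)"
        using norm_triangle_sub[of "D ?u" "S (l / N) (D ?s)"] norm_S[of "l / N" "D ?s"] by linarith
      ultimately show ?case using Suc by (simp add: algebra_simps)
    qed
    from this[of N] have "norm (D t) \<le> real N * (C * (l / N) powr \<mu>)"
      using N by (simp add: l_def)
    also have "\<dots> = C * l powr \<mu> * real N powr (1 - \<mu>)"
      using N l by (simp add: powr_divide powr_diff)
    finally show ?thesis .
  qed
  have "(\<lambda>N. C * l powr \<mu> * real N powr (1 - \<mu>)) \<longlonglongrightarrow> C * l powr \<mu> * 0"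
    using \<mu> by (intro tendsto_mult tendsto_const tendsto_neg_powr filterlim_real_sequentially) simp
  then have "norm (D t) \<le> 0"
    by (intro tendsto_lowerbound[where f="\<lambda>N. C * l powr \<mu> * real N powr (1 - \<mu>)" and F=sequentially])
       (auto intro!: eventually_sequentiallyI[of 1] bd)
  then show ?thesis by simp
qed

text \<open>Values at the last grid point are first transported to \<open>t\<close> by the
  semigroup, so that levels become comparable. \<open>two\<close> pays for the difference at the
  common grid point and \<open>one\<close> for an additional fine step; both are geometric, hence
  the differences are summable. Levels before \<open>n0\<close> are exempt since Euler bounds hold
  only for small steps.\<close>

lemma dyadic_limit:
  fixes Y :: "nat \<Rightarrow> nat \<Rightarrow> 'e"
  assumes r: "0 \<le> r" "r < 1"
    and one: "\<And>n k. n0 \<le> n \<Longrightarrow> real (2 * k + 1) / 2 ^ Suc n \<le> T \<Longrightarrow>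
      norm (Y (Suc n) (2 * k + 1) - S (1 / 2 ^ Suc n) (Y (Suc n) (2 * k))) \<le> c * r ^ n"
    and two: "\<And>n k. n0 \<le> n \<Longrightarrow> real k / 2 ^ n \<le> T \<Longrightarrow> norm (Y (Suc n) (2 * k) - Y n k) \<le> c * r ^ n"
    and t: "t \<in> {0..T}"
  shows "convergent (\<lambda>n. S (t - real (dyadic_index n t) / 2 ^ n) (Y n (dyadic_index n t)))" (is "convergent ?X")
proof -
  have "norm (?X (Suc n) - ?X n) \<le> 2 * c * r ^ n" if n: "n0 \<le> n" for n
  proof -
    let ?k = "dyadic_index n t"
    have kT: "real ?k / 2 ^ n \<le> T" using dyadic_index_le[of t n] t by auto
    have c0: "0 \<le> c * r ^ n" using order_trans[OF norm_ge_zero two[OF n kT]] .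
    consider "dyadic_index (Suc n) t = 2 * ?k" | "dyadic_index (Suc n) t = 2 * ?k + 1"
      using dyadic_index_Suc t by auto
    then show ?thesis
    proof cases
      case 1
      then have "?X (Suc n) - ?X n = S (t - real ?k / 2 ^ n) (Y (Suc n) (2 * ?k) - Y n ?k)"
        by (simp add: S_diff)
      then have "norm (?X (Suc n) - ?X n) \<le> norm (Y (Suc n) (2 * ?k) - Y n ?k)"
        by (simp add: norm_S)
      then show ?thesis using two[OF n kT] c0 by linarith
    next
      case 2
      let ?u = "real (2 * ?k + 1) / 2 ^ Suc n"
      have u: "?u \<le> t" using dyadic_index_le[of t "Suc n"] 2 t by (simp add: add_divide_distrib)
      have u2: "?u - real ?k / 2 ^ n = 1 / 2 ^ Suc n" by (simp add: field_simps)
      have "S (t - real ?k / 2 ^ n) (Y n ?k) = S (t - ?u) (S (1 / 2 ^ Suc n) (Y n ?k))"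
        using S_S[of "real ?k / 2 ^ n" ?u t "Y n ?k"] u u2 by (simp add: field_simps)
      then have "?X (Suc n) - ?X n = S (t - ?u) ((Y (Suc n) (2 * ?k + 1) - S (1 / 2 ^ Suc n) (Y (Suc n) (2 * ?k)))
          + S (1 / 2 ^ Suc n) (Y (Suc n) (2 * ?k) - Y n ?k))"
        using 2 by (simp add: S_diff)
      then have "norm (?X (Suc n) - ?X n) \<le> norm ((Y (Suc n) (2 * ?k + 1) - S (1 / 2 ^ Suc n) (Y (Suc n) (2 * ?k)))
          + S (1 / 2 ^ Suc n) (Y (Suc n) (2 * ?k) - Y n ?k))"
        by (simp only: norm_S)
      also have "\<dots> \<le> norm (Y (Suc n) (2 * ?k + 1) - S (1 / 2 ^ Suc n) (Y (Suc n) (2 * ?k)))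
          + norm (Y (Suc n) (2 * ?k) - Y n ?k)"
        by (intro order_trans[OF norm_triangle_ineq] add_left_mono norm_S)
      finally show ?thesis using two[OF n kT] one[of n ?k] n u t by auto
    qed
  qed
  moreover have "summable (\<lambda>n. 2 * c * r ^ n)"
    using r by (intro summable_mult summable_geometric) simp
  ultimately have "summable (\<lambda>n. ?X (Suc n) - ?X n)"
    by (rule summable_comparison_test'[where N=n0, rotated])
  then have "convergent (\<lambda>n. \<Sum>i<n. ?X (Suc i) - ?X i)"
    by (simp add: summable_iff_convergent)
  then have "convergent (\<lambda>n. ?X n - ?X 0)"
    by (subst (asm) sum_lessThan_telescope) simp
  then have "convergent (\<lambda>n. (?X n - ?X 0) + ?X 0)"
    by (intro convergent_add convergent_const)
  then show ?thesis by simp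
qed

text \<open>Applying \<open>S (t - t' n)\<close> to the residual on the grid keeps its bound by
  contractivity and turns both path terms into transported values, whose limits are known.
  \<open>B\<close> is an arbitrary convergent sequence, so that the lemma serves the linear sums as
  well as the Euler schemes.\<close>

lemma dyadic_limit_residual:
  fixes Y :: "nat \<Rightarrow> nat \<Rightarrow> 'e"
  assumes st: "0 \<le> s" "s \<le> t"
    and Zt: "(\<lambda>n. S (t - real (dyadic_index n t) / 2 ^ n) (Y n (dyadic_index n t))) \<longlonglongrightarrow> Zt"
    and Zs: "(\<lambda>n. S (s - real (dyadic_index n s) / 2 ^ n) (Y n (dyadic_index n s))) \<longlonglongrightarrow> Zs"
    and B: "B \<longlonglongrightarrow> B0" and b: "b \<longlonglongrightarrow> b0"
    and bd: "\<forall>\<^sub>F n in sequentially. norm (Y n (dyadic_index n t)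
        - S (real (dyadic_index n t - dyadic_index n s) * (1 / 2 ^ n)) (Y n (dyadic_index n s)) - B n) \<le> b n"
  shows "norm (Zt - S (t - s) Zs - B0) \<le> b0"
proof -
  define t' s' where "t' = (\<lambda>n. real (dyadic_index n t) / 2 ^ n)" and "s' = (\<lambda>n. real (dyadic_index n s) / 2 ^ n)"
  have le: "s' n \<le> t' n" "s' n \<le> s" "t' n \<le> t" for n
    using st dyadic_index_le[of s n] dyadic_index_le[of t n] dyadic_index_mono[of s t n]
    by (auto simp: t'_def s'_def divide_right_mono)
  have eq: "real (dyadic_index n t - dyadic_index n s) * (1 / 2 ^ n) = t' n - s' n" for n
    using dyadic_index_mono[of s t n] st by (simp add: t'_def s'_def of_nat_diff diff_divide_distrib)
  have t'l: "t' \<longlonglongrightarrow> t" unfolding t'_def using dyadic_index_tendsto st by simp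
  let ?E = "\<lambda>n. Y n (dyadic_index n t) - S (t' n - s' n) (Y n (dyadic_index n s)) - B n"
  have "S (t - t' n) (?E n) = S (t - t' n) (Y n (dyadic_index n t)) - S (t - s) (S (s - s' n) (Y n (dyadic_index n s))) - S (t - t' n) (B n)" for n
    using S_S[of "s' n" "t' n" t] S_S[of "s' n" s t] le[of n] st by (simp add: S_diff)
  moreover have "(\<lambda>n. S (t - t' n) (Y n (dyadic_index n t)) - S (t - s) (S (s - s' n) (Y n (dyadic_index n s))) - S (t - t' n) (B n))
      \<longlonglongrightarrow> Zt - S (t - s) Zs - S (t - t) B0"
    using Zt Zs B t'l unfolding t'_def s'_def by (intro tendsto_diff tendsto_S tendsto_const)
  ultimately have "(\<lambda>n. norm (S (t - t' n) (?E n))) \<longlonglongrightarrow> norm (Zt - S (t - s) Zs - B0)"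
    by (simp add: tendsto_norm)
  then show ?thesis
  proof (rule tendsto_le[OF sequentially_bot b])
    show "\<forall>\<^sub>F n in sequentially. norm (S (t - t' n) (?E n)) \<le> b n"
      using bd unfolding eq by eventually_elim (rule order_trans[OF norm_S])
  qed
qed

text \<open>\<open>I\<close> is the limit of dyadic Riemann sums carried along by the semigroup. The
  convolutional increment of the residual is minus that of \<open>B\<close>, so the residual is the
  sewn element. Obtaining it from a path puts it into the form of an increment minus a germ, which
  \<open>csew_eq\<close> expects.\<close>

lemma sewing:
  fixes B :: "real \<Rightarrow> real \<Rightarrow> 'e"
  assumes \<mu>: "\<mu> > 1" and \<alpha>: "\<alpha> > 0" and C: "C \<ge> 0" and T: "T \<ge> 0"
    and bnd: "\<And>s t. 0 \<le> s \<Longrightarrow> s \<le> t \<Longrightarrow> t \<le> T \<Longrightarrow> norm (B t s) \<le> C * (t - s) powr \<alpha>"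
    and dl: "\<And>s u t. 0 \<le> s \<Longrightarrow> s < u \<Longrightarrow> u < t \<Longrightarrow> t \<le> T \<Longrightarrow>
        norm (B t s - B t u - S (t - u) (B u s)) \<le> C * (t - s) powr \<mu>"
    and cont: "\<And>f g t s. (\<And>n. 0 \<le> g n \<and> g n \<le> f n \<and> f n \<le> T) \<Longrightarrow> f \<longlonglongrightarrow> t \<Longrightarrow> g \<longlonglongrightarrow> s \<Longrightarrow>
        (\<lambda>n. B (f n) (g n)) \<longlonglongrightarrow> B t s"
  shows "\<exists>I L. L \<ge> 0 \<and> (\<forall>s t. 0 \<le> s \<longrightarrow> s \<le> t \<longrightarrow> t \<le> T \<longrightarrow> norm (I t - S (t - s) (I s) - B t s) \<le> L * (t - s) powr \<mu>)"
proof -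
  define h where "h n = 1 / (2::real) ^ n" for n
  have h: "h n > 0" "h n = 2 * h (Suc n)" for n by (auto simp: h_def)
  define Y :: "nat \<Rightarrow> nat \<Rightarrow> 'e"
    where "Y n = rec_nat 0 (\<lambda>i y. S (h n) y + B (real (Suc i) * h n) (real i * h n))" for n
  have Y0: "Y n 0 = 0" and YS: "Y n (Suc i) = S (h n) (Y n i) + B (real (Suc i) * h n) (real i * h n)" for n i
    by (simp_all add: Y_def)
  define R where "R n i j = Y n i - S (real (i - j) * h n) (Y n j) - B (real i * h n) (real j * h n)" for n i j
  define lam :: real where "lam = (2/3) powr (\<mu> - 1)"
  have lam: "lam < 1" using \<mu> powr_less_mono2[of "\<mu> - 1" "2/3" 1] by (simp add: lam_def)
  \<comment> \<open>The defect constant \<open>C\<close> thus equals \<open>(1 - lam) * L\<close>,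
    as \<open>discrete_sewing\<close> demands. One-step residuals vanish by construction and put no
    further condition on \<open>L\<close>.\<close>
  define L where "L = C / (1 - lam)"
  have L: "L \<ge> 0" "(1 - lam) * L = C" using lam C by (auto simp: L_def)
  have R: "norm (R n i j) \<le> L * (real (i - j) * h n) powr \<mu>" if "j < i" "real i * h n \<le> T" for n i j
  proof (rule discrete_sewing[where a=0 and b=i and p=i and Q="\<lambda>i j. norm (R n i j)" and j=j and i=i])
    fix i' assume "i' < i"
    show "norm (R n (Suc i') i') \<le> L * h n powr \<mu>" using L by (simp add: R_def YS)
  next
    fix i' k j' assume *: "j' < k" "k < i'" "i' \<le> i"
    have i'T: "real i' * h n \<le> T" using * that h[of n] by (meson mult_right_mono of_nat_mono less_imp_le order_trans)
    have "R n i' j' = R n i' k + S (real (i' - k) * h n) (R n k j')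
       - (B (real i' * h n) (real j' * h n) - B (real i' * h n) (real k * h n)
          - S (real i' * h n - real k * h n) (B (real k * h n) (real j' * h n)))"
    proof -
      have "S (real (i' - k) * h n) (S (real (k - j') * h n) (Y n j')) = S (real (i' - j') * h n) (Y n j')"
        using S_S[of "real j' * h n" "real k * h n" "real i' * h n"] * h[of n]
        by (simp add: of_nat_diff left_diff_distrib)
      moreover have "real (i' - k) * h n = real i' * h n - real k * h n"
        using * by (simp add: of_nat_diff left_diff_distrib)
      ultimately show ?thesis
        unfolding R_def by (simp add: S_diff)
    qed
    moreover have "norm (B (real i' * h n) (real j' * h n) - B (real i' * h n) (real k * h n)
          - S (real i' * h n - real k * h n) (B (real k * h n) (real j' * h n))) \<le> C * (real i' * h n - real j' * h n) powr \<mu>"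
      using * h[of n] i'T by (intro dl) auto
    moreover have "real i' * h n - real j' * h n = real (i' - j') * h n"
      using * by (simp add: of_nat_diff left_diff_distrib)
    ultimately have "norm (R n i' j') \<le> norm (R n i' k) + norm (R n k j') + C * (real (i' - j') * h n) powr \<mu>"
      using norm_triangle_ineq4 norm_triangle_ineq norm_S by (smt (verit))
    then show "norm (R n i' j') \<le> norm (R n i' k) + norm (R n k j') + (1 - (2/3) powr (\<mu> - 1)) * L * (real (i' - j') * h n) powr \<mu>"
      using L(2) by (simp add: lam_def)
  qed (use \<mu> h(1) L(1) that in auto)
  \<comment> \<open>Two rates of convergence: about \<open>2 ^ n\<close> coarse steps each
    contribute a defect of order \<open>h n powr \<mu>\<close>, which leaves
    \<open>2 powr (1 - \<mu>)\<close> per level, and a single additional fine step has size of order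
    \<open>h n powr \<alpha>\<close>.\<close>
  define r where "r = max (2 powr (1 - \<mu>)) (2 powr (- \<alpha>))"
  have r: "0 \<le> r" "r < 1" "2 powr (1 - \<mu>) \<le> r" "2 powr (- \<alpha>) \<le> r"
    using \<mu> \<alpha> powr_less_mono[of _ 0 "2::real"] by (auto simp: r_def le_max_iff_disj)
  define c where "c = C * (T + 1)"
  have c: "C \<le> c" "C * T \<le> c" using C T by (auto simp: c_def algebra_simps)
  have one: "norm (Y (Suc n) (2 * k + 1) - S (1 / 2 ^ Suc n) (Y (Suc n) (2 * k))) \<le> c * r ^ n"
    if "real (2 * k + 1) / 2 ^ Suc n \<le> T" for n k
  proof -
    let ?h = "h (Suc n)"
    have "Y (Suc n) (2 * k + 1) - S (1 / 2 ^ Suc n) (Y (Suc n) (2 * k)) = B (real (Suc (2 * k)) * ?h) (real (2 * k) * ?h)"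
      using YS[of "Suc n" "2 * k"] by (simp add: h_def)
    moreover have "norm (B (real (Suc (2 * k)) * ?h) (real (2 * k) * ?h)) \<le> C * (real (Suc (2 * k)) * ?h - real (2 * k) * ?h) powr \<alpha>"
      using that h(1)[of "Suc n"] by (intro bnd) (auto simp: h_def field_simps)
    moreover have "real (Suc (2 * k)) * ?h - real (2 * k) * ?h = ?h" by (simp add: algebra_simps)
    moreover have "?h powr \<alpha> \<le> r ^ n"
    proof -
      have "?h powr \<alpha> = (2 powr (- \<alpha>)) ^ Suc n"
        by (simp add: h_def powr_divide powr_minus_divide powr_power powr_realpow[symmetric] powr_powr power_one_over mult.commute del: power_Suc)
      also have "\<dots> \<le> r ^ Suc n" using r by (intro power_mono) auto
      also have "\<dots> \<le> r ^ n" using r by (intro power_decreasing) auto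
      finally show ?thesis .
    qed
    moreover have "C * ?h powr \<alpha> \<le> c * r ^ n"
      using c C calculation(4) by (intro mult_mono) auto
    ultimately show ?thesis by (metis order_trans)
  qed
  have two: "norm (Y (Suc n) (2 * k) - Y n k) \<le> c * r ^ n" if kT: "real k / 2 ^ n \<le> T" for n k
  proof -
    have "norm (Y (Suc n) (2 * k) - Y n k) \<le> real k * (C * h n powr \<mu>)" using kT
    proof (induction k)
      case 0 then show ?case by (simp add: Y0)
    next
      case (Suc k)
      let ?h = "h (Suc n)"
      let ?t = "real (Suc k) * h n" and ?u = "real (Suc (2 * k)) * ?h" and ?s = "real k * h n"
      have e: "real (2 * k) * ?h = ?s" "real (Suc (Suc (2 * k))) * ?h = ?t" "?t - ?u = ?h" "?t - ?s = h n"
        using h(2)[of n] by (simp_all add: algebra_simps)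
      have "Y (Suc n) (2 * Suc k) - Y n (Suc k) = S (h n) (Y (Suc n) (2 * k) - Y n k)
          - (B ?t ?s - B ?t ?u - S (?t - ?u) (B ?u ?s))"
      proof -
        have "S ?h (S ?h (Y (Suc n) (2 * k))) = S (h n) (Y (Suc n) (2 * k))"
          using S_add[of ?h ?h "Y (Suc n) (2 * k)"] h(1)[of "Suc n"] unfolding h(2)[of n] by simp
        moreover have "Y (Suc n) (2 * Suc k) = S ?h (S ?h (Y (Suc n) (2 * k)) + B ?u ?s) + B ?t ?u"
          using YS[of "Suc n" "Suc (2 * k)"] YS[of "Suc n" "2 * k"] unfolding e by simp
        ultimately show ?thesis
          unfolding e(3) by (simp add: YS S_plus S_diff)
      qed
      moreover have "norm (B ?t ?s - B ?t ?u - S (?t - ?u) (B ?u ?s)) \<le> C * (?t - ?s) powr \<mu>"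
      proof (rule dl)
        show "0 \<le> ?s" using h(1)[of n] by simp
        show "?s < ?u" "?u < ?t" using e h(1)[of "Suc n"] h(2)[of n] by linarith+
        show "?t \<le> T" using Suc.prems by (simp add: h_def)
      qed
      ultimately have "norm (Y (Suc n) (2 * Suc k) - Y n (Suc k)) \<le> norm (Y (Suc n) (2 * k) - Y n k) + C * h n powr \<mu>"
        using norm_triangle_ineq4 norm_S e(4) by (smt (verit))
      moreover have "real k / 2 ^ n \<le> T" using Suc.prems by (simp add: add_divide_distrib) (smt (verit) divide_nonneg_nonneg zero_le_power)
      ultimately show ?case using Suc.IH by (simp add: algebra_simps)
    qed
    also have "\<dots> \<le> T * 2 ^ n * (C * h n powr \<mu>)"
      using kT C by (intro mult_right_mono) (auto simp: field_simps)
    also have "\<dots> = C * T * (2 powr (1 - \<mu>)) ^ n"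
      by (simp add: h_def powr_divide powr_diff power_divide powr_power powr_realpow[symmetric] powr_powr mult.commute)
    also have "\<dots> \<le> c * r ^ n"
      using c r C T by (intro mult_mono power_mono) auto
    finally show ?thesis .
  qed
  define I where "I t = lim (\<lambda>n. S (t - real (dyadic_index n t) / 2 ^ n) (Y n (dyadic_index n t)))" for t
  have I: "(\<lambda>n. S (t - real (dyadic_index n t) / 2 ^ n) (Y n (dyadic_index n t))) \<longlonglongrightarrow> I t" if "t \<in> {0..T}" for t
    using dyadic_limit[OF r(1,2) one two that, where ?n0.0=0] unfolding I_def convergent_LIMSEQ_iff by blast
  have "norm (I t - S (t - s) (I s) - B t s) \<le> L * (t - s) powr \<mu>" if st: "0 \<le> s" "s \<le> t" "t \<le> T" for s t
  proof (cases "s = t")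
    case True
    then show ?thesis using bnd[of t t] st \<alpha> by simp
  next
    case False
    define t' s' where "t' = (\<lambda>n. real (dyadic_index n t) / 2 ^ n)" and "s' = (\<lambda>n. real (dyadic_index n s) / 2 ^ n)"
    have lim: "t' \<longlonglongrightarrow> t" "s' \<longlonglongrightarrow> s" unfolding t'_def s'_def using dyadic_index_tendsto st by auto
    have le: "0 \<le> s' n \<and> s' n \<le> t' n \<and> t' n \<le> T" for n
      using st dyadic_index_le[of t n] dyadic_index_mono[of s t n]
      by (auto simp: t'_def s'_def divide_right_mono)
    have ev: "\<forall>\<^sub>F n in sequentially. s' n < t' n"
    proof -
      have "(\<lambda>n. t' n - s' n) \<longlonglongrightarrow> t - s" by (intro tendsto_diff lim)
      from order_tendstoD(1)[OF this, of 0] show ?thesis using False st by simp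
    qed
    show ?thesis
    proof (rule dyadic_limit_residual[OF st(1,2) I I])
      show "(\<lambda>n. B (t' n) (s' n)) \<longlonglongrightarrow> B t s" by (rule cont[OF le lim])
      show "(\<lambda>n. L * (t' n - s' n) powr \<mu>) \<longlonglongrightarrow> L * (t - s) powr \<mu>"
        using False st by (intro tendsto_intros lim) auto
      show "\<forall>\<^sub>F n in sequentially. norm (Y n (dyadic_index n t)
        - S (real (dyadic_index n t - dyadic_index n s) * (1 / 2 ^ n)) (Y n (dyadic_index n s)) - B (t' n) (s' n)) \<le> L * (t' n - s' n) powr \<mu>"
        using ev
      proof eventually_elim
        case (elim n)
        then have "dyadic_index n s < dyadic_index n t" by (simp add: s'_def t'_def divide_less_cancel)
        moreover have "real (dyadic_index n t - dyadic_index n s) * h n = t' n - s' n"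
          using calculation by (simp add: t'_def s'_def h_def of_nat_diff diff_divide_distrib)
        ultimately show ?case
          using R[of "dyadic_index n s" "dyadic_index n t" n] le[of n]
          by (simp add: R_def t'_def s'_def h_def)
      qed
    qed (use st in auto)
  qed
  then show ?thesis using L by blast
qed

end

section \<open>Rough equations in a Banach space with a contraction semigroup\<close>

lemma norm_add3_le:
  "norm a \<le> x \<Longrightarrow> norm b \<le> y \<Longrightarrow> norm c \<le> z \<Longrightarrow> norm (a + b + c) \<le> x + y + z"
  by (intro norm_triangle_le add_mono) auto

lemma le_powr_self:
  fixes x a :: real
  shows "0 < x \<Longrightarrow> x \<le> 1 \<Longrightarrow> a \<le> 1 \<Longrightarrow> x \<le> x powr a"
  using powr_mono'[of a 1 x] by simp

lemma powr_le_self: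
  fixes x a :: real
  shows "0 < x \<Longrightarrow> x \<le> 1 \<Longrightarrow> 1 \<le> a \<Longrightarrow> x powr a \<le> x"
  using powr_mono'[of 1 a x] by simp

lemma powr_square: "(x powr a)\<^sup>2 = x powr (2 * a)" for x a :: real
  by (simp add: power2_eq_square powr_add[symmetric])

text \<open>A block of \<open>p\<close> steps fills at least half of \<epsilon>, so the number of
  blocks in \<open>[0, T]\<close> is bounded independently of \<open>h\<close>. The last clause
  allows passing between a bound on lengths and a bound on index gaps.\<close>

lemma block_length:
  fixes h \<epsilon> :: real
  assumes h: "0 < h" "h \<le> \<epsilon>"
  shows "\<exists>p. 1 \<le> p \<and> real p * h \<le> \<epsilon> \<and> \<epsilon> \<le> 2 * (real p * h) \<and> (\<forall>m. real m * h \<le> \<epsilon> \<longrightarrow> m \<le> p)"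
proof -
  define p where "p = nat \<lfloor>\<epsilon> / h\<rfloor>"
  have "1 \<le> \<epsilon> / h" using h by simp
  then have fl: "1 \<le> \<lfloor>\<epsilon> / h\<rfloor>" by linarith
  have rp: "real p = of_int \<lfloor>\<epsilon> / h\<rfloor>" using fl by (simp add: p_def)
  have p1: "1 \<le> p" using fl unfolding p_def by linarith
  have "real p * h \<le> \<epsilon>" using h unfolding rp by (simp add: pos_le_divide_eq[symmetric])
  moreover have "\<epsilon> \<le> 2 * (real p * h)"
  proof -
    have "\<epsilon> / h < real p + 1" unfolding rp by linarith
    also have "\<dots> \<le> 2 * real p" using p1 by simp
    finally show ?thesis using h by (simp add: field_simps)
  qed
  moreover have "m \<le> p" if "real m * h \<le> \<epsilon>" for m
  proof -
    have "real_of_int (int m) \<le> \<epsilon> / h" using h that by (simp add: field_simps)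
    then have "int m \<le> \<lfloor>\<epsilon> / h\<rfloor>" by (simp add: le_floor_iff)
    then show ?thesis by (simp add: p_def)
  qed
  ultimately show ?thesis using p1 by blast
qed

text \<open>\<open>A\<close>, \<open>X\<close> and \<open>Z\<close> are the actions of \<open>x1\<close>, \<open>x2\<close> and \<open>x3\<close> on coefficients. The Chen relation of \<open>X\<close> is only
  required on the values of \<open>G\<close>, where the tensor product can be written as \<open>A\<close> applied to
  \<open>DF y (ell (A u s (F y)))\<close>.\<close>
locale rough_system = contraction_semigroup S
  for S :: "real \<Rightarrow> 'e::banach \<Rightarrow> 'e" +
  fixes ell :: "'e \<Rightarrow> 'v::real_normed_vector"
    and A :: "real \<Rightarrow> real \<Rightarrow> 'w::real_normed_vector \<Rightarrow> 'e"
    and X :: "real \<Rightarrow> real \<Rightarrow> 'x::real_normed_vector \<Rightarrow> 'e"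
    and Z :: "real \<Rightarrow> real \<Rightarrow> real \<Rightarrow> 'x \<Rightarrow> 'e"
    and F :: "'v \<Rightarrow> 'w" and DF :: "'v \<Rightarrow> 'v \<Rightarrow> 'w" and G :: "'v \<Rightarrow> 'x"
    and a0 :: 'v and T K \<gamma> :: real
  assumes T: "T > 0" and K: "K \<ge> 1" and \<gamma>: "1/3 < \<gamma>" "\<gamma> < 1/2"
    and ell_linear: "linear ell" and norm_ell: "norm (ell x) \<le> norm x"
    and ell_S: "0 \<le> t \<Longrightarrow> norm (ell (S t x) - ell x) \<le> t * norm x"
    and A_linear: "0 \<le> s \<Longrightarrow> s \<le> t \<Longrightarrow> t \<le> T \<Longrightarrow> linear (A t s)"
    and X_linear: "0 \<le> s \<Longrightarrow> s \<le> t \<Longrightarrow> t \<le> T \<Longrightarrow> linear (X t s)"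
    and Z_linear: "0 \<le> s \<Longrightarrow> s < u \<Longrightarrow> u < t \<Longrightarrow> t \<le> T \<Longrightarrow> linear (Z t u s)"
    and norm_A: "0 \<le> s \<Longrightarrow> s \<le> t \<Longrightarrow> t \<le> T \<Longrightarrow> norm (A t s w) \<le> K * (t - s) powr \<gamma> * norm w"
    and norm_X: "0 \<le> s \<Longrightarrow> s \<le> t \<Longrightarrow> t \<le> T \<Longrightarrow> norm (X t s g) \<le> K * ((t - s) powr \<gamma>)\<^sup>2 * norm g"
    and norm_Z: "0 \<le> s \<Longrightarrow> s < u \<Longrightarrow> u < t \<Longrightarrow> t \<le> T \<Longrightarrow>
        norm (Z t u s g) \<le> K * ((t - s) powr \<gamma>) ^ 3 * norm g"
    and A_chen: "0 \<le> s \<Longrightarrow> s < u \<Longrightarrow> u < t \<Longrightarrow> t \<le> T \<Longrightarrow> A t s w = A t u w + S (t - u) (A u s w)"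
    and X_chen: "0 \<le> s \<Longrightarrow> s < u \<Longrightarrow> u < t \<Longrightarrow> t \<le> T \<Longrightarrow>
        X t s (G y) = X t u (G y) + S (t - u) (X u s (G y)) + A t u (DF y (ell (A u s (F y)))) + Z t u s (G y)"
    and A_cont: "(\<And>n. 0 \<le> b n \<and> b n \<le> a n \<and> a n \<le> T) \<Longrightarrow> a \<longlonglongrightarrow> t \<Longrightarrow> b \<longlonglongrightarrow> s \<Longrightarrow>
        (\<lambda>n. A (a n) (b n) w) \<longlonglongrightarrow> A t s w"
    and X_cont: "(\<And>n. 0 \<le> b n \<and> b n \<le> a n \<and> a n \<le> T) \<Longrightarrow> a \<longlonglongrightarrow> t \<Longrightarrow> b \<longlonglongrightarrow> s \<Longrightarrow>
        (\<lambda>n. X (a n) (b n) g) \<longlonglongrightarrow> X t s g"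
    and F_bounded: "norm (F y) \<le> K"
    and F_lip: "norm (F y - F y') \<le> K * norm (y - y')"
    and DF_linear: "linear (DF y)"
    and norm_DF: "norm (DF y v) \<le> K * norm v"
    and DF_lip: "norm (DF y v - DF y' v) \<le> K * norm (y - y') * norm v"
    and F_taylor: "norm (F (y + v) - F y - DF y v) \<le> K * (norm v)\<^sup>2"
    and F_taylor_diff: "norm ((F (y + v) - F y - DF y v) - (F (y' + v') - F y' - DF y' v'))
        \<le> K * ((norm v + norm v') * norm (v - v') + norm (y - y') * (norm v)\<^sup>2)"
    and G_bounded: "norm (G y) \<le> K"
    and G_lip: "norm (G y - G y') \<le> K * norm (y - y')"
    and G_diff: "norm ((G (y + v) - G y) - (G (y' + v') - G y')) \<le> K * (norm (v - v') + norm (y - y') * norm v)"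
begin

lemmas ell_diff = linear_diff[OF ell_linear]
lemmas ell_plus = linear_add[OF ell_linear]

section \<open>Residual, observed remainder and splitting defect\<close>

definition pt :: "'e \<Rightarrow> 'v" where "pt g = a0 + ell g"

text \<open>One step of a second-order scheme of Milstein type; the state enters only through its
  observation \<open>pt g\<close>.\<close>

definition B :: "real \<Rightarrow> real \<Rightarrow> 'e \<Rightarrow> 'e" where
  "B t s g = A t s (F (pt g)) + X t s (G (pt g))"

definition res :: "real \<Rightarrow> real \<Rightarrow> 'e \<Rightarrow> 'e \<Rightarrow> 'e" where
  "res t s gt gs = gt - S (t - s) gs - B t s gs"

text \<open>The remainder of the observed path in its controlled decomposition with derivative
  \<open>F\<close>.\<close>

definition rho :: "real \<Rightarrow> real \<Rightarrow> 'e \<Rightarrow> 'e \<Rightarrow> 'v" where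
  "rho u s gu gs = ell (gu - gs) - ell (A u s (F (pt gs)))"

text \<open>Splitting leaves \<open>F (pt gu) - F (pt gs)\<close> minus the term
  \<open>DF (pt gs) (ell (A u s (F (pt gs))))\<close> of the Chen relation. Writing the argument of
  \<open>DF\<close> as the observed increment minus \<open>rho\<close> turns this into a Taylor
  remainder plus \<open>DF\<close> of \<open>rho\<close>, both of second order in the
  driver.\<close>

definition defect :: "real \<Rightarrow> real \<Rightarrow> real \<Rightarrow> 'e \<Rightarrow> 'e \<Rightarrow> 'e" where
  "defect t u s gu gs =
     A t u ((F (pt gs + ell (gu - gs)) - F (pt gs) - DF (pt gs) (ell (gu - gs))) + DF (pt gs) (rho u s gu gs))
     + X t u (G (pt gs + ell (gu - gs)) - G (pt gs)) - Z t u s (G (pt gs))"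

lemma pt_diff: "pt g - pt g' = ell (g - g')"
  by (simp add: pt_def ell_diff)

lemma norm_pt_diff: "norm (pt g - pt g') \<le> norm (g - g')"
  by (simp add: pt_diff norm_ell)

lemma res_split:
  assumes "0 \<le> s" "s < u" "u < t" "t \<le> T"
  shows "res t s gt gs = res t u gt gu + S (t - u) (res u s gu gs) + defect t u s gu gs"
proof -
  have A: "linear (A t u)" "linear (A u s)" "linear (X t u)" using A_linear X_linear assms by auto
  have e: "pt gs + ell (gu - gs) = pt gu" by (simp add: pt_def ell_diff)
  show ?thesis
    using S_S[of s u t gs] assms X_chen[OF assms, of "pt gs"] A_chen[OF assms, of "F (pt gs)"]
    unfolding res_def defect_def B_def e rho_def
    by (simp add: S_diff S_plus linear_diff[OF A(1)] linear_add[OF A(1)] linear_diff[OF A(3)]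
        linear_diff[OF DF_linear] algebra_simps)
qed

text \<open>Only the last summand grows with the state, and \<open>ell_S\<close> grants it a full
  power of the time step.\<close>

lemma rho_eq: "rho u s gu gs = ell (X u s (G (pt gs))) + ell (res u s gu gs) + (ell (S (u - s) gs) - ell gs)"
  by (simp add: rho_def res_def B_def ell_diff ell_plus)

lemma delta_eq: "ell (gu - gs) = ell (A u s (F (pt gs))) + rho u s gu gs"
  by (simp add: rho_def)

lemma norm_A_le: "0 \<le> s \<Longrightarrow> s \<le> t \<Longrightarrow> t \<le> T \<Longrightarrow> norm w \<le> c \<Longrightarrow> norm (A t s w) \<le> K * (t - s) powr \<gamma> * c"
  using K by (intro order_trans[OF norm_A mult_left_mono]) auto

lemma norm_X_le: "0 \<le> s \<Longrightarrow> s \<le> t \<Longrightarrow> t \<le> T \<Longrightarrow> norm w \<le> c \<Longrightarrow> norm (X t s w) \<le> K * ((t - s) powr \<gamma>)\<^sup>2 * c"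
  using K by (intro order_trans[OF norm_X mult_left_mono]) auto

lemma norm_Z_le: "0 \<le> s \<Longrightarrow> s < u \<Longrightarrow> u < t \<Longrightarrow> t \<le> T \<Longrightarrow> norm w \<le> c \<Longrightarrow>
    norm (Z t u s w) \<le> K * ((t - s) powr \<gamma>) ^ 3 * c"
  using K by (intro order_trans[OF norm_Z mult_left_mono]) auto

lemma rho_bound:
  assumes "0 \<le> s" "s < u" "u \<le> T"
  shows "norm (rho u s gu gs) \<le> K\<^sup>2 * ((u - s) powr \<gamma>)\<^sup>2 + norm (res u s gu gs) + (u - s) * norm gs"
proof -
  have "norm (ell (X u s (G (pt gs)))) \<le> K * ((u - s) powr \<gamma>)\<^sup>2 * K"
    using assms by (intro order_trans[OF norm_ell norm_X_le] G_bounded) auto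
  moreover have "norm (ell (res u s gu gs)) \<le> norm (res u s gu gs)" by (rule norm_ell)
  moreover have "norm (ell (S (u - s) gs) - ell gs) \<le> (u - s) * norm gs"
    using assms by (intro ell_S) auto
  ultimately show ?thesis unfolding rho_eq
    by (intro norm_add3_le) (simp_all add: power2_eq_square mult_ac)
qed

lemma delta_bound:
  assumes "0 \<le> s" "s < u" "u \<le> T"
  shows "norm (ell (gu - gs)) \<le> K\<^sup>2 * (u - s) powr \<gamma> + norm (rho u s gu gs)"
proof -
  have "norm (ell (A u s (F (pt gs)))) \<le> K * (u - s) powr \<gamma> * K"
    using assms by (intro order_trans[OF norm_ell norm_A_le] F_bounded) auto
  then show ?thesis unfolding delta_eq[of gu gs u s]
    by (intro norm_triangle_le) (simp add: power2_eq_square mult_ac)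
qed

lemma rho_diff:
  assumes "0 \<le> s" "s < u" "u \<le> T"
  shows "norm (rho u s gu gs - rho u s gu' gs') \<le> K\<^sup>2 * ((u - s) powr \<gamma>)\<^sup>2 * norm (gs - gs')
     + norm (res u s gu gs - res u s gu' gs') + (u - s) * norm (gs - gs')"
proof -
  have X: "linear (X u s)" using X_linear assms by auto
  have "norm (G (pt gs) - G (pt gs')) \<le> K * norm (gs - gs')"
    using K by (intro order_trans[OF G_lip] mult_left_mono norm_pt_diff) auto
  then have "norm (ell (X u s (G (pt gs) - G (pt gs')))) \<le> K * ((u - s) powr \<gamma>)\<^sup>2 * (K * norm (gs - gs'))"
    using assms by (intro order_trans[OF norm_ell norm_X_le]) auto
  moreover have "norm (ell (res u s gu gs - res u s gu' gs')) \<le> norm (res u s gu gs - res u s gu' gs')" by (rule norm_ell)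
  moreover have "norm (ell (S (u - s) (gs - gs')) - ell (gs - gs')) \<le> (u - s) * norm (gs - gs')"
    using assms by (intro ell_S) auto
  moreover have "rho u s gu gs - rho u s gu' gs' = ell (X u s (G (pt gs) - G (pt gs')))
      + ell (res u s gu gs - res u s gu' gs') + (ell (S (u - s) (gs - gs')) - ell (gs - gs'))"
    unfolding rho_eq by (simp add: ell_diff linear_diff[OF X] S_diff)
  ultimately show ?thesis
    by (simp only:) (intro norm_add3_le, simp_all add: power2_eq_square mult_ac)
qed

lemma delta_diff:
  assumes "0 \<le> s" "s < u" "u \<le> T"
  shows "norm (ell (gu - gs) - ell (gu' - gs')) \<le> K\<^sup>2 * (u - s) powr \<gamma> * norm (gs - gs')
     + norm (rho u s gu gs - rho u s gu' gs')"
proof -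
  have A: "linear (A u s)" using A_linear assms by auto
  have "norm (F (pt gs) - F (pt gs')) \<le> K * norm (gs - gs')"
    using K by (intro order_trans[OF F_lip] mult_left_mono norm_pt_diff) auto
  then have "norm (ell (A u s (F (pt gs) - F (pt gs')))) \<le> K * (u - s) powr \<gamma> * (K * norm (gs - gs'))"
    using assms by (intro order_trans[OF norm_ell norm_A_le]) auto
  moreover have "ell (gu - gs) - ell (gu' - gs') = ell (A u s (F (pt gs) - F (pt gs')))
      + (rho u s gu gs - rho u s gu' gs')"
    unfolding delta_eq[of gu gs u s] delta_eq[of gu' gs' u s] by (simp add: ell_diff linear_diff[OF A])
  ultimately show ?thesis
    by (simp only:) (intro norm_triangle_le, simp add: power2_eq_square mult_ac)
qed

text \<open>With \<open>d\<close> of order \<open>w\<close> and \<open>r\<close> of order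
  \<open>w\<^sup>2\<close> every term is cubic in \<open>w\<close>, that is, of order 3\<gamma> > 1
  in time.\<close>

lemma defect_bound:
  assumes st: "0 \<le> s" "s < u" "u < t" "t \<le> T"
    and d: "norm (ell (gu - gs)) \<le> d" and r: "norm (rho u s gu gs) \<le> r"
    and w: "(t - s) powr \<gamma> \<le> w"
  shows "norm (defect t u s gu gs) \<le> K\<^sup>2 * w * (d\<^sup>2 + r) + K\<^sup>2 * w\<^sup>2 * d + K\<^sup>2 * w ^ 3"
proof -
  have d0: "0 \<le> d" "0 \<le> r" "0 \<le> K" using d r K order_trans[OF norm_ge_zero] by auto
  have "(t - u) powr \<gamma> \<le> (t - s) powr \<gamma>" using st \<gamma> by (intro powr_mono2) auto
  then have wtu: "(t - u) powr \<gamma> \<le> w" "((t - u) powr \<gamma>)\<^sup>2 \<le> w\<^sup>2" "((t - s) powr \<gamma>) ^ 3 \<le> w ^ 3" "0 \<le> w"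
    using w by (auto intro!: power_mono intro: order_trans[OF powr_ge_zero w])
  let ?v = "ell (gu - gs)" and ?y = "pt gs"
  have "norm (F (?y + ?v) - F ?y - DF ?y ?v) \<le> K * d\<^sup>2"
    using d0 d by (intro order_trans[OF F_taylor] mult_left_mono power_mono) auto
  moreover have "norm (DF ?y (rho u s gu gs)) \<le> K * r"
    using d0 r by (intro order_trans[OF norm_DF] mult_left_mono) auto
  ultimately have "norm ((F (?y + ?v) - F ?y - DF ?y ?v) + DF ?y (rho u s gu gs)) \<le> K * (d\<^sup>2 + r)"
    by (intro norm_triangle_le) (simp add: distrib_left)
  then have 1: "norm (A t u ((F (?y + ?v) - F ?y - DF ?y ?v) + DF ?y (rho u s gu gs))) \<le> K * (t - u) powr \<gamma> * (K * (d\<^sup>2 + r))"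
    using st by (intro norm_A_le) auto
  have "norm (G (?y + ?v) - G ?y) \<le> K * d"
    using G_lip[of "?y + ?v" ?y] d d0 by (smt (verit) add_diff_cancel_left' mult_left_mono)
  then have 2: "norm (X t u (G (?y + ?v) - G ?y)) \<le> K * ((t - u) powr \<gamma>)\<^sup>2 * (K * d)"
    using st by (intro norm_X_le) auto
  have 3: "norm (Z t u s (G ?y)) \<le> K * ((t - s) powr \<gamma>) ^ 3 * K"
    using st by (intro norm_Z_le G_bounded) auto
  have "norm (defect t u s gu gs) \<le> K * (t - u) powr \<gamma> * (K * (d\<^sup>2 + r)) + K * ((t - u) powr \<gamma>)\<^sup>2 * (K * d)
     + K * ((t - s) powr \<gamma>) ^ 3 * K"
    unfolding defect_def using 1 2 3 by (intro order_trans[OF norm_triangle_ineq4] add_mono norm_triangle_le) auto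
  also have "\<dots> \<le> K * w * (K * (d\<^sup>2 + r)) + K * w\<^sup>2 * (K * d) + K * w ^ 3 * K"
    using wtu d0 by (intro add_mono mult_right_mono mult_left_mono) auto
  finally show ?thesis by (simp add: power2_eq_square mult_ac)
qed

text \<open>Every term carries exactly one factor that compares the two paths: \<open>dd\<close>,
  \<open>rr\<close> or \<open>m\<close>. The estimate is therefore linear in the distance of the
  paths, while it remains cubic in \<open>w\<close> once \<open>dd\<close> and \<open>rr\<close> are
  of first and second order.\<close>

lemma defect_diff:
  assumes st: "0 \<le> s" "s < u" "u < t" "t \<le> T"
    and d: "norm (ell (gu - gs)) \<le> d" "norm (ell (gu' - gs')) \<le> d" and r: "norm (rho u s gu' gs') \<le> r"
    and dd: "norm (ell (gu - gs) - ell (gu' - gs')) \<le> dd"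
    and rr: "norm (rho u s gu gs - rho u s gu' gs') \<le> rr"
    and m: "norm (gs - gs') \<le> m"
    and w: "(t - s) powr \<gamma> \<le> w"
  shows "norm (defect t u s gu gs - defect t u s gu' gs')
     \<le> K\<^sup>2 * w * (2 * d * dd + m * d\<^sup>2 + rr + m * r) + K\<^sup>2 * w\<^sup>2 * (dd + m * d) + K\<^sup>2 * w ^ 3 * m"
proof -
  have d0: "0 \<le> d" "0 \<le> r" "0 \<le> K" "0 \<le> dd" "0 \<le> rr" "0 \<le> m"
    using d r K dd rr m order_trans[OF norm_ge_zero] by auto
  have "(t - u) powr \<gamma> \<le> (t - s) powr \<gamma>" using st \<gamma> by (intro powr_mono2) auto
  then have wtu: "(t - u) powr \<gamma> \<le> w" "((t - u) powr \<gamma>)\<^sup>2 \<le> w\<^sup>2" "((t - s) powr \<gamma>) ^ 3 \<le> w ^ 3" "0 \<le> w"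
    using w by (auto intro!: power_mono intro: order_trans[OF powr_ge_zero w])
  have lin: "linear (A t u)" "linear (X t u)" "linear (Z t u s)" using A_linear X_linear Z_linear st by auto
  let ?v = "ell (gu - gs)" and ?y = "pt gs" and ?v' = "ell (gu' - gs')" and ?y' = "pt gs'"
  let ?p = "rho u s gu gs" and ?p' = "rho u s gu' gs'"
  let ?F = "F (?y + ?v) - F ?y - DF ?y ?v" and ?F' = "F (?y' + ?v') - F ?y' - DF ?y' ?v'"
  let ?G = "G (?y + ?v) - G ?y" and ?G' = "G (?y' + ?v') - G ?y'"
  have ym: "norm (?y - ?y') \<le> m" using norm_pt_diff m by (rule order_trans)
  have "norm (?F - ?F') \<le> K * (2 * d * dd + m * d\<^sup>2)"
    using d0 d dd ym by (intro order_trans[OF F_taylor_diff] mult_left_mono power_mono add_mono mult_mono) auto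
  moreover have "norm (DF ?y (?p - ?p')) \<le> K * rr"
    using d0 rr by (intro order_trans[OF norm_DF] mult_left_mono) auto
  moreover have "norm (DF ?y ?p' - DF ?y' ?p') \<le> K * m * r"
    using d0 r ym by (intro order_trans[OF DF_lip] mult_mono) auto
  ultimately have "norm (?F - ?F' + DF ?y (?p - ?p') + (DF ?y ?p' - DF ?y' ?p')) \<le> K * (2 * d * dd + m * d\<^sup>2 + rr + m * r)"
    using norm_add3_le by (fastforce simp: distrib_left mult.assoc)
  then have 1: "norm (A t u (?F - ?F' + DF ?y (?p - ?p') + (DF ?y ?p' - DF ?y' ?p')))
     \<le> K * (t - u) powr \<gamma> * (K * (2 * d * dd + m * d\<^sup>2 + rr + m * r))"
    using st by (intro norm_A_le) auto
  have "norm (?G - ?G') \<le> K * (dd + m * d)"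
    using d0 d dd ym by (intro order_trans[OF G_diff] mult_left_mono add_mono mult_mono) auto
  then have 2: "norm (X t u (?G - ?G')) \<le> K * ((t - u) powr \<gamma>)\<^sup>2 * (K * (dd + m * d))"
    using st by (intro norm_X_le) auto
  have "norm (G ?y - G ?y') \<le> K * m"
    using d0 ym by (intro order_trans[OF G_lip] mult_left_mono) auto
  then have 3: "norm (Z t u s (G ?y - G ?y')) \<le> K * ((t - s) powr \<gamma>) ^ 3 * (K * m)"
    using st by (intro norm_Z_le) auto
  have "defect t u s gu gs - defect t u s gu' gs' = A t u (?F - ?F' + DF ?y (?p - ?p') + (DF ?y ?p' - DF ?y' ?p'))
     + X t u (?G - ?G') - Z t u s (G ?y - G ?y')"
    unfolding defect_def
    by (simp add: linear_diff[OF lin(1)] linear_add[OF lin(1)] linear_diff[OF lin(2)]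
        linear_diff[OF lin(3)] linear_diff[OF DF_linear])
  then have "norm (defect t u s gu gs - defect t u s gu' gs') \<le>
     K * (t - u) powr \<gamma> * (K * (2 * d * dd + m * d\<^sup>2 + rr + m * r)) + K * ((t - u) powr \<gamma>)\<^sup>2 * (K * (dd + m * d))
     + K * ((t - s) powr \<gamma>) ^ 3 * (K * m)"
    using 1 2 3 by (simp only:) (intro order_trans[OF norm_triangle_ineq4] add_mono norm_triangle_le, auto)
  also have "\<dots> \<le> K * w * (K * (2 * d * dd + m * d\<^sup>2 + rr + m * r)) + K * w\<^sup>2 * (K * (dd + m * d)) + K * w ^ 3 * (K * m)"
    using wtu d0 by (intro add_mono mult_right_mono mult_left_mono) auto
  finally show ?thesis by (simp add: power2_eq_square mult_ac)
qed

lemma B_bound: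
  assumes "0 \<le> s" "s \<le> t" "t \<le> T"
  shows "norm (B t s g) \<le> K\<^sup>2 * ((t - s) powr \<gamma> + ((t - s) powr \<gamma>)\<^sup>2)"
proof -
  have "norm (A t s (F (pt g))) \<le> K * (t - s) powr \<gamma> * K" "norm (X t s (G (pt g))) \<le> K * ((t - s) powr \<gamma>)\<^sup>2 * K"
    using assms by (auto intro!: norm_A_le norm_X_le F_bounded G_bounded)
  then show ?thesis unfolding B_def
    by (intro norm_triangle_le) (simp add: power2_eq_square algebra_simps)
qed

lemma B_diff:
  assumes "0 \<le> s" "s \<le> t" "t \<le> T"
  shows "norm (B t s g - B t s g') \<le> K\<^sup>2 * ((t - s) powr \<gamma> + ((t - s) powr \<gamma>)\<^sup>2) * norm (g - g')"
proof -
  have lin: "linear (A t s)" "linear (X t s)" using A_linear X_linear assms by auto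
  have "norm (A t s (F (pt g) - F (pt g'))) \<le> K * (t - s) powr \<gamma> * (K * norm (g - g'))"
    using assms K by (intro norm_A_le order_trans[OF F_lip] mult_left_mono norm_pt_diff) auto
  moreover have "norm (X t s (G (pt g) - G (pt g'))) \<le> K * ((t - s) powr \<gamma>)\<^sup>2 * (K * norm (g - g'))"
    using assms K by (intro norm_X_le order_trans[OF G_lip] mult_left_mono norm_pt_diff) auto
  moreover have "B t s g - B t s g' = A t s (F (pt g) - F (pt g')) + X t s (G (pt g) - G (pt g'))"
    unfolding B_def by (simp add: linear_diff[OF lin(1)] linear_diff[OF lin(2)])
  ultimately show ?thesis
    by (simp only:) (intro norm_triangle_le, simp add: power2_eq_square algebra_simps)
qed

section \<open>A priori bound and stability of discrete paths\<close>

abbreviation gres :: "real \<Rightarrow> (nat \<Rightarrow> 'e) \<Rightarrow> nat \<Rightarrow> nat \<Rightarrow> 'e" where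
  "gres h Y i j \<equiv> res (real i * h) (real j * h) (Y i) (Y j)"

abbreviation grho :: "real \<Rightarrow> (nat \<Rightarrow> 'e) \<Rightarrow> nat \<Rightarrow> nat \<Rightarrow> 'v" where
  "grho h Y k j \<equiv> rho (real k * h) (real j * h) (Y k) (Y j)"

abbreviation gdefect :: "real \<Rightarrow> (nat \<Rightarrow> 'e) \<Rightarrow> nat \<Rightarrow> nat \<Rightarrow> nat \<Rightarrow> 'e" where
  "gdefect h Y i k j \<equiv> defect (real i * h) (real k * h) (real j * h) (Y k) (Y j)"

text \<open>The common ground of Euler schemes, of finer schemes restricted to a coarser grid and of
  exact solutions sampled on a grid; stability is proved for all of them at once.\<close>

definition approx_path :: "real \<Rightarrow> nat \<Rightarrow> real \<Rightarrow> real \<Rightarrow> real \<Rightarrow> real \<Rightarrow> (nat \<Rightarrow> 'e) \<Rightarrow> bool" where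
  "approx_path h N M L \<nu> \<epsilon> Y \<longleftrightarrow> (\<forall>i\<le>N. norm (Y i) \<le> M) \<and>
      (\<forall>i\<le>N. \<forall>j<i. real (i - j) * h \<le> \<epsilon> \<longrightarrow>
          norm (gres h Y i j) \<le> L * (real (i - j) * h) powr \<nu>)"

text \<open>Induction on the number of grid steps: residual bounds up to index \<open>n\<close>
  bound the state up to \<open>n\<close>. That suffices for residuals up to \<open>Suc n\<close>,
  because the observed remainder on a left piece involves the size of the state only at its left
  end.\<close>

lemma euler_bound:
  "\<exists>\<epsilon> L M. 0 < \<epsilon> \<and> \<epsilon> \<le> 1 \<and> 0 \<le> L \<and> 0 \<le> M \<and>
    (\<forall>h Y N. 0 < h \<longrightarrow> h \<le> \<epsilon> \<longrightarrow> real N * h \<le> T \<longrightarrow> Y 0 = 0 \<longrightarrow>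
      (\<forall>i<N. Y (Suc i) = S h (Y i) + B (real (Suc i) * h) (real i * h) (Y i)) \<longrightarrow>
      approx_path h N M L (3 * \<gamma>) \<epsilon> Y)"
proof -
  define lam :: real where "lam = (2/3) powr (3 * \<gamma> - 1)"
  have lam: "lam < 1" using \<gamma> powr_less_mono2[of "3 * \<gamma> - 1" "2/3" 1] by (simp add: lam_def)
  \<comment> \<open>In units of suitable powers of \<open>e\<close> below, \<open>c0\<close> bounds
    the growth over one block, \<open>c3\<close> the state, \<open>c4\<close> the observed remainder
    (driver, residual and drift), \<open>c5\<close> the observed increment and \<open>c6\<close> the
    defect.\<close>
  define c0 where "c0 = 2 * K\<^sup>2 + 1"
  define c3 where "c3 = c0 * (1 + 2 * T)"
  define c4 where "c4 = K\<^sup>2 + 1 + c3"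
  define c5 where "c5 = K\<^sup>2 + c4"
  define c6 where "c6 = K\<^sup>2 * (c5\<^sup>2 + c4 + c5 + 1)"
  have c: "c0 \<ge> 1" "c3 \<ge> 0" "c4 \<ge> 1" "c5 \<ge> 1" "c6 > 0" "K\<^sup>2 \<ge> 0"
    using K T unfolding c6_def c5_def c4_def c3_def c0_def
    by (auto intro!: mult_pos_pos add_nonneg_pos add_nonneg_nonneg mult_nonneg_nonneg)
  \<comment> \<open>\<open>e\<close> is the block length on the scale of the driver,
    \<open>\<epsilon> powr \<gamma>\<close>. The only smallness needed is
    \<open>c6 * e \<le> 1 - lam\<close>.\<close>
  define e where "e = min 1 ((1 - lam) / c6)"
  have e: "0 < e" "e \<le> 1" "c6 * e \<le> 1 - lam"
    using lam c by (auto simp: e_def min_def field_simps)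
  define \<epsilon> where "\<epsilon> = e powr (1 / \<gamma>)"
  have \<epsilon>: "0 < \<epsilon>" "\<epsilon> \<le> 1" "\<epsilon> powr \<gamma> = e"
    using e \<gamma> by (auto simp: \<epsilon>_def powr_powr intro: powr_le1)
  \<comment> \<open>Over a full block the residual is then at most \<open>L * e ^ 3 = e\<close>,
    comparable with the driver term, and the defect constant \<open>c6 / e\<close> stays below
    \<open>(1 - lam) * L\<close>.\<close>
  define L where "L = 1 / e\<^sup>2"
  \<comment> \<open>Each block adds at most \<open>c0 * e\<close> to the state, and at most
    \<open>2 * T / \<epsilon>\<close> blocks have to be counted.\<close>
  define M where "M = c3 * e / \<epsilon>"
  have LM: "0 \<le> L" "0 \<le> M" using e c \<epsilon> by (auto simp: L_def M_def)
  have main: "approx_path h N M L (3 * \<gamma>) \<epsilon> Y"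
    if h: "0 < h" "h \<le> \<epsilon>" and NT: "real N * h \<le> T" and Y0: "Y 0 = 0"
      and YS: "\<And>i. i < N \<Longrightarrow> Y (Suc i) = S h (Y i) + B (real (Suc i) * h) (real i * h) (Y i)"
    for h N and Y :: "nat \<Rightarrow> 'e"
  proof -
    obtain p :: nat where p1: "1 \<le> p" and ple: "real p * h \<le> \<epsilon>" and pge: "\<epsilon> \<le> 2 * (real p * h)"
      and pmax: "\<And>m. real m * h \<le> \<epsilon> \<Longrightarrow> m \<le> p"
      using block_length[OF h] by blast
    have close: "real (i - j) * h \<le> \<epsilon> \<longleftrightarrow> i \<le> j + p" if "j < i" for i j
    proof
      assume "i \<le> j + p"
      then have "real (i - j) * h \<le> real p * h" using h by (intro mult_right_mono) auto
      then show "real (i - j) * h \<le> \<epsilon>" using ple by simp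
    next
      assume "real (i - j) * h \<le> \<epsilon>"
      then show "i \<le> j + p" using pmax[of "i - j"] by simp
    qed
    let ?bd = "\<lambda>n. \<forall>i\<le>n. \<forall>j<i. i \<le> j + p \<longrightarrow>
        norm (gres h Y i j) \<le> L * (real (i - j) * h) powr (3 * \<gamma>)"
    have le: "real i * h \<le> T" if "i \<le> N" for i
      using that h NT by (meson mult_right_mono of_nat_mono less_imp_le order_trans)
    have w: "(real (i - j) * h) powr \<gamma> \<le> e" if "j < i" "i \<le> j + p" for i j
      using close[of j i] that h \<gamma> unfolding \<epsilon>(3)[symmetric] by (intro powr_mono2) auto
    have w3: "(real (i - j) * h) powr (3 * \<gamma>) = ((real (i - j) * h) powr \<gamma>) ^ 3" if "j < i" for i j
      using that h by (simp add: powr_power mult.commute)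
    have dt: "real i * h - real j * h = real (i - j) * h" if "j < i" for i j
      using that by (simp add: of_nat_diff left_diff_distrib)
    have normY: "norm (Y i) \<le> M" if bd: "?bd n" and n: "n \<le> N" "i \<le> n" for n i
    proof -
      have step: "norm (Y i) \<le> norm (Y j) + c0 * e" if ij: "j < i" "i \<le> j + p" "i \<le> n" for i j
      proof -
        let ?w = "(real (i - j) * h) powr \<gamma>"
        have we: "?w \<le> e" "0 \<le> ?w" using w ij by auto
        have "Y i = S (real i * h - real j * h) (Y j) + B (real i * h) (real j * h) (Y j) + gres h Y i j"
          by (simp add: res_def)
        moreover have "norm (B (real i * h) (real j * h) (Y j)) \<le> K\<^sup>2 * (?w + ?w\<^sup>2)"
          using B_bound[of "real j * h" "real i * h" "Y j"] h ij le[of i] n unfolding dt[OF ij(1)] by simp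
        moreover have "norm (gres h Y i j) \<le> L * ?w ^ 3"
          using bd ij unfolding w3[OF ij(1), symmetric] by auto
        ultimately have "norm (Y i) \<le> norm (Y j) + K\<^sup>2 * (?w + ?w\<^sup>2) + L * ?w ^ 3"
          using norm_add3_le[OF norm_S] by metis
        also have "\<dots> \<le> norm (Y j) + K\<^sup>2 * (e + e) + L * e ^ 3"
          using we e LM order_trans[OF power_mono[OF we, of 2], of e] by (intro add_mono mult_left_mono power_mono) (auto simp: power2_eq_square mult_left_le_one_le)
        also have "L * e ^ 3 = e" using e by (simp add: L_def power3_eq_cube power2_eq_square)
        finally show ?thesis by (simp add: c0_def algebra_simps)
      qed
      have "norm (Y i) \<le> c0 * e * (1 + real i / real p)" if "i \<le> n" for i
        using that
      proof (induction i rule: less_induct)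
        case (less i)
        consider "i = 0" | "0 < i" "i \<le> p" | "p < i" by linarith
        then show ?case
        proof cases
          case 1 then show ?thesis using Y0 c e by simp
        next
          case 2
          then have "norm (Y i) \<le> c0 * e" using step[of 0 i] less.prems Y0 by simp
          moreover have "0 \<le> c0 * e * (real i / real p)" using c e by simp
          ultimately show ?thesis by (simp add: distrib_left)
        next
          case 3
          then have "norm (Y i) \<le> c0 * e * (1 + real (i - p) / real p) + c0 * e"
            using step[of "i - p" i] less.IH[of "i - p"] less.prems p1 by force
          also have "\<dots> = c0 * e * (1 + real i / real p)"
            using 3 p1 by (simp add: of_nat_diff diff_divide_distrib distrib_left)
          finally show ?thesis .
        qed
      qed
      then have "norm (Y i) \<le> c0 * e * (1 + real i / real p)" using n by blast
      also have "real i / real p \<le> 2 * T / \<epsilon>"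
      proof -
        have "real i * \<epsilon> \<le> real i * (2 * (real p * h))" using pge by (intro mult_left_mono) auto
        also have "\<dots> = 2 * (real i * h) * real p" by simp
        also have "\<dots> \<le> 2 * T * real p" using le[of i] n by (intro mult_right_mono) auto
        finally show ?thesis using p1 \<epsilon> by (simp add: field_simps)
      qed
      also have "1 + 2 * T / \<epsilon> \<le> (1 + 2 * T) / \<epsilon>" using \<epsilon> by (simp add: field_simps)
      finally show ?thesis using c e by (simp add: M_def c3_def mult_left_mono field_simps)
    qed
    have "?bd n" if "n \<le> N" for n
      using that
    proof (induction n)
      case 0 then show ?case by simp
    next
      case (Suc n)
      then have IH: "?bd n" by simp
      have M: "norm (Y i) \<le> M" if "i \<le> n" for i using normY[OF IH] that Suc.prems by simp
      have "norm (gres h Y i j) \<le> L * (real (i - j) * h) powr (3 * \<gamma>)"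
        if "i \<le> Suc n" "j < i" "i \<le> j + p" for i j
      proof (rule discrete_sewing[where a=0 and b="Suc n" and p=p and j=j and i=i and
            Q="\<lambda>i j. norm (gres h Y i j)"])
        fix i assume "i < Suc n"
        then show "norm (res (real (Suc i) * h) (real i * h) (Y (Suc i)) (Y i)) \<le> L * h powr (3 * \<gamma>)"
          using YS[of i] Suc.prems LM by (simp add: res_def algebra_simps)
      next
        fix i k j assume *: "j < k" "k < i" "i \<le> Suc n" "i \<le> j + p"
          and Rkj: "norm (gres h Y k j) \<le> L * (real (k - j) * h) powr (3 * \<gamma>)"
        let ?w = "(real (i - j) * h) powr \<gamma>" and ?d = "real (k - j) * h" and ?v = "(real (k - j) * h) powr \<gamma>"
        have kp: "k \<le> j + p" using * by simp
        have v: "?v \<le> ?w" "?v \<le> e" "?w \<le> e" "0 < ?v" "0 < ?d"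
          using w[of j i] w[of j k] * h kp \<gamma> by (auto intro!: powr_mono2)
        have le0: "0 \<le> real j * h" "real j * h < real k * h" "real k * h < real i * h" "real i * h \<le> T" "real k * h \<le> T"
          using * h le[of i] le[of k] Suc.prems by auto
        have d\<epsilon>: "?d \<le> \<epsilon>" using close[of j k] * kp by simp
        \<comment> \<open>The drift has a full power of \<open>?d\<close>. Since
          \<open>?d \<le> \<epsilon>\<close> and 2\<gamma> < 1, replacing
          \<open>?d / \<epsilon>\<close> by its power 2\<gamma> cancels the factor
          \<open>1 / \<epsilon>\<close> of \<open>M\<close> and leaves a second-order term with only
          \<open>1 / e\<close> in front.\<close>
        have dM: "?d * M \<le> c3 * ?v\<^sup>2 / e"
        proof -
          have "0 < ?d / \<epsilon>" "?d / \<epsilon> \<le> 1" using divide_pos_pos[OF v(5) \<epsilon>(1)] d\<epsilon> \<epsilon>(1)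
              by (simp_all only: pos_divide_le_eq mult_1)
          then have "(?d / \<epsilon>) \<le> (?d / \<epsilon>) powr (2 * \<gamma>)"
            using \<gamma> by (intro le_powr_self) linarith+
          also have "\<dots> = (?v / e)\<^sup>2"
            using v(5) \<epsilon>(1) unfolding powr_square[symmetric] \<epsilon>(3)[symmetric] by (subst powr_divide) auto
          finally have "c3 * e * (?d / \<epsilon>) \<le> c3 * e * (?v / e)\<^sup>2"
            using c e by (intro mult_left_mono) auto
          then show ?thesis using e by (simp add: M_def power2_eq_square field_simps)
        qed
        have r: "norm (grho h Y k j) \<le> c4 * ?v\<^sup>2 / e"
        proof -
          have "norm (grho h Y k j) \<le> K\<^sup>2 * ?v\<^sup>2
            + norm (gres h Y k j) + ?d * norm (Y j)"
            using rho_bound[OF le0(1,2,5), of "Y k" "Y j"] unfolding dt[OF *(1)] .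
          also have "\<dots> \<le> K\<^sup>2 * ?v\<^sup>2 / e + ?v\<^sup>2 / e + c3 * ?v\<^sup>2 / e"
          proof (intro add_mono)
            have "K\<^sup>2 * ?v\<^sup>2 * e \<le> K\<^sup>2 * ?v\<^sup>2 * 1" using e by (intro mult_left_mono) auto
            then show "K\<^sup>2 * ?v\<^sup>2 \<le> K\<^sup>2 * ?v\<^sup>2 / e" using e by (simp add: field_simps)
            have "?v\<^sup>2 * ?v \<le> ?v\<^sup>2 * e" using v by (intro mult_left_mono) auto
            then have "L * ?v ^ 3 \<le> ?v\<^sup>2 / e"
              using e by (simp add: L_def power3_eq_cube power2_eq_square field_simps)
            then show "norm (gres h Y k j) \<le> ?v\<^sup>2 / e"
              using Rkj unfolding w3[OF *(1)] by (rule order_trans[rotated])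
            have "?d * norm (Y j) \<le> ?d * M" using M[of j] * v by (intro mult_left_mono) auto
            then show "?d * norm (Y j) \<le> c3 * ?v\<^sup>2 / e" using dM by simp
          qed
          finally show ?thesis by (simp add: c4_def algebra_simps add_divide_distrib)
        qed
        have ve: "?v\<^sup>2 / e \<le> ?v" using v e by (simp add: power2_eq_square field_simps)
        have r': "norm (grho h Y k j) \<le> c4 * ?v"
          using r mult_left_mono[OF ve, of c4] c by simp
        have d: "norm (ell (Y k - Y j)) \<le> c5 * ?w"
        proof -
          have "norm (ell (Y k - Y j)) \<le> K\<^sup>2 * ?v + c4 * ?v"
            using delta_bound[OF le0(1,2,5), of "Y k" "Y j"] r' unfolding dt[OF *(1)] by linarith
          also have "\<dots> \<le> c5 * ?w" unfolding c5_def distrib_right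
            using c v by (intro add_mono mult_left_mono) auto
          finally show ?thesis .
        qed
        have r2: "norm (grho h Y k j) \<le> c4 * ?w\<^sup>2 / e"
          using r e(1) c v by (elim order_trans) (intro divide_right_mono mult_left_mono power_mono less_imp_le[OF e(1)], auto)
        have "norm (gdefect h Y i k j)
            \<le> K\<^sup>2 * ?w * ((c5 * ?w)\<^sup>2 + c4 * ?w\<^sup>2 / e) + K\<^sup>2 * ?w\<^sup>2 * (c5 * ?w) + K\<^sup>2 * ?w ^ 3"
          using * by (intro defect_bound[OF le0(1,2,3,4) d r2]) (simp add: dt)
        also have "\<dots> = K\<^sup>2 * ?w ^ 3 * (c5\<^sup>2 + c4 / e + c5 + 1)"
          by (simp add: power2_eq_square power3_eq_cube algebra_simps)
        also have "\<dots> \<le> K\<^sup>2 * ?w ^ 3 * (c5\<^sup>2 / e + c4 / e + c5 / e + 1 / e)"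
          using e c by (intro mult_left_mono add_mono) (auto simp: field_simps mult_left_le_one_le)
        also have "\<dots> = ?w ^ 3 * (c6 / e)" by (simp add: c6_def add_divide_distrib[symmetric])
        also have "\<dots> \<le> ?w ^ 3 * ((1 - lam) * L)"
          using e by (intro mult_left_mono) (auto simp: L_def power2_eq_square field_simps)
        finally have "norm (gdefect h Y i k j) \<le> (1 - lam) * L * ?w ^ 3"
          by (simp add: mult_ac)
        moreover have "norm (gres h Y i j) \<le> norm (gres h Y i k)
            + norm (gres h Y k j) + norm (gdefect h Y i k j)"
          unfolding res_split[OF le0(1,2,3,4), of "Y i" "Y j" "Y k"]
          by (rule norm_add3_le[OF order_refl norm_S order_refl])
        ultimately show "norm (gres h Y i j) \<le> norm (gres h Y i k)
            + norm (gres h Y k j) + (1 - (2/3) powr (3 * \<gamma> - 1)) * L * (real (i - j) * h) powr (3 * \<gamma>)"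
          unfolding w3[OF order.strict_trans[OF *(1,2)]] lam_def by linarith
      qed (use that \<gamma> h LM in auto)
      then show ?case by blast
    qed
    then have "?bd N" by blast
    then show ?thesis using normY[of N] close unfolding approx_path_def by blast
  qed
  show ?thesis
    by (rule exI[of _ \<epsilon>], rule exI[of _ L], rule exI[of _ M]) (use \<epsilon> LM main in blast)
qed

text \<open>The two residuals need not be close on long intervals for any obvious reason; only their
  one-step values are small. Sewing the difference at an exponent below \<nu> propagates that
  smallness through a block, and the number of blocks does not depend on \<open>h\<close>.\<close>

lemma stability:
  assumes \<nu>: "1 < \<nu>" "\<nu> \<le> 3 * \<gamma>" and L: "0 \<le> L" and M: "0 \<le> M" and \<epsilon>0: "0 < \<epsilon>0"
  shows "\<exists>C h0. 0 \<le> C \<and> 0 < h0 \<and> (\<forall>h Y Y' N. 0 < h \<longrightarrow> h \<le> h0 \<longrightarrow> real N * h \<le> T \<longrightarrow> Y 0 = Y' 0 \<longrightarrow>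
      approx_path h N M L \<nu> \<epsilon>0 Y \<longrightarrow> approx_path h N M L \<nu> \<epsilon>0 Y' \<longrightarrow>
      (\<forall>i\<le>N. norm (Y i - Y' i) \<le> C * h powr ((\<nu> - 1) / 2)))"
proof -
  \<comment> \<open>Halfway between 1 and \<nu>: above 1 for the splitting argument, below 3\<gamma>
    so that the defect keeps a small power of the block length, and below \<nu> so that one-step
    residuals keep a small power of \<open>h\<close>.\<close>
  define \<mu> where "\<mu> = (1 + \<nu>) / 2"
  have \<mu>: "1 < \<mu>" "\<mu> < \<nu>" "\<nu> - \<mu> = (\<nu> - 1) / 2" "\<mu> < 3 * \<gamma>" using \<nu> by (auto simp: \<mu>_def field_simps)
  define lam :: real where "lam = (2/3) powr (\<mu> - 1)"
  have lam: "lam < 1" using \<mu> powr_less_mono2[of "\<mu> - 1" "2/3" 1] by (simp add: lam_def)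
  define c7 where "c7 = K\<^sup>2 + L + M"
  define c8 where "c8 = K\<^sup>2 + c7"
  define c9 where "c9 = K\<^sup>2 * (2 * c8 * (2 * K\<^sup>2 + 2) + c8\<^sup>2 + (K\<^sup>2 + 2) + c7 + (2 * K\<^sup>2 + 2) + c8 + 1)"
  have K1: "1 \<le> K\<^sup>2" using K by simp
  have c78: "c7 \<ge> 0" "c8 \<ge> 0" using K1 L M by (auto simp: c8_def c7_def)
  have c: "c7 \<ge> 0" "c8 \<ge> 0" "c9 > 0"
  proof -
    have "0 \<le> 2 * c8 * (2 * K\<^sup>2 + 2) + c8\<^sup>2 + (K\<^sup>2 + 2) + c7 + (2 * K\<^sup>2 + 2) + c8" using K1 c78 by simp
    then show "c9 > 0" using K1 unfolding c9_def by (intro mult_pos_pos) linarith+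
  qed (use c78 in auto)
  \<comment> \<open>The cap \<open>\<epsilon>0\<close> makes the residual hypotheses applicable
    inside a block, \<open>1/2\<close> gives \<open>\<epsilon> powr \<mu> \<le> 1/2\<close> for the
    absorption at the end of a block, and the third one makes the defect difference fit into
    \<open>1 - lam\<close>.\<close>
  define \<epsilon> where "\<epsilon> = min (min \<epsilon>0 (1/2)) (((1 - lam) / c9) powr (1 / (3 * \<gamma> - \<mu>)))"
  have \<epsilon>: "0 < \<epsilon>" "\<epsilon> \<le> \<epsilon>0" "\<epsilon> \<le> 1/2" "\<epsilon> \<le> 1" using \<epsilon>0 lam c by (auto simp: \<epsilon>_def)
  have c9\<epsilon>: "c9 * \<epsilon> powr (3 * \<gamma> - \<mu>) \<le> 1 - lam"
  proof -
    have "\<epsilon> powr (3 * \<gamma> - \<mu>) \<le> (((1 - lam) / c9) powr (1 / (3 * \<gamma> - \<mu>))) powr (3 * \<gamma> - \<mu>)"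
      using \<epsilon> \<mu> by (intro powr_mono2) (auto simp: \<epsilon>_def)
    also have "\<dots> = (1 - lam) / c9" using lam c \<mu> by (simp add: powr_powr)
    finally show ?thesis using c by (simp add: field_simps)
  qed
  have \<epsilon>\<mu>: "\<epsilon> powr \<mu> \<le> 1/2"
    using powr_mono'[of 1 \<mu> \<epsilon>] \<mu> \<epsilon> by simp
  \<comment> \<open>One block multiplies the distance by at most
    \<open>C1 - 1 = 2 + 4 * K\<^sup>2\<close> and adds \<open>e\<close>; starting from distance 0
    this sums to \<open>e\<close> times a power of \<open>C1\<close>, with \<open>n0\<close>
    bounding the number of full blocks.\<close>
  define C1 where "C1 = 3 + 4 * K\<^sup>2"
  define n0 where "n0 = nat \<lceil>2 * T / \<epsilon>\<rceil>"
  define C where "C = 2 * L * C1 ^ (n0 + 1)"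
  have C: "0 \<le> C" "1 \<le> C1" using L K1 by (auto simp: C_def C1_def)
  have main: "norm (Y i - Y' i) \<le> C * h powr ((\<nu> - 1) / 2)"
    if h: "0 < h" "h \<le> \<epsilon>" and NT: "real N * h \<le> T" and Y0: "Y 0 = Y' 0"
      and YY: "approx_path h N M L \<nu> \<epsilon>0 Y" "approx_path h N M L \<nu> \<epsilon>0 Y'"
      and i: "i \<le> N"
    for h N i and Y Y' :: "nat \<Rightarrow> 'e"
  proof -
    have YM: "norm (Y i) \<le> M" "norm (Y' i) \<le> M" if "i \<le> N" for i
      using YY that by (auto simp: approx_path_def)
    have R: "norm (gres h Y i j) \<le> L * (real (i - j) * h) powr \<nu>"
      and R': "norm (gres h Y' i j) \<le> L * (real (i - j) * h) powr \<nu>"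
      if "i \<le> N" "j < i" "real (i - j) * h \<le> \<epsilon>0" for i j
      using YY that by (auto simp: approx_path_def)
    obtain p :: nat where p1: "1 \<le> p" and ple: "real p * h \<le> \<epsilon>" and pge: "\<epsilon> \<le> 2 * (real p * h)"
      and pmax: "\<And>m. real m * h \<le> \<epsilon> \<Longrightarrow> m \<le> p"
      using block_length[OF h] by blast
    have close: "real (i - j) * h \<le> \<epsilon>" if "i \<le> j + p" for i j
    proof -
      have "real (i - j) * h \<le> real p * h" using h that by (intro mult_right_mono) auto
      then show ?thesis using ple by simp
    qed
    have le: "real i * h \<le> T" if "i \<le> N" for i
      using that h NT by (meson mult_right_mono of_nat_mono less_imp_le order_trans)
    have dt: "real i * h - real j * h = real (i - j) * h" if "j < i" for i j
      using that by (simp add: of_nat_diff left_diff_distrib)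
    \<comment> \<open>The two one-step residuals, each at most \<open>L * h powr \<nu>\<close>, with
      the factor \<open>h powr \<mu>\<close> taken out. This vanishes with \<open>h\<close>.\<close>
    define e where "e = 2 * L * h powr (\<nu> - \<mu>)"
    have e0: "0 \<le> e" using L by (simp add: e_def)
    define D where "D i = norm (Y i - Y' i)" for i
    define Q where "Q i j = norm (gres h Y i j - gres h Y' i j)" for i j
    have block: "D i \<le> (2 + 4 * K\<^sup>2) * D a + e" if a: "a \<le> i" "i \<le> a + p" "i \<le> N" for a i
    proof -
      define b where "b = min N (a + p)"
      have ab: "a \<le> i" "i \<le> b" "b \<le> N" "b \<le> a + p" using a by (auto simp: b_def)
      \<comment> \<open>The unknown maximal distance over the whole block is fixed beforehand. As
        the defect difference is linear in it, it enters the sewing bound through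
        \<open>q = e + m\<close> and is absorbed afterwards.\<close>
      define m where "m = Max (D ` {a..b})"
      have mD: "D k \<le> m" if "a \<le> k" "k \<le> b" for k unfolding m_def using that by (intro Max_ge) auto
      have m0: "0 \<le> m" using mD[of a] ab by (simp add: D_def order_trans[OF norm_ge_zero])
      define q where "q = e + m"
      have q: "0 \<le> q" "m \<le> q" "e \<le> q" using e0 m0 by (auto simp: q_def)
      have Qb: "Q i j \<le> q * (real (i - j) * h) powr \<mu>" if "a \<le> j" "j < i" "i \<le> b" for i j
      proof (rule discrete_sewing[where a=a and b=b and p=p and Q=Q and i=i and j=j])
        fix i assume i: "a \<le> i" "i < b"
        have "h powr \<nu> = h powr (\<nu> - \<mu>) * h powr \<mu>" by (simp add: powr_add[symmetric])
        moreover have "norm (res (real (Suc i) * h) (real i * h) (Y (Suc i)) (Y i)) \<le> L * h powr \<nu>"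
           "norm (res (real (Suc i) * h) (real i * h) (Y' (Suc i)) (Y' i)) \<le> L * h powr \<nu>"
          using R[of "Suc i" i] R'[of "Suc i" i] i ab h \<epsilon> by auto
        ultimately have "Q (Suc i) i \<le> e * h powr \<mu>"
          unfolding Q_def e_def by (intro order_trans[OF norm_triangle_ineq4]) simp
        also have "\<dots> \<le> q * h powr \<mu>" using q by (intro mult_right_mono) auto
        finally show "Q (Suc i) i \<le> q * h powr \<mu>" .
      next
        fix i k j assume *: "a \<le> j" "j < k" "k < i" "i \<le> b" "i \<le> j + p"
          and Qkj: "Q k j \<le> q * (real (k - j) * h) powr \<mu>"
        let ?w = "(real (i - j) * h) powr \<gamma>" and ?d = "real (k - j) * h" and ?v = "(real (k - j) * h) powr \<gamma>"
        have kp: "k \<le> j + p" using * by simp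
        have d: "0 < ?d" "?d \<le> \<epsilon>" "?d \<le> \<epsilon>0" "?d \<le> 1" using close[OF kp] * h \<epsilon> by auto
        have v: "?v \<le> ?w" "0 < ?v"
          using * h \<gamma> by (auto intro!: powr_mono2)
        have w: "?w \<le> 1" "0 < ?w" "?w\<^sup>2 \<le> ?w" "?w ^ 3 \<le> ?w\<^sup>2"
        proof -
          show w1: "?w \<le> 1" using close[of i j] * h \<gamma> \<epsilon> by (intro powr_le1) auto
          show "0 < ?w" using * h by auto
          show "?w\<^sup>2 \<le> ?w" "?w ^ 3 \<le> ?w\<^sup>2" using w1 power_decreasing[of 1 2 ?w] power_decreasing[of 2 3 ?w] by auto
        qed
        have v2: "?v\<^sup>2 \<le> ?w\<^sup>2" using v by (intro power_mono) auto
        have dv: "?d \<le> ?v\<^sup>2"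
          using d \<gamma> unfolding powr_square by (intro le_powr_self) linarith+
        have d\<mu>: "?d powr \<mu> \<le> ?v\<^sup>2" "?d powr \<nu> \<le> ?v\<^sup>2"
          using order_trans[OF powr_le_self[OF d(1,4)] dv] \<mu>(1) \<nu>(1) less_imp_le by blast+
        have le0: "0 \<le> real j * h" "real j * h < real k * h" "real k * h < real i * h" "real i * h \<le> T" "real k * h \<le> T"
          using * h le[of i] le[of k] ab by auto
        have v1: "?v \<le> 1" using v w by simp
        have rgen: "norm (grho h y k j) \<le> c7 * ?v\<^sup>2"
          if "norm (y j) \<le> M" "norm (gres h y k j) \<le> L * ?d powr \<nu>" for y
        proof -
          have "norm (grho h y k j) \<le> K\<^sup>2 * ?v\<^sup>2
            + norm (gres h y k j) + ?d * norm (y j)"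
            using rho_bound[OF le0(1,2,5), of "y k" "y j"] unfolding dt[OF *(2)] .
          also have "\<dots> \<le> K\<^sup>2 * ?v\<^sup>2 + L * ?v\<^sup>2 + ?v\<^sup>2 * M"
            using that dv d d\<mu> L by (intro add_mono order_refl mult_mono order_trans[OF that(2)] mult_left_mono) auto
          finally show ?thesis by (simp add: c7_def algebra_simps)
        qed
        have r: "norm (grho h Y k j) \<le> c7 * ?v\<^sup>2"
           "norm (grho h Y' k j) \<le> c7 * ?v\<^sup>2"
          using rgen[of Y] rgen[of Y'] YM R R' * ab d by auto
        have dgen: "norm (ell (y k - y j)) \<le> c8 * ?w"
          if "norm (grho h y k j) \<le> c7 * ?v\<^sup>2" for y
        proof -
          have "norm (ell (y k - y j)) \<le> K\<^sup>2 * ?v + c7 * ?v\<^sup>2"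
            using delta_bound[OF le0(1,2,5), of "y k" "y j"] that unfolding dt[OF *(2)] by linarith
          also have "\<dots> \<le> K\<^sup>2 * ?w + c7 * ?w"
            using c v(1) order_trans[OF v2 w(3)] by (intro add_mono mult_left_mono) simp_all
          finally show ?thesis by (simp add: c8_def algebra_simps)
        qed
        have Dj: "norm (Y j - Y' j) \<le> m" using mD[of j] * by (simp add: D_def)
        have rr: "norm (grho h Y k j - grho h Y' k j)
            \<le> (K\<^sup>2 + 2) * q * ?w\<^sup>2"
        proof -
          have "norm (grho h Y k j - grho h Y' k j)
             \<le> K\<^sup>2 * ?v\<^sup>2 * norm (Y j - Y' j) + Q k j + ?d * norm (Y j - Y' j)"
            using rho_diff[OF le0(1,2,5), of "Y k" "Y j" "Y' k" "Y' j"] unfolding dt[OF *(2)] Q_def .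
          also have "\<dots> \<le> K\<^sup>2 * ?v\<^sup>2 * q + q * ?v\<^sup>2 + ?v\<^sup>2 * q"
          proof (intro add_mono mult_mono mult_left_mono)
            show "Q k j \<le> q * ?v\<^sup>2" using Qkj d\<mu> q by (meson mult_left_mono order_trans)
          qed (use Dj q d dv in auto)
          also have "\<dots> = (K\<^sup>2 + 2) * q * ?v\<^sup>2" by (simp add: algebra_simps)
          also have "\<dots> \<le> (K\<^sup>2 + 2) * q * ?w\<^sup>2" using v2 q by (intro mult_left_mono) auto
          finally show ?thesis .
        qed
        have dd: "norm (ell (Y k - Y j) - ell (Y' k - Y' j)) \<le> (2 * K\<^sup>2 + 2) * q * ?w"
        proof -
          have "norm (ell (Y k - Y j) - ell (Y' k - Y' j)) \<le> K\<^sup>2 * ?v * norm (Y j - Y' j) + (K\<^sup>2 + 2) * q * ?w\<^sup>2"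
            using delta_diff[OF le0(1,2,5), of "Y k" "Y j" "Y' k" "Y' j"] rr unfolding dt[OF *(2)] by linarith
          also have "\<dots> \<le> K\<^sup>2 * ?w * q + (K\<^sup>2 + 2) * q * ?w"
            using v w Dj q by (intro add_mono mult_mono mult_left_mono) auto
          finally show ?thesis by (simp add: algebra_simps)
        qed
        have r2: "norm (grho h Y' k j) \<le> c7 * ?w\<^sup>2"
          using r(2) mult_left_mono[OF v2, of c7] c by linarith
        have "norm (gdefect h Y i k j - gdefect h Y' i k j)
            \<le> K\<^sup>2 * ?w * (2 * (c8 * ?w) * ((2 * K\<^sup>2 + 2) * q * ?w) + q * (c8 * ?w)\<^sup>2 + (K\<^sup>2 + 2) * q * ?w\<^sup>2 + q * (c7 * ?w\<^sup>2))
              + K\<^sup>2 * ?w\<^sup>2 * ((2 * K\<^sup>2 + 2) * q * ?w + q * (c8 * ?w)) + K\<^sup>2 * ?w ^ 3 * q"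
          using * Dj q
          by (intro defect_diff[OF le0(1,2,3,4) dgen[OF r(1)] dgen[OF r(2)] r2 dd rr]) (simp_all add: dt)
        also have "\<dots> = c9 * q * ?w ^ 3"
          by (simp add: c9_def power2_eq_square power3_eq_cube algebra_simps)
        also have "?w ^ 3 = (real (i - j) * h) powr (3 * \<gamma> - \<mu>) * (real (i - j) * h) powr \<mu>"
          using * h by (simp add: powr_add[symmetric] powr_power mult.commute)
        also have "c9 * q * \<dots> \<le> c9 * q * (\<epsilon> powr (3 * \<gamma> - \<mu>) * (real (i - j) * h) powr \<mu>)"
          using close[of i j] * h \<mu> c q by (intro mult_left_mono mult_right_mono powr_mono2) auto
        also have "\<dots> = (c9 * \<epsilon> powr (3 * \<gamma> - \<mu>)) * (q * (real (i - j) * h) powr \<mu>)" by simp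
        also have "\<dots> \<le> (1 - lam) * (q * (real (i - j) * h) powr \<mu>)"
          using c9\<epsilon> q by (intro mult_right_mono) auto
        finally have "norm (gdefect h Y i k j - gdefect h Y' i k j)
            \<le> (1 - lam) * q * (real (i - j) * h) powr \<mu>" by simp
        moreover have "gres h Y i j - gres h Y' i j
            = (gres h Y i k - gres h Y' i k)
            + S (real i * h - real k * h) (gres h Y k j - gres h Y' k j)
            + (gdefect h Y i k j - gdefect h Y' i k j)"
          unfolding res_split[OF le0(1,2,3,4), of "Y i" "Y j" "Y k"] res_split[OF le0(1,2,3,4), of "Y' i" "Y' j" "Y' k"]
          by (simp add: S_diff)
        ultimately have "Q i j \<le> Q i k + Q k j + (1 - lam) * q * (real (i - j) * h) powr \<mu>"
          unfolding Q_def using norm_add3_le[OF order_refl norm_S] by metis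
        then show "Q i j \<le> Q i k + Q k j + (1 - (2/3) powr (\<mu> - 1)) * q * (real (i - j) * h) powr \<mu>"
          by (simp add: lam_def)
      qed (use \<mu> h q that ab in auto)
      have Db: "D k \<le> (1 + 2 * K\<^sup>2) * D a + (e + m) / 2" if k: "a \<le> k" "k \<le> b" for k
      proof (cases "k = a")
        case True
        then show ?thesis using K1 e0 m0 by (simp add: D_def distrib_right)
      next
        case False
        then have ak: "a < k" using k by simp
        let ?w = "(real (k - a) * h) powr \<gamma>"
        have d\<epsilon>: "real (k - a) * h \<le> \<epsilon>" using close[of k a] k ab by simp
        have w: "?w \<le> 1" "0 \<le> ?w" using d\<epsilon> h \<gamma> \<epsilon> by (auto intro!: powr_le1)
        have "?w + ?w\<^sup>2 \<le> 2" using w power_le_one[of ?w 2] by simp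
        then have "K\<^sup>2 * (?w + ?w\<^sup>2) * D a \<le> K\<^sup>2 * 2 * D a"
          by (intro mult_right_mono mult_left_mono) (auto simp: D_def)
        then have 1: "norm (B (real k * h) (real a * h) (Y a) - B (real k * h) (real a * h) (Y' a)) \<le> K\<^sup>2 * 2 * D a"
          using B_diff[of "real a * h" "real k * h" "Y a" "Y' a"] h ak le[of k] k ab unfolding dt[OF ak] by (simp add: D_def)
        have "(real (k - a) * h) powr \<mu> \<le> \<epsilon> powr \<mu>" using d\<epsilon> h \<mu> by (intro powr_mono2) auto
        then have "(real (k - a) * h) powr \<mu> \<le> 1/2" using \<epsilon>\<mu> by simp
        then have "q * (real (k - a) * h) powr \<mu> \<le> q * (1/2)" using q by (intro mult_left_mono) auto
        then have 2: "Q k a \<le> (e + m) / 2"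
          using Qb[of a k] ak k by (simp add: q_def)
        have "Y k - Y' k = S (real k * h - real a * h) (Y a - Y' a)
           + (B (real k * h) (real a * h) (Y a) - B (real k * h) (real a * h) (Y' a))
           + (gres h Y k a - gres h Y' k a)"
          by (simp add: res_def S_diff)
        then have "D k \<le> D a + K\<^sup>2 * 2 * D a + (e + m) / 2"
          unfolding D_def using norm_add3_le[OF norm_S 1 2[unfolded Q_def]] by (simp add: D_def)
        then show ?thesis by (simp add: algebra_simps)
      qed
      have "m \<in> D ` {a..b}" unfolding m_def using ab by (intro Max_in) auto
      then have "m \<le> (1 + 2 * K\<^sup>2) * D a + (e + m) / 2" using Db by auto
      \<comment> \<open>Only half of \<open>m\<close> stands on the right, thanks to
        \<open>\<epsilon> powr \<mu> \<le> 1/2\<close>, so it can be moved to the left.\<close>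
      then have "2 * m \<le> 2 * (1 + 2 * K\<^sup>2) * D a + (e + m)" by (simp add: field_simps)
      moreover have "2 * (1 + 2 * K\<^sup>2) * D a = (2 + 4 * K\<^sup>2) * D a" by (simp add: algebra_simps)
      ultimately have "2 * m \<le> (2 + 4 * K\<^sup>2) * D a + (e + m)" by (simp only:)
      then have "m \<le> (2 + 4 * K\<^sup>2) * D a + e" by (simp only: add.assoc[symmetric] mult_2 add_le_cancel_right)
      then show ?thesis using mD[OF ab(1,2)] by (rule order_trans[rotated])
    qed
    have "D i \<le> e * C1 ^ (i div p + 1)" if "i \<le> N" for i
      using that
    proof (induction i rule: less_induct)
      case (less i)
      have D0: "D 0 = 0" using Y0 by (simp add: D_def)
      show ?case
      proof (cases "i \<le> p")
        case True
        then have "D i \<le> e" using block[of 0 i] less.prems D0 by simp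
        also have "\<dots> \<le> e * C1 ^ (i div p + 1)" using e0 C one_le_power[of C1 "i div p + 1"] by (simp add: mult_le_cancel_left1 del: power_Suc power_add)
        finally show ?thesis .
      next
        case False
        define k where "k = i div p"
        have k: "(i - p) div p + 1 = k" using False p1 unfolding k_def by (simp add: div_if[of i])
        have "D i \<le> (C1 - 1) * D (i - p) + e"
          using block[of "i - p" i] less.prems by (simp add: C1_def)
        also have "\<dots> \<le> (C1 - 1) * (e * C1 ^ k) + e * C1 ^ k"
          using less.IH[of "i - p"] False less.prems p1 C e0 one_le_power[of C1 k] unfolding k
          by (intro add_mono mult_left_mono) (auto simp: mult_le_cancel_left1)
        also have "\<dots> = e * C1 ^ (k + 1)" by (simp add: algebra_simps)
        finally show ?thesis unfolding k_def .
      qed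
    qed
    then have "D i \<le> e * C1 ^ (i div p + 1)" using i by blast
    also have "\<dots> \<le> e * C1 ^ (n0 + 1)"
    proof (intro mult_left_mono power_increasing C e0 add_right_mono)
      have "real i * \<epsilon> \<le> real i * (2 * (real p * h))" using pge by (intro mult_left_mono) auto
      also have "\<dots> = 2 * (real i * h) * real p" by simp
      also have "\<dots> \<le> 2 * T * real p" using le[of i] i by (intro mult_right_mono) auto
      finally have "real i / real p \<le> 2 * T / \<epsilon>" using p1 \<epsilon> by (simp add: field_simps)
      then have "real (i div p) \<le> 2 * T / \<epsilon>" using of_nat_div_le_of_nat[of i p, where 'a=real] by linarith
      then show "i div p \<le> n0" unfolding n0_def by linarith
    qed
    also have "\<dots> = C * h powr ((\<nu> - 1) / 2)" by (simp add: C_def e_def \<mu>)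
    finally show ?thesis by (simp add: D_def)
  qed
  show ?thesis
    by (rule exI[of _ C], rule exI[of _ \<epsilon>]) (use \<epsilon> C main in blast)
qed

section \<open>Limits of Euler schemes: existence and uniqueness\<close>

lemma tendsto_A:
  assumes le: "\<And>n. 0 \<le> b n \<and> b n \<le> a n \<and> a n \<le> T" and lim: "a \<longlonglongrightarrow> t" "b \<longlonglongrightarrow> s" "w \<longlonglongrightarrow> w0"
  shows "(\<lambda>n. A (a n) (b n) (w n)) \<longlonglongrightarrow> A t s w0"
proof -
  have "(\<lambda>n. A (a n) (b n) (w n - w0)) \<longlonglongrightarrow> 0"
  proof (rule Lim_null_comparison)
    have "norm (A (a n) (b n) (w n - w0)) \<le> K * T powr \<gamma> * norm (w n - w0)" for n
      using le[of n] K \<gamma> by (intro order_trans[OF norm_A] mult_right_mono mult_left_mono powr_mono2) auto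
    then show "\<forall>\<^sub>F n in sequentially. norm (A (a n) (b n) (w n - w0)) \<le> K * T powr \<gamma> * norm (w n - w0)"
      by simp
    show "(\<lambda>n. K * T powr \<gamma> * norm (w n - w0)) \<longlonglongrightarrow> 0"
      using lim(3) by (intro tendsto_mult_right_zero tendsto_norm_zero LIM_zero)
  qed
  from tendsto_add[OF this A_cont[OF le lim(1,2), of w0]] show ?thesis
    using le by (simp add: linear_diff[OF A_linear])
qed

lemma tendsto_X:
  assumes le: "\<And>n. 0 \<le> b n \<and> b n \<le> a n \<and> a n \<le> T" and lim: "a \<longlonglongrightarrow> t" "b \<longlonglongrightarrow> s" "g \<longlonglongrightarrow> g0"
  shows "(\<lambda>n. X (a n) (b n) (g n)) \<longlonglongrightarrow> X t s g0"
proof -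
  have "(\<lambda>n. X (a n) (b n) (g n - g0)) \<longlonglongrightarrow> 0"
  proof (rule Lim_null_comparison)
    have "norm (X (a n) (b n) (g n - g0)) \<le> K * (T powr \<gamma>)\<^sup>2 * norm (g n - g0)" for n
      using le[of n] K \<gamma> by (intro order_trans[OF norm_X] mult_right_mono mult_left_mono powr_mono2 power_mono) auto
    then show "\<forall>\<^sub>F n in sequentially. norm (X (a n) (b n) (g n - g0)) \<le> K * (T powr \<gamma>)\<^sup>2 * norm (g n - g0)"
      by simp
    show "(\<lambda>n. K * (T powr \<gamma>)\<^sup>2 * norm (g n - g0)) \<longlonglongrightarrow> 0"
      using lim(3) by (intro tendsto_mult_right_zero tendsto_norm_zero LIM_zero)
  qed
  from tendsto_add[OF this X_cont[OF le lim(1,2), of g0]] show ?thesis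
    using le by (simp add: linear_diff[OF X_linear])
qed

text \<open>Convergence is asked of the observed points only: the states of Euler schemes at grid
  points are known to converge merely after transport to a common time.\<close>

lemma tendsto_B:
  assumes le: "\<And>n. 0 \<le> b n \<and> b n \<le> a n \<and> a n \<le> T" and lim: "a \<longlonglongrightarrow> t" "b \<longlonglongrightarrow> s"
    and p: "(\<lambda>n. pt (g n)) \<longlonglongrightarrow> pt g0"
  shows "(\<lambda>n. B (a n) (b n) (g n)) \<longlonglongrightarrow> B t s g0"
proof -
  have "continuous_on UNIV F" "continuous_on UNIV G"
    using K F_lip G_lip by (auto intro!: lipschitz_on_continuous_on[where L=K] simp: lipschitz_on_def dist_norm)
  then have "(\<lambda>n. F (pt (g n))) \<longlonglongrightarrow> F (pt g0)" "(\<lambda>n. G (pt (g n))) \<longlonglongrightarrow> G (pt g0)"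
    using p by (auto intro: continuous_on_tendsto_compose)
  then show ?thesis unfolding B_def by (intro tendsto_add tendsto_A tendsto_X le lim)
qed

lemma B_refl: "0 \<le> t \<Longrightarrow> t \<le> T \<Longrightarrow> B t t g = 0"
  using B_bound[of t t g] \<gamma> by simp

lemma res_le:
  assumes "0 \<le> s" "s \<le> t" "t \<le> T" "norm gt \<le> M" "norm gs \<le> M"
  shows "norm (res t s gt gs) \<le> 2 * M + K\<^sup>2 * (T powr \<gamma> + (T powr \<gamma>)\<^sup>2)"
proof -
  have w: "(t - s) powr \<gamma> \<le> T powr \<gamma>" using assms \<gamma> by (intro powr_mono2) auto
  have "norm (B t s gs) \<le> K\<^sup>2 * ((t - s) powr \<gamma> + ((t - s) powr \<gamma>)\<^sup>2)" using assms by (intro B_bound)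
  also have "\<dots> \<le> K\<^sup>2 * (T powr \<gamma> + (T powr \<gamma>)\<^sup>2)" using w by (intro mult_left_mono add_mono power_mono) auto
  finally have "norm (- B t s gs) \<le> K\<^sup>2 * (T powr \<gamma> + (T powr \<gamma>)\<^sup>2)" by simp
  from norm_add3_le[OF assms(4) _ this, of "- S (t - s) gs" M] show ?thesis
    using norm_S[of "t - s" gs] assms(5) by (simp add: res_def)
qed

text \<open>Stability compares each Euler scheme with the next finer one, so the distances decay
  geometrically in the level and the schemes converge. The residual bound passes to the limit on
  intervals shorter than \<epsilon>; longer ones are covered by a crude bound.\<close>

theorem existence:
  "\<exists>Y L. 0 \<le> L \<and> Y 0 = 0 \<and>
     (\<forall>s t. 0 \<le> s \<longrightarrow> s \<le> t \<longrightarrow> t \<le> T \<longrightarrow> norm (res t s (Y t) (Y s)) \<le> L * (t - s) powr (3 * \<gamma>))"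
proof -
  obtain \<epsilon> L M where \<epsilon>: "0 < \<epsilon>" "\<epsilon> \<le> 1" and LM: "0 \<le> L" "0 \<le> M"
    and euler: "\<And>h Y N. 0 < h \<Longrightarrow> h \<le> \<epsilon> \<Longrightarrow> real N * h \<le> T \<Longrightarrow> Y 0 = 0 \<Longrightarrow>
      (\<forall>i<N. Y (Suc i) = S h (Y i) + B (real (Suc i) * h) (real i * h) (Y i)) \<Longrightarrow>
      approx_path h N M L (3 * \<gamma>) \<epsilon> Y"
    using euler_bound by blast
  have "1 < 3 * \<gamma>" using \<gamma> by simp
  then obtain C h0 where C: "0 \<le> C" "0 < h0"
    and stab: "\<And>h Y Y' N. 0 < h \<Longrightarrow> h \<le> h0 \<Longrightarrow> real N * h \<le> T \<Longrightarrow> Y 0 = Y' 0 \<Longrightarrow>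
      approx_path h N M L (3 * \<gamma>) \<epsilon> Y \<Longrightarrow> approx_path h N M L (3 * \<gamma>) \<epsilon> Y' \<Longrightarrow>
      (\<forall>i\<le>N. norm (Y i - Y' i) \<le> C * h powr ((3 * \<gamma> - 1) / 2))"
    using stability[of "3 * \<gamma>" L M \<epsilon>] LM \<epsilon> by blast
  define h where "h n = 1 / (2::real) ^ n" for n
  have h: "h n > 0" "h (Suc n) = h n / 2" for n by (auto simp: h_def)
  have "\<exists>n0. (1/2::real) ^ n0 < min \<epsilon> h0" using C \<epsilon> by (intro real_arch_pow_inv) auto
  then obtain n0 where "(1/2::real) ^ n0 < min \<epsilon> h0" ..
  then have n0: "h n0 \<le> \<epsilon>" "h n0 \<le> h0" by (auto simp: h_def power_one_over)
  have "h n \<le> h n0" if "n0 \<le> n" for n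
    using that unfolding h_def by (intro divide_left_mono power_increasing) auto
  then have h\<epsilon>: "h n \<le> \<epsilon>" "h n \<le> h0" if "n0 \<le> n" for n using n0 that order_trans by blast+
  define Y :: "nat \<Rightarrow> nat \<Rightarrow> 'e"
    where "Y n = rec_nat 0 (\<lambda>i y. S (h n) y + B (real (Suc i) * h n) (real i * h n) y)" for n
  have Y0: "Y n 0 = 0" and YS: "Y n (Suc i) = S (h n) (Y n i) + B (real (Suc i) * h n) (real i * h n) (Y n i)" for n i
    by (simp_all add: Y_def)
  have path: "approx_path (h n) i M L (3 * \<gamma>) \<epsilon> (Y n)" if "n0 \<le> n" "real i * h n \<le> T" for n i
    using euler[of "h n" i "Y n"] h h\<epsilon>[of n] that Y0 YS by blast
  have YM: "norm (Y n i) \<le> M" if "n0 \<le> n" "real i * h n \<le> T" for n i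
    using path[OF that] by (simp add: approx_path_def)
  have R: "norm (gres (h n) (Y n) i j) \<le> L * (real (i - j) * h n) powr (3 * \<gamma>)"
    if "n0 \<le> n" "real i * h n \<le> T" "j < i" "real (i - j) * h n \<le> \<epsilon>" for n i j
    using path[OF that(1,2)] that(3,4) by (simp add: approx_path_def)
  define \<theta> where "\<theta> = (3 * \<gamma> - 1) / 2"
  \<comment> \<open>The first rate is that of stability with step \<open>h n\<close>, the second
    that of one additional step of the finer scheme.\<close>
  define r where "r = max (2 powr (- \<theta>)) (2 powr (- \<gamma>))"
  have r: "0 \<le> r" "r < 1" "2 powr (- \<theta>) \<le> r" "2 powr (- \<gamma>) \<le> r"
    using \<gamma> powr_less_mono[of _ 0 "2::real"] by (auto simp: r_def \<theta>_def le_max_iff_disj)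
  have hp: "h n powr a = (2 powr (- a)) ^ n" for n a
    by (simp add: h_def powr_divide powr_minus_divide powr_power powr_realpow[symmetric] powr_powr power_one_over mult.commute)
  define c where "c = C + 2 * K\<^sup>2"
  have c: "C \<le> c" "2 * K\<^sup>2 \<le> c" using C by (auto simp: c_def)
  have one: "norm (Y (Suc n) (2 * k + 1) - S (1 / 2 ^ Suc n) (Y (Suc n) (2 * k))) \<le> c * r ^ n"
    if n: "n0 \<le> n" and kT: "real (2 * k + 1) / 2 ^ Suc n \<le> T" for n k
  proof -
    let ?h = "h (Suc n)"
    have "Y (Suc n) (2 * k + 1) - S (1 / 2 ^ Suc n) (Y (Suc n) (2 * k)) = B (real (Suc (2 * k)) * ?h) (real (2 * k) * ?h) (Y (Suc n) (2 * k))"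
      using YS[of "Suc n" "2 * k"] by (simp add: h_def)
    moreover have "norm (B (real (Suc (2 * k)) * ?h) (real (2 * k) * ?h) (Y (Suc n) (2 * k))) \<le> K\<^sup>2 * (?h powr \<gamma> + (?h powr \<gamma>)\<^sup>2)"
    proof -
      have "real (Suc (2 * k)) * ?h - real (2 * k) * ?h = ?h" by (simp add: algebra_simps)
      moreover have "0 \<le> real (2 * k) * ?h" "real (2 * k) * ?h \<le> real (Suc (2 * k)) * ?h"
        using h(1)[of "Suc n"] by (intro mult_nonneg_nonneg mult_right_mono; simp)+
      moreover have "real (Suc (2 * k)) * ?h \<le> T" using kT by (simp add: h_def)
      ultimately show ?thesis using B_bound by metis
    qed
    moreover have "K\<^sup>2 * (?h powr \<gamma> + (?h powr \<gamma>)\<^sup>2) \<le> c * r ^ n"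
    proof -
      have h1: "?h \<le> 1" unfolding h_def by (simp only: divide_le_eq_1) (simp add: one_le_power del: power_Suc)
      have w1: "?h powr \<gamma> \<le> 1" using h(1)[of "Suc n"] h1 \<gamma> by (intro powr_le1) auto
      have "(?h powr \<gamma>)\<^sup>2 \<le> ?h powr \<gamma>" using w1 power_decreasing[of 1 2 "?h powr \<gamma>"] by simp
      then have "K\<^sup>2 * (?h powr \<gamma> + (?h powr \<gamma>)\<^sup>2) \<le> K\<^sup>2 * (?h powr \<gamma> + ?h powr \<gamma>)" by (intro mult_left_mono) auto
      also have "\<dots> = 2 * K\<^sup>2 * ?h powr \<gamma>" by simp
      also have "?h powr \<gamma> \<le> r ^ Suc n" unfolding hp using r by (intro power_mono) auto
      also have "r ^ Suc n \<le> r ^ n" using r by (intro power_decreasing) auto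
      finally have "K\<^sup>2 * (?h powr \<gamma> + (?h powr \<gamma>)\<^sup>2) \<le> 2 * K\<^sup>2 * r ^ n" by (simp add: mult_left_mono)
      also have "\<dots> \<le> c * r ^ n" using c r by (intro mult_right_mono) auto
      finally show ?thesis .
    qed
    ultimately show ?thesis by simp
  qed
  have two: "norm (Y (Suc n) (2 * k) - Y n k) \<le> c * r ^ n" if n: "n0 \<le> n" and kT: "real k / 2 ^ n \<le> T" for n k
  proof -
    have kT': "real i * h n \<le> T" if "i \<le> k" for i
    proof -
      have "real i * h n \<le> real k * h n" using that h(1)[of n] by (intro mult_right_mono) auto
      then show ?thesis using kT by (simp add: h_def)
    qed
    have e: "real (2 * i) * h (Suc n) = real i * h n" for i by (simp add: h)
    have e': "real (2 * i - 2 * j) * h (Suc n) = real (i - j) * h n" if "j < i" for i j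
      using that by (simp add: h of_nat_diff)
    \<comment> \<open>The finer scheme read at even indices is an approximate path on the coarser
      grid with unchanged constants, because residual bounds refer to times and not to numbers of
      steps.\<close>
    have "\<forall>i\<le>k. norm (Y n i - Y (Suc n) (2 * i)) \<le> C * h n powr ((3 * \<gamma> - 1) / 2)"
    proof (rule stab)
      show "approx_path (h n) k M L (3 * \<gamma>) \<epsilon> (\<lambda>i. Y (Suc n) (2 * i))"
        unfolding approx_path_def
      proof (intro conjI allI impI)
        fix i j assume ij: "i \<le> k" "j < i" "real (i - j) * h n \<le> \<epsilon>"
        show "norm (res (real i * h n) (real j * h n) (Y (Suc n) (2 * i)) (Y (Suc n) (2 * j))) \<le> L * (real (i - j) * h n) powr (3 * \<gamma>)"
          by (rule R[of "Suc n" "2 * i" "2 * j", unfolded e e'[OF ij(2)]]) (use ij kT' n in auto)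
      next
        fix i assume "i \<le> k"
        then show "norm (Y (Suc n) (2 * i)) \<le> M" using YM[of "Suc n" "2 * i"] n kT' unfolding e by simp
      qed
    qed (use h(1)[of n] h\<epsilon>[OF n] kT'[of k] Y0 path[OF n, of k] in auto)
    then have "norm (Y (Suc n) (2 * k) - Y n k) \<le> C * (2 powr (- \<theta>)) ^ n"
      unfolding hp \<theta>_def by (metis order_refl norm_minus_commute)
    also have "\<dots> \<le> c * r ^ n" using c r C by (intro mult_mono power_mono) auto
    finally show ?thesis .
  qed
  define I where "I t = lim (\<lambda>n. S (t - real (dyadic_index n t) / 2 ^ n) (Y n (dyadic_index n t)))" for t
  have I: "(\<lambda>n. S (t - real (dyadic_index n t) / 2 ^ n) (Y n (dyadic_index n t))) \<longlonglongrightarrow> I t" if "t \<in> {0..T}" for t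
    using dyadic_limit[OF r(1,2) one two that] unfolding I_def convergent_LIMSEQ_iff by blast
  have I0: "I 0 = 0" using I[of 0] T LIMSEQ_unique[OF tendsto_const] by (fastforce simp: dyadic_index_def Y0)
  have le: "real (dyadic_index n t) * h n \<le> t" if "0 \<le> t" for n t
    using dyadic_index_le[OF that, of n] by (simp add: h_def)
  have Yd: "norm (Y n (dyadic_index n t)) \<le> M" if "n0 \<le> n" "0 \<le> t" "t \<le> T" for n t
    using YM[of n "dyadic_index n t"] le[of t n] that by auto
  have IM: "norm (I t) \<le> M" if t: "0 \<le> t" "t \<le> T" for t
  proof (rule tendsto_upperbound[OF tendsto_norm[OF I]])
    show "\<forall>\<^sub>F n in sequentially. norm (S (t - real (dyadic_index n t) / 2 ^ n) (Y n (dyadic_index n t))) \<le> M"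
      by (rule eventually_sequentiallyI[of n0]) (rule order_trans[OF norm_S Yd], use t in auto)
  qed (use t in auto)
  have close: "norm (res t s (I t) (I s)) \<le> L * (t - s) powr (3 * \<gamma>)"
    if st: "0 \<le> s" "s < t" "t \<le> T" "t - s < \<epsilon>" for s t
  proof -
    define t' s' where "t' = (\<lambda>n. real (dyadic_index n t) / 2 ^ n)" and "s' = (\<lambda>n. real (dyadic_index n s) / 2 ^ n)"
    have lim: "t' \<longlonglongrightarrow> t" "s' \<longlonglongrightarrow> s" unfolding t'_def s'_def using dyadic_index_tendsto st by auto
    have le': "0 \<le> s' n \<and> s' n \<le> t' n \<and> t' n \<le> T" "s' n \<le> s" for n
      using st dyadic_index_le[of t n] dyadic_index_le[of s n] dyadic_index_mono[of s t n]
      by (auto simp: t'_def s'_def divide_right_mono)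
    have "(\<lambda>n. t' n - s' n) \<longlonglongrightarrow> t - s" by (intro tendsto_diff lim)
    from order_tendstoD(1)[OF this, of 0] order_tendstoD(2)[OF this, of \<epsilon>]
    have ev: "\<forall>\<^sub>F n in sequentially. 0 < t' n - s' n \<and> t' n - s' n < \<epsilon>"
      using st by (simp add: eventually_conj)
    \<comment> \<open>The transport time \<open>s - s' n\<close> vanishes and the states are bounded
      by \<open>M\<close>, so \<open>ell_S\<close> makes the observation before transport converge
      to the same limit.\<close>
    have ptl: "(\<lambda>n. pt (Y n (dyadic_index n s))) \<longlonglongrightarrow> pt (I s)"
    proof -
      have "(\<lambda>n. ell (S (s - s' n) (Y n (dyadic_index n s)))) \<longlonglongrightarrow> ell (I s)"
      proof -
        have "bounded_linear ell" using ell_linear norm_ell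
          by (auto simp: bounded_linear_def bounded_linear_axioms_def linear_def intro!: exI[of _ 1])
        moreover have "(\<lambda>n. S (s - s' n) (Y n (dyadic_index n s))) \<longlonglongrightarrow> I s" using I[of s] st by (simp add: s'_def)
        ultimately show ?thesis by (rule bounded_linear.tendsto)
      qed
      moreover have "(\<lambda>n. ell (S (s - s' n) (Y n (dyadic_index n s))) - ell (Y n (dyadic_index n s))) \<longlonglongrightarrow> 0"
      proof (rule Lim_null_comparison)
        show "\<forall>\<^sub>F n in sequentially. norm (ell (S (s - s' n) (Y n (dyadic_index n s))) - ell (Y n (dyadic_index n s))) \<le> (s - s' n) * M"
        proof (rule eventually_sequentiallyI[of n0])
          fix n assume "n0 \<le> n"
          then show "norm (ell (S (s - s' n) (Y n (dyadic_index n s))) - ell (Y n (dyadic_index n s))) \<le> (s - s' n) * M"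
            using le'[of n] Yd[of n s] st by (intro order_trans[OF ell_S] mult_left_mono) auto
        qed
        have "(\<lambda>n. (s - s' n) * M) \<longlonglongrightarrow> (s - s) * M" by (intro tendsto_intros lim)
        then show "(\<lambda>n. (s - s' n) * M) \<longlonglongrightarrow> 0" by simp
      qed
      ultimately have "(\<lambda>n. ell (Y n (dyadic_index n s))) \<longlonglongrightarrow> ell (I s)"
        using tendsto_diff by fastforce
      then show ?thesis unfolding pt_def by (intro tendsto_intros)
    qed
    show ?thesis unfolding res_def
    proof (rule dyadic_limit_residual[OF _ _ I[of t] I[of s]])
      show "(\<lambda>n. B (t' n) (s' n) (Y n (dyadic_index n s))) \<longlonglongrightarrow> B t s (I s)" by (rule tendsto_B[OF le'(1) lim ptl])
      show "(\<lambda>n. L * (t' n - s' n) powr (3 * \<gamma>)) \<longlonglongrightarrow> L * (t - s) powr (3 * \<gamma>)"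
        using st by (intro tendsto_intros lim) auto
      show "\<forall>\<^sub>F n in sequentially. norm (Y n (dyadic_index n t)
        - S (real (dyadic_index n t - dyadic_index n s) * (1 / 2 ^ n)) (Y n (dyadic_index n s)) - B (t' n) (s' n) (Y n (dyadic_index n s))) \<le> L * (t' n - s' n) powr (3 * \<gamma>)"
        using ev eventually_ge_at_top[of n0]
      proof eventually_elim
        case (elim n)
        then have "dyadic_index n s < dyadic_index n t" by (simp add: s'_def t'_def divide_less_cancel)
        moreover have "real (dyadic_index n t - dyadic_index n s) * h n = t' n - s' n"
          using calculation by (simp add: t'_def s'_def h_def of_nat_diff diff_divide_distrib)
        ultimately show ?case
          using R[of n "dyadic_index n t" "dyadic_index n s"] le'[of n] elim
          by (simp add: res_def t'_def s'_def h_def)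
      qed
    qed (use st in auto)
  qed
  define M' where "M' = 2 * M + K\<^sup>2 * (T powr \<gamma> + (T powr \<gamma>)\<^sup>2)"
  have M': "0 \<le> M'" using LM unfolding M'_def by (intro add_nonneg_nonneg mult_nonneg_nonneg) auto
  \<comment> \<open>The discrete estimates say nothing about intervals longer than \<epsilon>. There
    the residual is at most \<open>M'\<close>, which is
    \<open>M' / \<epsilon> powr (3 * \<gamma>)\<close> times a quantity below
    \<open>(t - s) powr (3 * \<gamma>)\<close>.\<close>
  define L' where "L' = L + M' / \<epsilon> powr (3 * \<gamma>)"
  have "L' * \<epsilon> powr (3 * \<gamma>) = L * \<epsilon> powr (3 * \<gamma>) + M'" using \<epsilon> by (simp add: L'_def distrib_right)
  then have L': "L \<le> L'" "M' \<le> L' * \<epsilon> powr (3 * \<gamma>)"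
    using LM \<epsilon> M' by (auto simp: L'_def)
  have "norm (res t s (I t) (I s)) \<le> L' * (t - s) powr (3 * \<gamma>)" if st: "0 \<le> s" "s \<le> t" "t \<le> T" for s t
  proof -
    consider "s = t" | "s < t" "t - s < \<epsilon>" | "\<epsilon> \<le> t - s" using st by linarith
    then show ?thesis
    proof cases
      case 1
      then show ?thesis using st B_refl \<gamma> by (simp add: res_def)
    next
      case 2
      then show ?thesis using close[of s t] st L'(1) by (meson mult_right_mono order_trans powr_ge_zero)
    next
      case 3
      have "norm (res t s (I t) (I s)) \<le> L' * \<epsilon> powr (3 * \<gamma>)"
        using order_trans[OF res_le L'(2)[unfolded M'_def]] st IM by auto
      also have "\<dots> \<le> L' * (t - s) powr (3 * \<gamma>)"
        using 3 \<epsilon> \<gamma> LM L'(1) by (intro mult_left_mono powr_mono2) auto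
      finally show ?thesis .
    qed
  qed
  then show ?thesis using I0 LM L'(1) by (intro exI[of _ I] exI[of _ L']) auto
qed

text \<open>Both paths, sampled at \<open>N\<close> equal steps up to \<open>t\<close>, are
  approximate paths with constants independent of \<open>N\<close>. Stability bounds their distance
  at \<open>t\<close> by a positive power of \<open>t / N\<close>, and \<open>N\<close> is
  arbitrary.\<close>

theorem uniqueness:
  assumes \<nu>: "1 < \<nu>" "\<nu> \<le> 3 * \<gamma>" and L: "0 \<le> L" and Y0: "Y 0 = Y' 0"
    and R: "\<And>s t. 0 \<le> s \<Longrightarrow> s \<le> t \<Longrightarrow> t \<le> T \<Longrightarrow> norm (res t s (Y t) (Y s)) \<le> L * (t - s) powr \<nu>"
      "\<And>s t. 0 \<le> s \<Longrightarrow> s \<le> t \<Longrightarrow> t \<le> T \<Longrightarrow> norm (res t s (Y' t) (Y' s)) \<le> L * (t - s) powr \<nu>"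
    and t: "0 \<le> t" "t \<le> T"
  shows "Y t = Y' t"
proof (cases "t = 0")
  case True then show ?thesis using Y0 by simp
next
  case False
  \<comment> \<open>A uniform bound for both paths, read off from the residual between time 0 and
    the current time.\<close>
  define M where "M = norm (Y 0) + K\<^sup>2 * (T powr \<gamma> + (T powr \<gamma>)\<^sup>2) + L * T powr \<nu>"
  have M: "0 \<le> M" using L unfolding M_def by (intro add_nonneg_nonneg mult_nonneg_nonneg) auto
  have bd: "norm (y s) \<le> M" if "norm (y 0) \<le> norm (Y 0)" "norm (res s 0 (y s) (y 0)) \<le> L * (s - 0) powr \<nu>" "0 \<le> s" "s \<le> T" for y s
  proof -
    have w: "s powr \<gamma> \<le> T powr \<gamma>" "s powr \<nu> \<le> T powr \<nu>" using that \<gamma> \<nu> by (auto intro!: powr_mono2)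
    have "norm (B s 0 (y 0)) \<le> K\<^sup>2 * ((s - 0) powr \<gamma> + ((s - 0) powr \<gamma>)\<^sup>2)" using that by (intro B_bound) auto
    also have "\<dots> \<le> K\<^sup>2 * (T powr \<gamma> + (T powr \<gamma>)\<^sup>2)" using w by (intro mult_left_mono add_mono power_mono) auto
    finally have 1: "norm (B s 0 (y 0)) \<le> K\<^sup>2 * (T powr \<gamma> + (T powr \<gamma>)\<^sup>2)" .
    have 2: "norm (res s 0 (y s) (y 0)) \<le> L * T powr \<nu>"
      using that(2) mult_left_mono[OF w(2) L] by simp
    have "y s = S (s - 0) (y 0) + B s 0 (y 0) + res s 0 (y s) (y 0)" by (simp add: res_def)
    then show ?thesis using norm_add3_le[OF order_trans[OF norm_S that(1)] 1 2] unfolding M_def by metis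
  qed
  obtain C h0 where C: "0 \<le> C" "0 < h0"
    and stab: "\<And>h Y Y' N. 0 < h \<Longrightarrow> h \<le> h0 \<Longrightarrow> real N * h \<le> T \<Longrightarrow> Y 0 = Y' 0 \<Longrightarrow>
      approx_path h N M L \<nu> 1 Y \<Longrightarrow> approx_path h N M L \<nu> 1 Y' \<Longrightarrow>
      (\<forall>i\<le>N. norm (Y i - Y' i) \<le> C * h powr ((\<nu> - 1) / 2))"
    using stability[OF \<nu> L M zero_less_one] by blast
  have est: "norm (Y t - Y' t) \<le> C * (t / real N) powr ((\<nu> - 1) / 2)" if N: "0 < N" "t / real N \<le> h0" for N :: nat
  proof -
    define h where "h = t / real N"
    have h: "0 < h" "real N * h = t" using False t N by (auto simp: h_def)
    have le: "0 \<le> real i * h" "real i * h \<le> T" if "i \<le> N" for i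
    proof -
      have "real i * h \<le> real N * h" using that h(1) by (intro mult_right_mono) auto
      then show "real i * h \<le> T" using h t by simp
    qed (use h in auto)
    have path: "approx_path h N M L \<nu> 1 (\<lambda>i. y (real i * h))"
      if "norm (y 0) \<le> norm (Y 0)"
        and R: "\<And>s t. 0 \<le> s \<Longrightarrow> s \<le> t \<Longrightarrow> t \<le> T \<Longrightarrow> norm (res t s (y t) (y s)) \<le> L * (t - s) powr \<nu>" for y
      unfolding approx_path_def
    proof (intro conjI allI impI)
      fix i assume "i \<le> N"
      then show "norm (y (real i * h)) \<le> M" using R[of 0 "real i * h"] le[of i] that(1) by (intro bd) auto
    next
      fix i j assume ij: "i \<le> N" "j < i"
      have "real j * h \<le> real i * h" using ij h(1) by (intro mult_right_mono) auto
      moreover have "real i * h - real j * h = real (i - j) * h" using ij by (simp add: of_nat_diff left_diff_distrib)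
      ultimately show "norm (res (real i * h) (real j * h) (y (real i * h)) (y (real j * h))) \<le> L * (real (i - j) * h) powr \<nu>"
        using R[of "real j * h" "real i * h"] le[of i] le[of j] ij by simp
    qed
    have "\<forall>i\<le>N. norm (Y (real i * h) - Y' (real i * h)) \<le> C * h powr ((\<nu> - 1) / 2)"
      by (rule stab[where Y="\<lambda>i. Y (real i * h)" and Y'="\<lambda>i. Y' (real i * h)"])
         (use h N t Y0 R path[of Y] path[of Y'] in \<open>auto simp: h_def[symmetric]\<close>)
    then have "norm (Y (real N * h) - Y' (real N * h)) \<le> C * h powr ((\<nu> - 1) / 2)" by blast
    then show ?thesis unfolding h(2) by (simp add: h_def)
  qed
  have lim0: "(\<lambda>N. t / real N) \<longlonglongrightarrow> 0" by (rule lim_const_over_n)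
  then have "(\<lambda>N. C * (t / real N) powr ((\<nu> - 1) / 2)) \<longlonglongrightarrow> C * 0 powr ((\<nu> - 1) / 2)"
    using \<nu> t by (intro tendsto_mult tendsto_const tendsto_powr') auto
  moreover have "\<forall>\<^sub>F N in sequentially. norm (Y t - Y' t) \<le> C * (t / real N) powr ((\<nu> - 1) / 2)"
    using order_tendstoD(2)[OF lim0 C(2)] eventually_gt_at_top[of 0]
    by eventually_elim (rule est, auto)
  ultimately have "norm (Y t - Y' t) \<le> C * 0 powr ((\<nu> - 1) / 2)"
    by (intro tendsto_lowerbound) auto
  then show ?thesis using \<nu> by simp
qed

end

section \<open>The space of integrable classes\<close>

\<comment> \<open>The abstract argument takes limits in a type of class \<open>banach\<close>,
  whereas integrable functions carry only a seminorm; hence classes modulo null sets. The relation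
  is partial in order to exclude non-integrable functions.\<close>
quotient_type (overloaded) 'v lone = "real \<Rightarrow> 'v::{banach,second_countable_topology}" /
  partial: "\<lambda>f g. integrable lborel f \<and> integrable lborel g \<and> (AE x in lborel. f x = g x)"
  morphisms rep_lone abs_lone
proof (rule part_equivpI)
  show "\<exists>f. integrable lborel f \<and> integrable lborel f \<and> (AE x in lborel. f x = (f x :: 'v))"
    by (rule exI[of _ "\<lambda>_. 0"]) simp
qed (auto intro!: sympI transpI elim: eventually_mono eventually_elim2)

lemma integral_norm_add_le:
  fixes f g :: "real \<Rightarrow> 'v::{banach,second_countable_topology}"
  assumes "integrable lborel f" "integrable lborel g"
  shows "(LINT x|lborel. norm (f x + g x)) \<le> (LINT x|lborel. norm (f x)) + (LINT x|lborel. norm (g x))"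
proof -
  have "(LINT x|lborel. norm (f x + g x)) \<le> (LINT x|lborel. norm (f x) + norm (g x))"
    using assms by (intro integral_mono norm_triangle_ineq integrable_norm Bochner_Integration.integrable_add)
  then show ?thesis using assms by simp
qed

instantiation lone :: ("{banach,second_countable_topology}") real_normed_vector
begin

lift_definition zero_lone :: "'a lone" is "\<lambda>_. 0" by simp

lift_definition plus_lone :: "'a lone \<Rightarrow> 'a lone \<Rightarrow> 'a lone" is "\<lambda>f g x. f x + g x"
  by (auto elim: eventually_elim2)

lift_definition minus_lone :: "'a lone \<Rightarrow> 'a lone \<Rightarrow> 'a lone" is "\<lambda>f g x. f x - g x"
  by (auto elim: eventually_elim2)

lift_definition uminus_lone :: "'a lone \<Rightarrow> 'a lone" is "\<lambda>f x. - f x"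
  by auto

lift_definition scaleR_lone :: "real \<Rightarrow> 'a lone \<Rightarrow> 'a lone" is "\<lambda>c f x. c *\<^sub>R f x"
  by auto

lift_definition norm_lone :: "'a lone \<Rightarrow> real" is "\<lambda>f. LINT x|lborel. norm (f x)"
  by (intro integral_cong_AE) auto

definition dist_lone :: "'a lone \<Rightarrow> 'a lone \<Rightarrow> real" where "dist_lone f g = norm (f - g)"

definition sgn_lone :: "'a lone \<Rightarrow> 'a lone" where "sgn_lone f = scaleR (inverse (norm f)) f"

definition uniformity_lone :: "('a lone \<times> 'a lone) filter" where
  "uniformity_lone = (INF e\<in>{0<..}. principal {(x, y). dist x y < e})"

definition open_lone :: "'a lone set \<Rightarrow> bool" where
  "open_lone U = (\<forall>x\<in>U. \<forall>\<^sub>F (x', y) in uniformity. x' = x \<longrightarrow> y \<in> U)"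

instance
proof
  fix f g h :: "'a lone" and a b :: real
  show "norm (f + g) \<le> norm f + norm g"
    by transfer (simp add: integral_norm_add_le)
  show "(norm f = 0) = (f = 0)"
    by transfer (auto simp: integral_nonneg_eq_0_iff_AE)
  show "norm (a *\<^sub>R f) = \<bar>a\<bar> * norm f"
    by transfer simp
  show "dist f g = norm (f - g)" by (rule dist_lone_def)
  show "sgn f = inverse (norm f) *\<^sub>R f" by (rule sgn_lone_def)
  show "uniformity = (INF e\<in>{0<..}. principal {(x, y :: 'a lone). dist x y < e})" by (rule uniformity_lone_def)
  show "open U = (\<forall>x\<in>U. \<forall>\<^sub>F (x', y) in uniformity. x' = x \<longrightarrow> y \<in> U)" for U :: "'a lone set"
    by (rule open_lone_def)
  show "f + g + h = f + (g + h)" "f + g = g + f" "0 + f = f" "- f + f = 0" "f - g = f + - g"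
    by (transfer; auto simp: add_ac)+
  show "a *\<^sub>R (f + g) = a *\<^sub>R f + a *\<^sub>R g" "(a + b) *\<^sub>R f = a *\<^sub>R f + b *\<^sub>R f"
      "a *\<^sub>R b *\<^sub>R f = (a * b) *\<^sub>R f" "1 *\<^sub>R f = f"
    by (transfer; auto simp: scaleR_add_right scaleR_add_left)+
qed

end

lemma integrable_rep_lone: "integrable lborel (rep_lone F)"
  and abs_rep_lone [simp]: "abs_lone (rep_lone F) = F"
  using Quotient3_rep_reflp[OF Quotient3_lone, of F] Quotient3_abs_rep[OF Quotient3_lone, of F] by auto

lemma abs_lone_eq_iff:
  "integrable lborel f \<Longrightarrow> integrable lborel g \<Longrightarrow> abs_lone f = abs_lone g \<longleftrightarrow> (AE x in lborel. f x = g x)"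
  using Quotient3_rel[OF Quotient3_lone, of f g] by auto

lemma rep_abs_lone: "integrable lborel f \<Longrightarrow> AE x in lborel. rep_lone (abs_lone f) x = f x"
  using abs_lone_eq_iff[OF integrable_rep_lone, of f "abs_lone f"] by simp

lemma norm_abs_lone: "integrable lborel f \<Longrightarrow> norm (abs_lone f) = (LINT x|lborel. norm (f x))"
  by (rule norm_lone.abs_eq) simp

lemma abs_lone_diff: "integrable lborel f \<Longrightarrow> integrable lborel g \<Longrightarrow> abs_lone f - abs_lone g = abs_lone (\<lambda>x. f x - g x)"
  by (rule minus_lone.abs_eq) auto

lemma abs_lone_add: "integrable lborel f \<Longrightarrow> integrable lborel g \<Longrightarrow> abs_lone f + abs_lone g = abs_lone (\<lambda>x. f x + g x)"
  by (rule plus_lone.abs_eq) auto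

lemma abs_lone_scaleR: "integrable lborel f \<Longrightarrow> c *\<^sub>R abs_lone f = abs_lone (\<lambda>x. c *\<^sub>R f x)"
  by (rule scaleR_lone.abs_eq) auto

lemma abs_lone_zero: "abs_lone (\<lambda>_. 0) = 0"
  by (simp add: zero_lone_def)

text \<open>The Riesz-Fischer argument: summable norms force absolute convergence almost everywhere,
  the pointwise sum is integrable, and the tail of the series bounds the distance to it. The rate
  \<open>(1/2) ^ n\<close> is enough because every Cauchy sequence has a subsequence with such
  increments.\<close>

lemma lone_summable_complete:
  fixes D :: "nat \<Rightarrow> 'v::{banach,second_countable_topology} lone"
  assumes D: "\<And>n. norm (D n) \<le> (1/2) ^ n"
  shows "\<exists>L. (\<lambda>n. \<Sum>i<n. D i) \<longlonglongrightarrow> L"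
proof -
  define f where "f n = rep_lone (D n)" for n
  have f: "integrable lborel (f n)" "D n = abs_lone (f n)" for n
    by (simp_all add: f_def integrable_rep_lone)
  have fn: "(LINT x|lborel. norm (f n x)) \<le> (1/2) ^ n" for n
    using D[of n] by (simp add: f norm_abs_lone)
  have summ: "summable (\<lambda>n. LINT x|lborel. norm (f n x))"
    by (rule summable_comparison_test'[OF summable_geometric[of "1/2::real"], of 0])
       (auto simp: fn)
  have AE: "AE x in lborel. summable (\<lambda>n. norm (f n x))"
  proof -
    have "(\<integral>\<^sup>+x. (\<Sum>n. ennreal (norm (f n x))) \<partial>lborel) = (\<Sum>n. \<integral>\<^sup>+x. ennreal (norm (f n x)) \<partial>lborel)"
      using f by (intro nn_integral_suminf) auto
    also have "\<dots> = (\<Sum>n. ennreal (LINT x|lborel. norm (f n x)))"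
      using f by (intro arg_cong[where f=suminf] ext nn_integral_eq_integral) auto
    also have "\<dots> \<noteq> \<infinity>" using summ by (simp add: ennreal_suminf_neq_top)
    finally have "AE x in lborel. (\<Sum>n. ennreal (norm (f n x))) \<noteq> \<infinity>"
      using f by (intro nn_integral_PInf_AE) auto
    then show ?thesis by eventually_elim (simp add: summable_suminf_not_top)
  qed
  have int: "integrable lborel (\<lambda>x. \<Sum>n. f n x)"
    by (rule integrable_suminf[OF f(1) AE summ])
  have part: "(\<Sum>i<n. D i) = abs_lone (\<lambda>x. \<Sum>i<n. f i x)" for n
    by (induction n) (auto simp: abs_lone_zero f abs_lone_add)
  have "norm ((\<Sum>i<n. D i) - abs_lone (\<lambda>x. \<Sum>n. f n x)) \<le> 2 * (1/2) ^ n" for n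
  proof -
    have AE': "AE x in lborel. summable (\<lambda>i. norm (norm (f (i + n) x)))"
      using AE by eventually_elim (drule summable_ignore_initial_segment[where k=n], simp)
    have summ': "summable (\<lambda>i. LINT x|lborel. norm (norm (f (i + n) x)))"
      using summable_ignore_initial_segment[OF summ, of n] by simp
    have intn: "integrable lborel (\<lambda>x. norm (f (i + n) x))" for i using f by auto
    have "norm ((\<Sum>i<n. D i) - abs_lone (\<lambda>x. \<Sum>n. f n x)) = (LINT x|lborel. norm ((\<Sum>i<n. f i x) - (\<Sum>n. f n x)))"
      unfolding part using f int by (subst abs_lone_diff) (auto simp: norm_abs_lone)
    also have "\<dots> \<le> (LINT x|lborel. (\<Sum>i. norm (f (i + n) x)))"
    proof (rule integral_mono_AE)
      show "integrable lborel (\<lambda>x. \<Sum>i. norm (f (i + n) x))"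
        by (rule integrable_suminf[OF intn AE' summ'])
      show "AE x in lborel. norm ((\<Sum>i<n. f i x) - (\<Sum>n. f n x)) \<le> (\<Sum>i. norm (f (i + n) x))"
        using AE
      proof eventually_elim
        case (elim x)
        then have s: "summable (\<lambda>n. f n x)" by (rule summable_norm_cancel)
        have "norm (\<Sum>i. f (i + n) x) \<le> (\<Sum>i. norm (f (i + n) x))"
          using elim by (intro summable_norm summable_ignore_initial_segment)
        moreover have "(\<Sum>i<n. f i x) - (\<Sum>n. f n x) = - (\<Sum>i. f (i + n) x)"
          using suminf_minus_initial_segment[OF s, of n] by simp
        ultimately show ?case by (metis norm_minus_cancel)
      qed
    qed (use f int in auto)
    also have "\<dots> = (\<Sum>i. LINT x|lborel. norm (f (i + n) x))"
      by (rule integral_suminf[OF intn AE' summ'])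
    also have "\<dots> \<le> (\<Sum>i. (1/2) ^ n * (1/2) ^ i)"
      using summ' fn by (intro suminf_le summable_mult summable_geometric) (auto simp: power_add[symmetric] add.commute)
    also have "\<dots> = (1/2) ^ n * (\<Sum>i. (1/2) ^ i)" by (intro suminf_mult summable_geometric) simp
    finally show ?thesis by (simp add: suminf_geometric)
  qed
  then have "(\<lambda>n. (\<Sum>i<n. D i) - abs_lone (\<lambda>x. \<Sum>n. f n x)) \<longlonglongrightarrow> 0"
    by (rule Lim_null_comparison[OF always_eventually, rule_format])
       (intro tendsto_mult_right_zero LIMSEQ_power_zero, simp)
  from LIM_zero_cancel[OF this] show ?thesis ..
qed

instance lone :: ("{banach,second_countable_topology}") banach
proof
  fix X :: "nat \<Rightarrow> 'a lone"
  assume X: "Cauchy X"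
  have "\<exists>N. \<forall>m\<ge>N. \<forall>n\<ge>N. norm (X m - X n) < (1/2) ^ k" for k
    using CauchyD[OF X, of "(1/2) ^ k"] by auto
  then obtain N where N: "\<And>k m n. N k \<le> m \<Longrightarrow> N k \<le> n \<Longrightarrow> norm (X m - X n) < (1/2) ^ k" by metis
  define r where "r = rec_nat (N 0) (\<lambda>k m. Suc (m + N (Suc k)))"
  have r: "r (Suc k) = Suc (r k + N (Suc k))" for k by (simp add: r_def)
  have mono: "strict_mono r" by (rule strict_monoI_Suc) (simp add: r)
  have rN: "N k \<le> r k" for k by (cases k) (auto simp: r_def)
  have "norm (X (r (Suc k)) - X (r k)) \<le> (1/2) ^ k" for k
    using N[of k "r (Suc k)" "r k"] rN[of k] by (simp add: r)
  from lone_summable_complete[OF this] obtain L where "(\<lambda>n. \<Sum>i<n. X (r (Suc i)) - X (r i)) \<longlonglongrightarrow> L" ..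
  then have "(\<lambda>n. X (r n) - X (r 0)) \<longlonglongrightarrow> L"
    by (subst (asm) sum_lessThan_telescope)
  from tendsto_add[OF this tendsto_const[of "X (r 0)"]] have "(X \<circ> r) \<longlonglongrightarrow> L + X (r 0)"
    by (simp add: o_def)
  then show "convergent X" using Cauchy_converges_subseq[OF X mono] by (auto simp: convergent_def)
qed

lemma integrable_scaleR_bounded:
  fixes f :: "real \<Rightarrow> 'v::{banach,second_countable_topology}"
  assumes "integrable lborel f" "m \<in> borel_measurable lborel" "\<And>x. \<bar>m x\<bar> \<le> 1"
  shows "integrable lborel (\<lambda>x. m x *\<^sub>R f x)"
proof (rule Bochner_Integration.integrable_bound[OF assms(1)])
  show "(\<lambda>x. m x *\<^sub>R f x) \<in> borel_measurable lborel" using assms by measurable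
  show "AE x in lborel. norm (m x *\<^sub>R f x) \<le> norm (f x)"
    using assms(3) by (auto intro!: mult_left_le_one_le)
qed

text \<open>Truncating at zero makes the semigroup total: only nonnegative frequencies and times matter.\<close>
definition damping :: "real \<Rightarrow> real \<Rightarrow> real" where
  "damping t \<xi> = exp (- (max \<xi> 0 * max t 0))"

lemma damping_measurable [measurable]: "damping t \<in> borel_measurable lborel"
  unfolding damping_def by measurable

lemma damping_bounds: "0 \<le> damping t \<xi>" "damping t \<xi> \<le> 1" "\<bar>damping t \<xi>\<bar> \<le> 1"
  by (auto simp: damping_def)

lemma integrable_damping [simp]:
  fixes f :: "real \<Rightarrow> 'v::{banach,second_countable_topology}"
  shows "integrable lborel f \<Longrightarrow> integrable lborel (\<lambda>\<xi>. damping t \<xi> *\<^sub>R f \<xi>)"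
  by (intro integrable_scaleR_bounded damping_bounds damping_measurable)

lift_definition damp :: "real \<Rightarrow> 'v::{banach,second_countable_topology} lone \<Rightarrow> 'v lone" is
  "\<lambda>t f \<xi>. damping t \<xi> *\<^sub>R f \<xi>"
  by auto

lemma damp_abs_lone: "integrable lborel f \<Longrightarrow> damp t (abs_lone f) = abs_lone (\<lambda>\<xi>. damping t \<xi> *\<^sub>R f \<xi>)"
  by (rule damp.abs_eq) auto

lemma damp_linear: "linear (damp t :: 'v::{banach,second_countable_topology} lone \<Rightarrow> 'v lone)"
proof (rule linearI)
  fix F G :: "'v lone" and c :: real
  note int = integrable_rep_lone[of F] integrable_rep_lone[of G]
  have "damp t (abs_lone (rep_lone F) + abs_lone (rep_lone G)) = damp t (abs_lone (rep_lone F)) + damp t (abs_lone (rep_lone G))"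
    using int by (simp only: abs_lone_add damp_abs_lone Bochner_Integration.integrable_add integrable_damping scaleR_add_right)
  then show "damp t (F + G) = damp t F + damp t G" by simp
  have "damp t (c *\<^sub>R abs_lone (rep_lone F)) = c *\<^sub>R damp t (abs_lone (rep_lone F))"
    using int by (simp only: abs_lone_scaleR damp_abs_lone integrable_scaleR_right integrable_damping scaleR_scaleR mult.commute)
  then show "damp t (c *\<^sub>R F) = c *\<^sub>R damp t F" by simp
qed

lemma norm_damp: "norm (damp t F) \<le> norm F" for F :: "'v::{banach,second_countable_topology} lone"
proof transfer
  fix t and f :: "real \<Rightarrow> 'v"
  assume "integrable lborel f \<and> integrable lborel f \<and> (AE x in lborel. f x = f x)"
  then show "(LINT x|lborel. norm (damping t x *\<^sub>R f x)) \<le> (LINT x|lborel. norm (f x))"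
    by (intro integral_mono integrable_norm integrable_damping)
       (auto simp: damping_bounds mult_left_le_one_le)
qed

interpretation damp: contraction_semigroup "damp :: real \<Rightarrow> 'v::{banach,second_countable_topology} lone \<Rightarrow> 'v lone"
proof (rule contraction_semigroup.intro)
  fix s t :: real and F :: "'v lone"
  show "linear (damp t :: 'v lone \<Rightarrow> _)" by (rule damp_linear)
  show "norm (damp t F) \<le> norm F" by (rule norm_damp)
  show "damp 0 F = F" by transfer (auto simp: damping_def)
  show "damp (s + t) F = damp s (damp t F)" if "0 \<le> s" "0 \<le> t"
  proof -
    have "damping (s + t) \<xi> = damping s \<xi> * damping t \<xi>" for \<xi>
      using that by (simp add: damping_def exp_add[symmetric] distrib_left)
    then have "damp (s + t) (abs_lone (rep_lone F)) = damp s (damp t (abs_lone (rep_lone F)))"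
      by (simp only: damp_abs_lone integrable_rep_lone integrable_damping scaleR_scaleR)
    then show ?thesis by simp
  qed
  show "continuous_on UNIV (\<lambda>t. damp t F)"
    unfolding continuous_on_sequentially
  proof (intro allI ballI impI)
    fix x :: "nat \<Rightarrow> real" and a :: real assume "(\<forall>n. x n \<in> UNIV) \<and> x \<longlonglongrightarrow> a"
    then have x: "x \<longlonglongrightarrow> a" by simp
    let ?f = "rep_lone F"
    have int: "integrable lborel (\<lambda>\<xi>. damping t \<xi> *\<^sub>R ?f \<xi>)" for t
      by (intro integrable_damping integrable_rep_lone)
    \<comment> \<open>Frequencies are unbounded, so the multipliers do not converge uniformly;
      dominated convergence gives strong continuity, with twice the norm as majorant.\<close>
    have lim: "(\<lambda>n. LINT \<xi>|lborel. norm (damping (x n) \<xi> *\<^sub>R ?f \<xi> - damping a \<xi> *\<^sub>R ?f \<xi>)) \<longlonglongrightarrow> (LINT \<xi>|(lborel :: real measure). 0)"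
    proof (rule integral_dominated_convergence[where w="\<lambda>\<xi>. 2 * norm (?f \<xi>)"])
      show "integrable lborel (\<lambda>\<xi>. 2 * norm (?f \<xi>))" using integrable_rep_lone[of F] by simp
      show "AE \<xi> in lborel. (\<lambda>n. norm (damping (x n) \<xi> *\<^sub>R ?f \<xi> - damping a \<xi> *\<^sub>R ?f \<xi>)) \<longlonglongrightarrow> 0"
      proof (intro AE_I2 tendsto_norm_zero LIM_zero tendsto_scaleR tendsto_const)
        fix \<xi> show "(\<lambda>n. damping (x n) \<xi>) \<longlonglongrightarrow> damping a \<xi>"
          unfolding damping_def by (intro tendsto_intros x)
      qed
      show "AE \<xi> in lborel. norm (norm (damping (x n) \<xi> *\<^sub>R ?f \<xi> - damping a \<xi> *\<^sub>R ?f \<xi>)) \<le> 2 * norm (?f \<xi>)" for n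
      proof (rule AE_I2)
        fix \<xi>
        have "\<bar>damping (x n) \<xi> - damping a \<xi>\<bar> \<le> 2" using damping_bounds(1,2)[of "x n" \<xi>] damping_bounds(1,2)[of a \<xi>] by linarith
        then show "norm (norm (damping (x n) \<xi> *\<^sub>R ?f \<xi> - damping a \<xi> *\<^sub>R ?f \<xi>)) \<le> 2 * norm (?f \<xi>)"
          by (simp add: scaleR_diff_left[symmetric] mult_right_mono)
      qed
    qed (rule borel_measurable_const, rule borel_measurable_integrable[OF integrable_norm[OF Bochner_Integration.integrable_diff[OF int int]]])
    have "norm (damp (x n) F - damp a F) = (LINT \<xi>|lborel. norm (damping (x n) \<xi> *\<^sub>R ?f \<xi> - damping a \<xi> *\<^sub>R ?f \<xi>))" for n
    proof -
      have "damp (x n) F - damp a F = abs_lone (\<lambda>\<xi>. damping (x n) \<xi> *\<^sub>R ?f \<xi> - damping a \<xi> *\<^sub>R ?f \<xi>)"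
        using damp_abs_lone[OF integrable_rep_lone, of _ F] abs_lone_diff[OF int int] by simp
      then show ?thesis by (simp only: norm_abs_lone Bochner_Integration.integrable_diff int)
    qed
    then have "(\<lambda>n. norm (damp (x n) F - damp a F)) \<longlonglongrightarrow> 0" using lim by simp
    then show "((\<lambda>t. damp t F) \<circ> x) \<longlonglongrightarrow> damp a F"
      unfolding o_def by (rule LIM_zero_cancel[OF tendsto_norm_zero_cancel])
  qed
qed

section \<open>Weighted classes\<close>

locale weighted =
  fixes phi :: "real \<Rightarrow> real"
  assumes phi_measurable: "set_borel_measurable lborel {0<..} phi"
begin

definition wt :: "real \<Rightarrow> real" where
  "wt \<xi> = indicator {0..} \<xi> * (\<bar>phi \<xi>\<bar> * (1 + \<xi>))"

lemma phi_indicator_measurable [measurable]: "(\<lambda>\<xi>. indicator {0<..} \<xi> * phi \<xi>) \<in> borel_measurable borel"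
  using phi_measurable by (simp add: set_borel_measurable_def)

text \<open>Measurability of \<open>phi\<close> is assumed on the open half line only, while the
  norm integrates over the closed one. The frequency 0 is split off as a multiple of the indicator
  of a point.\<close>

lemma wt_measurable [measurable]: "wt \<in> borel_measurable borel"
proof -
  have "wt = (\<lambda>\<xi>. \<bar>indicator {0<..} \<xi> * phi \<xi>\<bar> * (1 + \<xi>) + indicator {0} \<xi> * \<bar>phi 0\<bar>)"
    by (auto simp: wt_def fun_eq_iff indicator_def)
  also have "\<dots> \<in> borel_measurable borel" by measurable
  finally show ?thesis .
qed

lemma wt_nonneg: "0 \<le> wt \<xi>"
  by (auto simp: wt_def indicator_def)

lemma L1N_eq: "L1N phi g = (\<integral>\<^sup>+ \<xi>. ennreal (norm (wt \<xi> *\<^sub>R g \<xi>)) \<partial>lborel)"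
  unfolding L1N_def by (intro nn_integral_cong) (auto simp: wt_def indicator_def)

definition cls :: "(real \<Rightarrow> 'v::{banach,second_countable_topology}) \<Rightarrow> 'v lone" where
  "cls g = abs_lone (\<lambda>\<xi>. wt \<xi> *\<^sub>R g \<xi>)"

lemma wt_scaleR_measurable:
  fixes g :: "real \<Rightarrow> 'v::{banach,second_countable_topology}"
  assumes "set_borel_measurable lborel {0..} g"
  shows "(\<lambda>\<xi>. wt \<xi> *\<^sub>R g \<xi>) \<in> borel_measurable lborel"
proof -
  have [measurable]: "(\<lambda>\<xi>. indicator {0..} \<xi> *\<^sub>R g \<xi>) \<in> borel_measurable borel"
    using assms by (simp add: set_borel_measurable_def)
  have "(\<lambda>\<xi>. wt \<xi> *\<^sub>R g \<xi>) = (\<lambda>\<xi>. wt \<xi> *\<^sub>R (indicator {0..} \<xi> *\<^sub>R g \<xi>))"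
    by (auto simp: wt_def fun_eq_iff indicator_def)
  also have "\<dots> \<in> borel_measurable lborel" by measurable
  finally show ?thesis .
qed

lemma inL1_integrable:
  fixes g :: "real \<Rightarrow> 'v::{banach,second_countable_topology}"
  assumes "inL1 phi g"
  shows "integrable lborel (\<lambda>\<xi>. wt \<xi> *\<^sub>R g \<xi>)"
  using assms wt_scaleR_measurable by (intro integrableI_bounded) (auto simp: inL1_def L1N_eq)

lemma L1N_cls:
  fixes g :: "real \<Rightarrow> 'v::{banach,second_countable_topology}"
  assumes "inL1 phi g"
  shows "L1N phi g = ennreal (norm (cls g))"
  unfolding L1N_eq cls_def norm_abs_lone[OF inL1_integrable[OF assms]]
  by (intro nn_integral_eq_integral integrable_norm inL1_integrable assms) auto

lemma L1N_zero_imp_cls: "L1N phi g = 0 \<Longrightarrow> inL1 phi g \<Longrightarrow> cls g = 0"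
  by (simp add: L1N_cls)

lemma inL1_bound:
  fixes f :: "real \<Rightarrow> 'w::{banach,second_countable_topology}" and g :: "real \<Rightarrow> 'v::{banach,second_countable_topology}"
  assumes "set_borel_measurable lborel {0..} f" and g: "inL1 phi g" and c: "0 \<le> c"
    and le: "\<And>\<xi>. 0 \<le> \<xi> \<Longrightarrow> norm (f \<xi>) \<le> c * norm (g \<xi>)"
  shows "inL1 phi f" and "norm (cls f) \<le> c * norm (cls g)"
proof -
  have "L1N phi f \<le> (\<integral>\<^sup>+ \<xi>. ennreal c * ennreal (norm (wt \<xi> *\<^sub>R g \<xi>)) \<partial>lborel)"
    unfolding L1N_eq
  proof (intro nn_integral_mono)
    fix \<xi>
    have "norm (wt \<xi> *\<^sub>R f \<xi>) \<le> c * norm (wt \<xi> *\<^sub>R g \<xi>)"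
    proof (cases "0 \<le> \<xi>")
      case True
      from mult_left_mono[OF le[OF True] wt_nonneg[of \<xi>]] show ?thesis by (simp add: wt_nonneg mult_ac)
    qed (simp add: wt_def)
    then show "ennreal (norm (wt \<xi> *\<^sub>R f \<xi>)) \<le> ennreal c * ennreal (norm (wt \<xi> *\<^sub>R g \<xi>))"
      using c by (simp add: ennreal_mult[symmetric] ennreal_leI)
  qed
  also have "\<dots> = ennreal c * L1N phi g"
    unfolding L1N_eq
    by (rule nn_integral_cmult,
        rule measurable_compose[OF borel_measurable_integrable[OF integrable_norm[OF inL1_integrable[OF g]]] measurable_ennreal])
  also have "\<dots> = ennreal (c * norm (cls g))" using c by (simp add: L1N_cls[OF g] ennreal_mult)
  finally have *: "L1N phi f \<le> ennreal (c * norm (cls g))" .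
  then show f: "inL1 phi f" using assms(1) by (auto simp: inL1_def intro: order.strict_trans1)
  show "norm (cls f) \<le> c * norm (cls g)"
    using * c unfolding L1N_cls[OF f] by (subst (asm) ennreal_le_iff) auto
qed

lemma inL1_linear:
  fixes g :: "real \<Rightarrow> 'v::{banach,second_countable_topology}" and L :: "'v \<Rightarrow> 'w::{banach,second_countable_topology}"
  assumes "bounded_linear L" and g: "inL1 phi g" and c: "0 \<le> c" "\<And>x. norm (L x) \<le> c * norm x"
  shows "inL1 phi (\<lambda>\<xi>. L (g \<xi>))" and "norm (cls (\<lambda>\<xi>. L (g \<xi>))) \<le> c * norm (cls g)"
proof -
  interpret L: bounded_linear L by fact
  have "L \<in> borel_measurable borel" by (intro borel_measurable_continuous_onI L.continuous_on continuous_on_id)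
  moreover have "(\<lambda>\<xi>. indicator {0..} \<xi> *\<^sub>R g \<xi>) \<in> borel_measurable borel"
    using g by (simp add: inL1_def set_borel_measurable_def)
  ultimately have "(\<lambda>\<xi>. L (indicator {0..} \<xi> *\<^sub>R g \<xi>)) \<in> borel_measurable borel" by measurable
  then have m: "set_borel_measurable lborel {0..} (\<lambda>\<xi>. L (g \<xi>))" by (simp add: set_borel_measurable_def L.scaleR)
  show "inL1 phi (\<lambda>\<xi>. L (g \<xi>))" "norm (cls (\<lambda>\<xi>. L (g \<xi>))) \<le> c * norm (cls g)"
    using inL1_bound[OF m g c(1)] c(2) by blast+
qed

lemma inL1_linear':
  fixes g :: "real \<Rightarrow> 'v::{banach,second_countable_topology}" and L :: "'v \<Rightarrow> 'w::{banach,second_countable_topology}"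
  assumes L: "bounded_linear L" and g: "inL1 phi g"
  shows "inL1 phi (\<lambda>\<xi>. L (g \<xi>))"
  using inL1_linear(1)[OF L g, of "onorm L"] onorm[OF L] onorm_pos_le[OF L] by blast

lemma inL1_add:
  fixes f g :: "real \<Rightarrow> 'v::{banach,second_countable_topology}"
  assumes f: "inL1 phi f" and g: "inL1 phi g"
  shows "inL1 phi (\<lambda>\<xi>. f \<xi> + g \<xi>)" and "cls (\<lambda>\<xi>. f \<xi> + g \<xi>) = cls f + cls g"
proof -
  have [measurable]: "(\<lambda>\<xi>. indicator {0..} \<xi> *\<^sub>R f \<xi>) \<in> borel_measurable borel" "(\<lambda>\<xi>. indicator {0..} \<xi> *\<^sub>R g \<xi>) \<in> borel_measurable borel"
    using f g by (simp_all add: inL1_def set_borel_measurable_def)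
  have "(\<lambda>\<xi>. indicator {0..} \<xi> *\<^sub>R f \<xi> + indicator {0..} \<xi> *\<^sub>R g \<xi>) \<in> borel_measurable borel" by measurable
  then have "set_borel_measurable lborel {0..} (\<lambda>\<xi>. f \<xi> + g \<xi>)" by (simp add: set_borel_measurable_def scaleR_add_right)
  moreover have "integrable lborel (\<lambda>\<xi>. wt \<xi> *\<^sub>R (f \<xi> + g \<xi>))"
    unfolding scaleR_add_right by (intro Bochner_Integration.integrable_add inL1_integrable f g)
  then have "L1N phi (\<lambda>\<xi>. f \<xi> + g \<xi>) < \<infinity>" by (auto simp: L1N_eq integrable_iff_bounded)
  ultimately show "inL1 phi (\<lambda>\<xi>. f \<xi> + g \<xi>)" by (simp add: inL1_def)
  show "cls (\<lambda>\<xi>. f \<xi> + g \<xi>) = cls f + cls g"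
    unfolding cls_def by (simp add: scaleR_add_right abs_lone_add inL1_integrable f g)
qed

lemma inL1_scaleR:
  fixes g :: "real \<Rightarrow> 'v::{banach,second_countable_topology}"
  assumes g: "inL1 phi g"
  shows "inL1 phi (\<lambda>\<xi>. c *\<^sub>R g \<xi>)" and "cls (\<lambda>\<xi>. c *\<^sub>R g \<xi>) = c *\<^sub>R cls g"
proof -
  show "inL1 phi (\<lambda>\<xi>. c *\<^sub>R g \<xi>)" by (rule inL1_linear'[OF bounded_linear_scaleR_right g])
  show "cls (\<lambda>\<xi>. c *\<^sub>R g \<xi>) = c *\<^sub>R cls g"
    unfolding cls_def by (simp add: abs_lone_scaleR inL1_integrable g mult.commute)
qed

lemma inL1_diff:
  fixes f g :: "real \<Rightarrow> 'v::{banach,second_countable_topology}"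
  assumes f: "inL1 phi f" and g: "inL1 phi g"
  shows "inL1 phi (\<lambda>\<xi>. f \<xi> - g \<xi>)" and "cls (\<lambda>\<xi>. f \<xi> - g \<xi>) = cls f - cls g"
  using inL1_add[OF f inL1_scaleR(1)[OF g, of "-1"]] inL1_scaleR(2)[OF g, of "-1"] by auto

lemma inL1_zero: "inL1 phi (\<lambda>_. 0 :: 'v::{banach,second_countable_topology})" "cls (\<lambda>_. 0 :: 'v) = 0"
  by (auto simp: inL1_def set_borel_measurable_def L1N_def cls_def abs_lone_zero)

text \<open>At negative frequencies the exponential grows and differs from \<open>damping\<close>,
  but the weight vanishes there, so the classes agree.\<close>

lemma inL1_damp:
  fixes g :: "real \<Rightarrow> 'v::{banach,second_countable_topology}"
  assumes g: "inL1 phi g" and \<tau>: "0 \<le> \<tau>"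
  shows "inL1 phi (\<lambda>\<xi>. exp (- \<xi> * \<tau>) *\<^sub>R g \<xi>)" and "cls (\<lambda>\<xi>. exp (- \<xi> * \<tau>) *\<^sub>R g \<xi>) = damp \<tau> (cls g)"
proof -
  have [measurable]: "(\<lambda>\<xi>. indicator {0..} \<xi> *\<^sub>R g \<xi>) \<in> borel_measurable borel"
    using g by (simp add: inL1_def set_borel_measurable_def)
  have "(\<lambda>\<xi>. exp (- \<xi> * \<tau>) *\<^sub>R (indicator {0..} \<xi> *\<^sub>R g \<xi>)) \<in> borel_measurable borel" by measurable
  then have m: "set_borel_measurable lborel {0..} (\<lambda>\<xi>. exp (- \<xi> * \<tau>) *\<^sub>R g \<xi>)"
    by (simp add: set_borel_measurable_def mult.commute)
  show "inL1 phi (\<lambda>\<xi>. exp (- \<xi> * \<tau>) *\<^sub>R g \<xi>)"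
    by (rule inL1_bound(1)[OF m g, of 1]) (auto intro!: mult_left_le_one_le simp: \<tau>)
  have "wt \<xi> *\<^sub>R exp (- \<xi> * \<tau>) *\<^sub>R g \<xi> = damping \<tau> \<xi> *\<^sub>R wt \<xi> *\<^sub>R g \<xi>" for \<xi>
    using \<tau> by (cases "0 \<le> \<xi>") (auto simp: damping_def wt_def)
  then show "cls (\<lambda>\<xi>. exp (- \<xi> * \<tau>) *\<^sub>R g \<xi>) = damp \<tau> (cls g)"
    by (simp only: cls_def damp_abs_lone[OF inL1_integrable[OF g]])
qed

lemma cls_eq_iff:
  fixes f g :: "real \<Rightarrow> 'v::{banach,second_countable_topology}"
  assumes f: "inL1 phi f" and g: "inL1 phi g"
  shows "L1N phi (\<lambda>\<xi>. f \<xi> - g \<xi>) = 0 \<longleftrightarrow> cls f = cls g"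
  by (simp add: L1N_cls[OF inL1_diff(1)[OF f g]] inL1_diff(2)[OF f g])

lemma inL1_cdelta1:
  fixes f :: "real \<Rightarrow> real \<Rightarrow> 'v::{banach,second_countable_topology}"
  assumes "inL1 phi (f t)" "inL1 phi (f s)" "s \<le> t"
  shows "inL1 phi (cdelta1 f t s)" and "cls (cdelta1 f t s) = cls (f t) - damp (t - s) (cls (f s))"
  unfolding cdelta1_def using assms
  by (simp_all only: inL1_diff inL1_damp diff_ge_0_iff_ge)

lemma inL1_cdelta2:
  fixes B :: "real \<Rightarrow> real \<Rightarrow> real \<Rightarrow> 'v::{banach,second_countable_topology}"
  assumes "inL1 phi (B t s)" "inL1 phi (B t u)" "inL1 phi (B u s)" "u \<le> t"
  shows "inL1 phi (cdelta2 B t u s)" and "cls (cdelta2 B t u s) = cls (B t s) - cls (B t u) - damp (t - u) (cls (B u s))"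
  unfolding cdelta2_def using assms
  by (simp_all only: inL1_diff inL1_damp diff_ge_0_iff_ge)

lemma L1N_less_iff:
  fixes f g :: "real \<Rightarrow> 'v::{banach,second_countable_topology}"
  assumes "inL1 phi f" "inL1 phi g" "0 < e"
  shows "L1N phi (\<lambda>\<xi>. f \<xi> - g \<xi>) < ennreal e \<longleftrightarrow> dist (cls f) (cls g) < e"
  using assms by (simp add: L1N_cls inL1_diff dist_norm ennreal_less_iff)

lemma tC1_iff:
  fixes f :: "real \<Rightarrow> real \<Rightarrow> 'v::{banach,second_countable_topology}"
  shows "tC1 phi I f \<longleftrightarrow> (\<forall>t\<in>I. inL1 phi (f t)) \<and> continuous_on I (\<lambda>t. cls (f t))"
  unfolding tC1_def continuous_on_iff dist_real_def by (auto simp: L1N_less_iff)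

lemma tC2_cont:
  fixes B :: "real \<Rightarrow> real \<Rightarrow> real \<Rightarrow> 'v::{banach,second_countable_topology}"
  assumes B: "tC2 phi {0..T} B" and le: "\<And>n. 0 \<le> b n \<and> b n \<le> a n \<and> a n \<le> T"
    and lim: "a \<longlonglongrightarrow> t" "b \<longlonglongrightarrow> s"
  shows "(\<lambda>n. cls (B (a n) (b n))) \<longlonglongrightarrow> cls (B t s)"
proof -
  have t: "t \<in> {0..T}" "s \<in> {0..T}" "s \<le> t"
    using le lim by (auto intro: LIMSEQ_le LIMSEQ_le_const LIMSEQ_le_const2 order_trans)
  have inL: "inL1 phi (B t s)" if "t \<in> {0..T}" "s \<in> {0..T}" "s \<le> t" for t s
    using B that by (auto simp: tC2_def)
  show ?thesis
  proof (rule tendstoI)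
    fix e :: real assume e: "0 < e"
    have "\<exists>d>0. \<forall>t'\<in>{0..T}. \<forall>s'\<in>{0..T}. s' \<le> t' \<longrightarrow> \<bar>t' - t\<bar> + \<bar>s' - s\<bar> < d \<longrightarrow>
        L1N phi (\<lambda>\<xi>. B t' s' \<xi> - B t s \<xi>) < ennreal e"
      using B[unfolded tC2_def, THEN conjunct2, rule_format, OF t e] by simp
    then obtain d where d: "d > 0" "\<forall>t'\<in>{0..T}. \<forall>s'\<in>{0..T}. s' \<le> t' \<longrightarrow> \<bar>t' - t\<bar> + \<bar>s' - s\<bar> < d \<longrightarrow>
        L1N phi (\<lambda>\<xi>. B t' s' \<xi> - B t s \<xi>) < ennreal e" by blast
    have "\<forall>\<^sub>F n in sequentially. \<bar>a n - t\<bar> < d/2" "\<forall>\<^sub>F n in sequentially. \<bar>b n - s\<bar> < d/2"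
      using tendstoD[OF lim(1), of "d/2"] tendstoD[OF lim(2), of "d/2"] d(1) by (auto simp: dist_real_def)
    then show "\<forall>\<^sub>F n in sequentially. dist (cls (B (a n) (b n))) (cls (B t s)) < e"
    proof eventually_elim
      case (elim n)
      then have "\<bar>a n - t\<bar> + \<bar>b n - s\<bar> < d" by simp
      then show ?case using d(2)[rule_format, of "a n" "b n"] le[of n] t inL e by (subst (asm) L1N_less_iff) auto
    qed
  qed
qed

lemma tC2_I:
  fixes B :: "real \<Rightarrow> real \<Rightarrow> real \<Rightarrow> 'v::{banach,second_countable_topology}"
  assumes inL: "\<And>t s. t \<in> I \<Longrightarrow> s \<in> I \<Longrightarrow> s \<le> t \<Longrightarrow> inL1 phi (B t s)"
    and cont: "continuous_on {p. fst p \<in> I \<and> snd p \<in> I \<and> snd p \<le> fst p} (\<lambda>p. cls (B (fst p) (snd p)))"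
  shows "tC2 phi I B"
  unfolding tC2_def
proof (intro conjI ballI impI allI)
  fix t s e :: real assume ts: "t \<in> I" "s \<in> I" "s \<le> t" and e: "0 < e"
  obtain d where d: "d > 0" "\<And>p. fst p \<in> I \<Longrightarrow> snd p \<in> I \<Longrightarrow> snd p \<le> fst p \<Longrightarrow> dist p (t, s) < d \<Longrightarrow>
      dist (cls (B (fst p) (snd p))) (cls (B t s)) < e"
    using cont[unfolded continuous_on_iff, rule_format, of "(t, s)" e] ts e by auto
  show "\<exists>d>0. \<forall>t'\<in>I. \<forall>s'\<in>I. s' \<le> t' \<longrightarrow> \<bar>t' - t\<bar> + \<bar>s' - s\<bar> < d \<longrightarrow> L1N phi (\<lambda>\<xi>. B t' s' \<xi> - B t s \<xi>) < ennreal e"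
  proof (intro exI[of _ d] conjI ballI impI d(1))
    fix t' s' assume *: "t' \<in> I" "s' \<in> I" "s' \<le> t'" "\<bar>t' - t\<bar> + \<bar>s' - s\<bar> < d"
    have "dist (t', s') (t, s) < d"
      using *(4) sqrt_sum_squares_le_sum_abs[of "t' - t" "s' - s"] by (simp add: dist_Pair_Pair dist_real_def)
    then show "L1N phi (\<lambda>\<xi>. B t' s' \<xi> - B t s \<xi>) < ennreal e"
      using d(2)[of "(t', s')"] * ts e inL by (subst L1N_less_iff) auto
  qed
qed (use inL in auto)

text \<open>A class already contains the weight \<open>\<bar>phi \<xi>\<bar> * (1 + \<xi>)\<close>.
  Integrating the underlying function against \<open>phi\<close> therefore means integrating the
  class against the bounded multiplier \<open>sgn (phi \<xi>) / (1 + \<xi>)\<close>.\<close>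

definition ell :: "'v::{banach,second_countable_topology} lone \<Rightarrow> 'v" where
  "ell F = (LINT \<xi>|lborel. (indicator {0<..} \<xi> * (sgn (phi \<xi>) / (1 + \<xi>))) *\<^sub>R rep_lone F \<xi>)"

lemma ell_weight_measurable [measurable]: "(\<lambda>\<xi>. indicator {0<..} \<xi> * (sgn (phi \<xi>) / (1 + \<xi>))) \<in> borel_measurable borel"
proof -
  have "(\<lambda>\<xi>. indicator {0<..} \<xi> * (sgn (phi \<xi>) / (1 + \<xi>))) = (\<lambda>\<xi>. sgn (indicator {0<..} \<xi> * phi \<xi>) / (1 + \<xi>))"
    by (auto simp: indicator_def)
  also have "\<dots> \<in> borel_measurable borel" by measurable
  finally show ?thesis .
qed

lemma ell_weight_bound: "\<bar>indicator {0<..} \<xi> * (sgn (phi \<xi>) / (1 + \<xi>))\<bar> \<le> 1"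
  by (auto simp: indicator_def sgn_if)

lemma ell_integrable:
  fixes f :: "real \<Rightarrow> 'v::{banach,second_countable_topology}"
  shows "integrable lborel f \<Longrightarrow> integrable lborel (\<lambda>\<xi>. (indicator {0<..} \<xi> * (sgn (phi \<xi>) / (1 + \<xi>))) *\<^sub>R f \<xi>)"
  by (rule integrable_scaleR_bounded[OF _ _ ell_weight_bound])
     (simp_all only: measurable_lborel2 ell_weight_measurable)

lemma ell_abs_lone:
  fixes f :: "real \<Rightarrow> 'v::{banach,second_countable_topology}"
  assumes "integrable lborel f"
  shows "ell (abs_lone f) = (LINT \<xi>|lborel. (indicator {0<..} \<xi> * (sgn (phi \<xi>) / (1 + \<xi>))) *\<^sub>R f \<xi>)"
  unfolding ell_def
proof (rule integral_cong_AE)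
  show "AE \<xi> in lborel. (indicator {0<..} \<xi> * (sgn (phi \<xi>) / (1 + \<xi>))) *\<^sub>R rep_lone (abs_lone f) \<xi>
      = (indicator {0<..} \<xi> * (sgn (phi \<xi>) / (1 + \<xi>))) *\<^sub>R f \<xi>"
    using rep_abs_lone[OF assms] by eventually_elim simp
qed (intro borel_measurable_integrable ell_integrable assms integrable_rep_lone)+

lemma ell_linear: "linear (ell :: 'v::{banach,second_countable_topology} lone \<Rightarrow> 'v)"
proof (rule linearI)
  fix F G :: "'v lone" and c :: real
  note int = integrable_rep_lone[of F] integrable_rep_lone[of G]
  have "ell (abs_lone (rep_lone F) + abs_lone (rep_lone G)) = ell (abs_lone (rep_lone F)) + ell (abs_lone (rep_lone G))"
    using int by (simp only: abs_lone_add ell_abs_lone Bochner_Integration.integrable_add scaleR_add_right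
        Bochner_Integration.integral_add ell_integrable)
  then show "ell (F + G) = ell F + ell G" by simp
  have "ell (c *\<^sub>R abs_lone (rep_lone F)) = c *\<^sub>R ell (abs_lone (rep_lone F))"
    using int by (simp only: abs_lone_scaleR ell_abs_lone integrable_scaleR_right scaleR_left_commute[of _ c]
        integral_scaleR_right)
  then show "ell (c *\<^sub>R F) = c *\<^sub>R ell F" by simp
qed

lemma norm_ell_le: "norm (ell F) \<le> norm F" for F :: "'v::{banach,second_countable_topology} lone"
proof -
  note int = integrable_rep_lone[of F]
  have "norm (ell F) \<le> (LINT \<xi>|lborel. norm ((indicator {0<..} \<xi> * (sgn (phi \<xi>) / (1 + \<xi>))) *\<^sub>R rep_lone F \<xi>))"
    unfolding ell_def by (rule integral_norm_bound)
  also have "\<dots> \<le> (LINT \<xi>|lborel. norm (rep_lone F \<xi>))"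
  proof (intro integral_mono integrable_norm ell_integrable int)
    fix \<xi> :: real show "norm ((indicator {0<..} \<xi> * (sgn (phi \<xi>) / (1 + \<xi>))) *\<^sub>R rep_lone F \<xi>) \<le> norm (rep_lone F \<xi>)"
      unfolding norm_scaleR real_norm_def by (intro mult_left_le_one_le ell_weight_bound) auto
  qed
  also have "\<dots> = norm F" using norm_abs_lone[OF int] by simp
  finally show ?thesis .
qed

text \<open>This is where the factor 1 + \<xi> in the norm is used.\<close>
lemma ell_damp:
  fixes F :: "'v::{banach,second_countable_topology} lone"
  assumes t: "0 \<le> t"
  shows "norm (ell (damp t F) - ell F) \<le> t * norm F"
proof -
  note int = integrable_rep_lone[of F]
  let ?m = "\<lambda>\<xi>. indicator {0<..} \<xi> * (sgn (phi \<xi>) / (1 + \<xi>))"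
  have "ell (damp t F) - ell F = (LINT \<xi>|lborel. ?m \<xi> *\<^sub>R damping t \<xi> *\<^sub>R rep_lone F \<xi> - ?m \<xi> *\<^sub>R rep_lone F \<xi>)"
    using ell_abs_lone[OF integrable_damping[OF int], of t] damp_abs_lone[OF int, of t]
      Bochner_Integration.integral_diff[OF ell_integrable[OF integrable_damping[OF int, of t]] ell_integrable[OF int]]
    by (simp add: ell_def)
  then have "norm (ell (damp t F) - ell F) \<le> (LINT \<xi>|lborel. norm (?m \<xi> *\<^sub>R damping t \<xi> *\<^sub>R rep_lone F \<xi> - ?m \<xi> *\<^sub>R rep_lone F \<xi>))"
    by (simp only: integral_norm_bound)
  also have "\<dots> \<le> (LINT \<xi>|lborel. t * norm (rep_lone F \<xi>))"
  proof (intro integral_mono integrable_norm Bochner_Integration.integrable_diff ell_integrable integrable_damping int integrable_mult_right)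
    fix \<xi> :: real
    have "\<bar>?m \<xi> * (damping t \<xi> - 1)\<bar> \<le> t"
    proof (cases "0 < \<xi>")
      case True
      have "1 - \<xi> * t \<le> exp (- (\<xi> * t))" using exp_ge_add_one_self[of "- (\<xi> * t)"] by simp
      moreover have "exp (- (\<xi> * t)) \<le> 1" using True t by simp
      ultimately have d: "\<bar>damping t \<xi> - 1\<bar> \<le> \<xi> * t" using True t by (simp add: damping_def)
      have "\<bar>?m \<xi>\<bar> \<le> 1 / (1 + \<xi>)" using True by (simp add: sgn_if)
      then have "\<bar>?m \<xi> * (damping t \<xi> - 1)\<bar> \<le> 1 / (1 + \<xi>) * (\<xi> * t)"
        unfolding abs_mult using d True by (intro mult_mono) auto
      also have "\<dots> = \<xi> / (1 + \<xi>) * t" by simp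
      also have "\<dots> \<le> 1 * t" using True t by (intro mult_right_mono) auto
      finally show ?thesis by simp
    qed (use t in simp)
    then have "\<bar>?m \<xi> * (damping t \<xi> - 1)\<bar> * norm (rep_lone F \<xi>) \<le> t * norm (rep_lone F \<xi>)" by (rule mult_right_mono) simp
    moreover have "?m \<xi> *\<^sub>R damping t \<xi> *\<^sub>R rep_lone F \<xi> - ?m \<xi> *\<^sub>R rep_lone F \<xi> = (?m \<xi> * (damping t \<xi> - 1)) *\<^sub>R rep_lone F \<xi>"
      by (simp add: right_diff_distrib scaleR_diff_left)
    ultimately show "norm (?m \<xi> *\<^sub>R damping t \<xi> *\<^sub>R rep_lone F \<xi> - ?m \<xi> *\<^sub>R rep_lone F \<xi>) \<le> t * norm (rep_lone F \<xi>)"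
      by simp
  qed
  also have "\<dots> = t * norm F" using norm_abs_lone[OF int] by simp
  finally show ?thesis .
qed

lemma ell_cls:
  fixes g :: "real \<Rightarrow> 'v::{banach,second_countable_topology}"
  assumes "inL1 phi g"
  shows "ell (cls g) = phint phi g"
proof -
  have "(indicator {0<..} \<xi> * (sgn (phi \<xi>) / (1 + \<xi>))) *\<^sub>R wt \<xi> *\<^sub>R g \<xi> = indicator {0<..} \<xi> *\<^sub>R phi \<xi> *\<^sub>R g \<xi>" for \<xi>
    by (cases "0 < \<xi>") (auto simp: wt_def sgn_if)
  then show ?thesis
    by (simp only: cls_def ell_abs_lone[OF inL1_integrable[OF assms]] phint_def set_lebesgue_integral_def)
qed

text \<open>Frequencies of weight zero get the value \<open>0\<close> because \<open>inverse 0 = 0\<close>; they carry no mass.\<close>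
definition unc :: "'v::{banach,second_countable_topology} lone \<Rightarrow> real \<Rightarrow> 'v" where
  "unc F \<xi> = inverse (wt \<xi>) *\<^sub>R rep_lone F \<xi>"

definition supp_mult :: "real \<Rightarrow> real" where
  "supp_mult \<xi> = (if wt \<xi> = 0 then 0 else 1)"

lemma supp_mult_integrable:
  fixes f :: "real \<Rightarrow> 'v::{banach,second_countable_topology}"
  shows "integrable lborel f \<Longrightarrow> integrable lborel (\<lambda>\<xi>. supp_mult \<xi> *\<^sub>R f \<xi>)"
  by (rule integrable_scaleR_bounded) (auto simp: supp_mult_def[abs_def])

lemma inL1_unc: "inL1 phi (unc F)" for F :: "'v::{banach,second_countable_topology} lone"
proof -
  have m: "rep_lone F \<in> borel_measurable borel" using integrable_rep_lone[of F] by auto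
  have "(\<lambda>\<xi>. indicator {0..} \<xi> *\<^sub>R inverse (wt \<xi>) *\<^sub>R rep_lone F \<xi>) \<in> borel_measurable borel" using m by measurable
  then have "set_borel_measurable lborel {0..} (unc F)" by (simp add: set_borel_measurable_def unc_def)
  moreover have "wt \<xi> *\<^sub>R unc F \<xi> = supp_mult \<xi> *\<^sub>R rep_lone F \<xi>" for \<xi> by (simp add: unc_def supp_mult_def)
  then have "L1N phi (unc F) < \<infinity>"
    using supp_mult_integrable[OF integrable_rep_lone, of F] by (simp add: L1N_eq integrable_iff_bounded)
  ultimately show ?thesis by (simp add: inL1_def)
qed

text \<open>Classes of the form \<open>cls g\<close> vanish where the weight does, and
  \<open>proj\<close> cuts an arbitrary class down to that part. The limits built in the abstract
  space are not tracked to be of this form.\<close>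

definition proj :: "'v::{banach,second_countable_topology} lone \<Rightarrow> 'v lone" where
  "proj F = cls (unc F)"

lemma proj_abs_lone:
  fixes f :: "real \<Rightarrow> 'v::{banach,second_countable_topology}"
  assumes f: "integrable lborel f"
  shows "proj (abs_lone f) = abs_lone (\<lambda>\<xi>. supp_mult \<xi> *\<^sub>R f \<xi>)"
proof -
  have e: "wt \<xi> *\<^sub>R unc F \<xi> = supp_mult \<xi> *\<^sub>R rep_lone F \<xi>" for \<xi> and F :: "'v lone" by (simp add: unc_def supp_mult_def)
  show ?thesis unfolding proj_def cls_def e
  proof (subst abs_lone_eq_iff)
    show "AE \<xi> in lborel. supp_mult \<xi> *\<^sub>R rep_lone (abs_lone f) \<xi> = supp_mult \<xi> *\<^sub>R f \<xi>"
      using rep_abs_lone[OF f] by eventually_elim simp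
  qed (use f supp_mult_integrable integrable_rep_lone in auto)
qed

lemma proj_diff: "proj (F - G) = proj F - proj G" for F :: "'v::{banach,second_countable_topology} lone"
proof -
  note int = integrable_rep_lone[of F] integrable_rep_lone[of G]
  have "proj (abs_lone (rep_lone F) - abs_lone (rep_lone G)) = proj (abs_lone (rep_lone F)) - proj (abs_lone (rep_lone G))"
    using int by (simp only: abs_lone_diff proj_abs_lone Bochner_Integration.integrable_diff scaleR_diff_right supp_mult_integrable)
  then show ?thesis by simp
qed

lemma norm_proj: "norm (proj F) \<le> norm F" for F :: "'v::{banach,second_countable_topology} lone"
proof -
  note int = integrable_rep_lone[of F]
  have "norm (proj (abs_lone (rep_lone F))) \<le> norm (abs_lone (rep_lone F))"
    unfolding proj_abs_lone[OF int] norm_abs_lone[OF int] norm_abs_lone[OF supp_mult_integrable[OF int]]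
    by (intro integral_mono integrable_norm supp_mult_integrable int) (simp add: supp_mult_def)
  then show ?thesis by simp
qed

lemma proj_damp: "proj (damp t F) = damp t (proj F)" for F :: "'v::{banach,second_countable_topology} lone"
proof -
  note int = integrable_rep_lone[of F]
  have "proj (damp t (abs_lone (rep_lone F))) = damp t (proj (abs_lone (rep_lone F)))"
    using int by (simp only: damp_abs_lone proj_abs_lone integrable_damping supp_mult_integrable scaleR_left_commute)
  then show ?thesis by simp
qed

lemma proj_cls: "inL1 phi g \<Longrightarrow> proj (cls g) = cls g" for g :: "real \<Rightarrow> 'v::{banach,second_countable_topology}"
proof -
  assume g: "inL1 phi g"
  have "supp_mult \<xi> *\<^sub>R wt \<xi> *\<^sub>R g \<xi> = wt \<xi> *\<^sub>R g \<xi>" for \<xi> by (simp add: supp_mult_def)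
  then show ?thesis by (simp only: cls_def proj_abs_lone[OF inL1_integrable[OF g]])
qed

text \<open>At a positive frequency of weight zero \<open>phi\<close> vanishes, hence so does the
  multiplier in \<open>ell\<close>: nothing that \<open>proj\<close> discards is observed.\<close>

lemma ell_proj: "ell (proj F) = ell F" for F :: "'v::{banach,second_countable_topology} lone"
proof -
  note int = integrable_rep_lone[of F]
  have "(indicator {0<..} \<xi> * (sgn (phi \<xi>) / (1 + \<xi>))) *\<^sub>R supp_mult \<xi> *\<^sub>R rep_lone F \<xi>
     = (indicator {0<..} \<xi> * (sgn (phi \<xi>) / (1 + \<xi>))) *\<^sub>R rep_lone F \<xi>" for \<xi>
    by (auto simp: supp_mult_def wt_def indicator_def)
  then have "ell (proj (abs_lone (rep_lone F))) = ell (abs_lone (rep_lone F))"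
    by (simp only: proj_abs_lone[OF int] ell_abs_lone[OF int] ell_abs_lone[OF supp_mult_integrable[OF int]])
  then show ?thesis by simp
qed

end

section \<open>Estimates on the coefficients\<close>

text \<open>The third estimate is the discrete form of a bounded second derivative.\<close>
definition tame :: "('a::real_normed_vector \<Rightarrow> 'b::real_normed_vector) \<Rightarrow> bool" where
  "tame f \<longleftrightarrow> (\<exists>K\<ge>0. (\<forall>y. norm (f y) \<le> K) \<and> (\<forall>y y'. norm (f y - f y') \<le> K * norm (y - y')) \<and>
     (\<forall>y v y' v'. norm ((f (y + v) - f y) - (f (y' + v') - f y')) \<le> K * (norm (v - v') + norm (y - y') * norm v)))"

lemma tame_linear:
  assumes f: "tame f" and L: "bounded_linear L"
  shows "tame (\<lambda>y. L (f y))"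
proof -
  interpret L: bounded_linear L by fact
  obtain K where K: "K \<ge> 0" "\<And>y. norm (f y) \<le> K" "\<And>y y'. norm (f y - f y') \<le> K * norm (y - y')"
    "\<And>y v y' v'. norm ((f (y + v) - f y) - (f (y' + v') - f y')) \<le> K * (norm (v - v') + norm (y - y') * norm v)"
    using f by (auto simp: tame_def)
  obtain c where c: "c > 0" "\<And>x. norm (L x) \<le> norm x * c" using L.pos_bounded by blast
  have *: "norm (L x) \<le> K * c * b" if "norm x \<le> K * b" for x b
    using order_trans[OF c(2)[of x] mult_right_mono[OF that, of c]] c(1) by (simp add: mult_ac)
  show ?thesis unfolding tame_def
  proof (intro exI[of _ "K * c"] conjI allI)
    show "norm (L (f y)) \<le> K * c" for y using *[of "f y" 1] K(2) by simp
    show "norm (L (f y) - L (f y')) \<le> K * c * norm (y - y')" for y y'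
      using *[OF K(3)] by (simp add: L.diff)
    show "norm ((L (f (y + v)) - L (f y)) - (L (f (y' + v')) - L (f y'))) \<le> K * c * (norm (v - v') + norm (y - y') * norm v)" for y v y' v'
      using *[OF K(4)] by (simp add: L.diff)
  qed (use K c in simp)
qed

lemma tame_add:
  assumes f: "tame f" and g: "tame g"
  shows "tame (\<lambda>y. f y + g y)"
proof -
  obtain K where K: "K \<ge> 0" "\<And>y. norm (f y) \<le> K" "\<And>y y'. norm (f y - f y') \<le> K * norm (y - y')"
    "\<And>y v y' v'. norm ((f (y + v) - f y) - (f (y' + v') - f y')) \<le> K * (norm (v - v') + norm (y - y') * norm v)"
    using f by (auto simp: tame_def)
  obtain M where M: "M \<ge> 0" "\<And>y. norm (g y) \<le> M" "\<And>y y'. norm (g y - g y') \<le> M * norm (y - y')"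
    "\<And>y v y' v'. norm ((g (y + v) - g y) - (g (y' + v') - g y')) \<le> M * (norm (v - v') + norm (y - y') * norm v)"
    using g by (auto simp: tame_def)
  have *: "norm z \<le> (K + M) * b" if "z = x + x'" "norm x \<le> K * b" "norm x' \<le> M * b" for x x' z :: 'b and b
    unfolding that(1) distrib_right by (rule norm_triangle_le) (use that in simp)
  show ?thesis unfolding tame_def
  proof (intro exI[of _ "K + M"] conjI allI)
    show "norm (f y + g y) \<le> K + M" for y using *[of _ "f y" "g y" 1] K(2) M(2) by simp
    show "norm (f y + g y - (f y' + g y')) \<le> (K + M) * norm (y - y')" for y y'
      by (rule *[OF _ K(3) M(3)]) simp
    show "norm ((f (y + v) + g (y + v) - (f y + g y)) - (f (y' + v') + g (y' + v') - (f y' + g y')))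
       \<le> (K + M) * (norm (v - v') + norm (y - y') * norm v)" for y v y' v'
      by (rule *[OF _ K(4) M(4)]) simp
  qed (use K M in simp)
qed

lemma tame_const: "tame (\<lambda>_. c)"
  unfolding tame_def by (rule exI[of _ "norm c"]) (auto intro!: mult_nonneg_nonneg add_nonneg_nonneg)

lemma tame_sum: "(\<And>i. i \<in> I \<Longrightarrow> tame (f i)) \<Longrightarrow> tame (\<lambda>y. \<Sum>i\<in>I. f i y)"
  by (induction I rule: infinite_finite_induct) (auto intro: tame_add tame_const)

lemma tame_mult:
  fixes f g :: "'a::real_normed_vector \<Rightarrow> real"
  assumes f: "tame f" and g: "tame g"
  shows "tame (\<lambda>y. f y * g y)"
proof -
  obtain K where K: "K \<ge> 0" "\<And>y. \<bar>f y\<bar> \<le> K" "\<And>y y'. \<bar>f y - f y'\<bar> \<le> K * norm (y - y')"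
    "\<And>y v y' v'. \<bar>(f (y + v) - f y) - (f (y' + v') - f y')\<bar> \<le> K * (norm (v - v') + norm (y - y') * norm v)"
    using f by (auto simp: tame_def)
  obtain M where M: "M \<ge> 0" "\<And>y. \<bar>g y\<bar> \<le> M" "\<And>y y'. \<bar>g y - g y'\<bar> \<le> M * norm (y - y')"
    "\<And>y v y' v'. \<bar>(g (y + v) - g y) - (g (y' + v') - g y')\<bar> \<le> M * (norm (v - v') + norm (y - y') * norm v)"
    using g by (auto simp: tame_def)
  show ?thesis unfolding tame_def real_norm_def
  proof (intro exI[of _ "9 * (K * M)"] conjI allI)
    show KM: "0 \<le> 9 * (K * M)" using K M by simp
    show "\<bar>f y * g y\<bar> \<le> 9 * (K * M)" for y
      using mult_mono[OF K(2)[of y] M(2)[of y]] K(1) KM by (simp add: abs_mult)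
    show "\<bar>f y * g y - f y' * g y'\<bar> \<le> 9 * (K * M) * norm (y - y')" for y y'
    proof -
      have "f y * g y - f y' * g y' = (f y - f y') * g y + f y' * (g y - g y')" by (simp add: algebra_simps)
      moreover have "\<bar>(f y - f y') * g y\<bar> \<le> (K * norm (y - y')) * M" "\<bar>f y' * (g y - g y')\<bar> \<le> K * (M * norm (y - y'))"
        unfolding abs_mult using K M by (auto intro!: mult_mono)
      moreover have "0 \<le> K * M * norm (y - y')" using K M by simp
      ultimately show ?thesis by (simp add: mult_ac)
    qed
    fix y v y' v' :: 'a
    let ?e = "norm (v - v') + norm (y - y') * norm v"
    have e: "0 \<le> ?e" "0 \<le> norm (v - v')" "0 \<le> norm (y - y') * norm v" by simp_all
    define a b where "a = f (y + v) - f y" and "b = g (y + v) - g y"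
    define a' b' where "a' = f (y' + v') - f y'" and "b' = g (y' + v') - g y'"
    define p q where "p = g (y + v) - g (y' + v)" and "q = g (y' + v) - g (y' + v')"
    have 1: "\<bar>(a - a') * g (y + v)\<bar> \<le> K * ?e * M"
      unfolding abs_mult a_def a'_def using K M e by (intro mult_mono) auto
    have 4: "\<bar>f y' * (b - b')\<bar> \<le> K * (M * ?e)"
      unfolding abs_mult b_def b'_def using K M e by (intro mult_mono) auto
    have 3: "\<bar>(f y - f y') * b\<bar> \<le> K * norm (y - y') * (M * norm v)"
      unfolding abs_mult b_def using K M M(3)[of "y + v" y] by (intro mult_mono) auto
    have a2: "\<bar>a'\<bar> \<le> 2 * K" unfolding a'_def using K(2)[of "y' + v'"] K(2)[of y'] by linarith
    have p2: "\<bar>p\<bar> \<le> 2 * M" unfolding p_def using M(2)[of "y + v"] M(2)[of "y' + v"] by linarith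
    have 5: "\<bar>a' * q\<bar> \<le> 2 * K * (M * norm (v - v'))"
      unfolding abs_mult using a2 M(3)[of "y' + v" "y' + v'"] K(1) M(1) by (intro mult_mono) (auto simp: q_def)
    have a3: "\<bar>a'\<bar> \<le> K * norm v + K * norm (v - v')"
    proof -
      have "\<bar>a'\<bar> \<le> K * norm v'" unfolding a'_def using K(3)[of "y' + v'" y'] by simp
      also have "norm v' \<le> norm v + norm (v - v')" by (metis norm_minus_commute norm_triangle_sub)
      finally show ?thesis using K(1) by (simp add: mult_left_mono distrib_left)
    qed
    \<comment> \<open>The target bound contains no product of \<open>norm (v - v')\<close> with
      \<open>norm (y - y')\<close>. So \<open>p\<close> is bounded by the Lipschitz estimate next to
      \<open>norm v\<close>, but only by \<open>2 * M\<close> next to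
      \<open>norm (v - v')\<close>.\<close>
    have 6: "\<bar>a' * p\<bar> \<le> K * norm v * (M * norm (y - y')) + K * norm (v - v') * (2 * M)"
    proof -
      have "\<bar>p\<bar> \<le> M * norm (y - y')" unfolding p_def using M(3)[of "y + v" "y' + v"] by simp
      then have "K * norm v * \<bar>p\<bar> \<le> K * norm v * (M * norm (y - y'))" using K(1) by (intro mult_left_mono) auto
      moreover have "K * norm (v - v') * \<bar>p\<bar> \<le> K * norm (v - v') * (2 * M)" using p2 K(1) by (intro mult_left_mono) auto
      moreover have "\<bar>a' * p\<bar> \<le> (K * norm v + K * norm (v - v')) * \<bar>p\<bar>" unfolding abs_mult using a3 by (rule mult_right_mono) simp
      ultimately show ?thesis by (simp add: distrib_right)
    qed
    \<comment> \<open>A Leibniz rule for second differences: the outer terms contain a full second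
      difference of one factor, the middle ones products of first differences, with \<open>b\<close>
      and \<open>p + q\<close> each exchanging one argument at a time.\<close>
    have eq: "(f (y + v) * g (y + v) - f y * g y) - (f (y' + v') * g (y' + v') - f y' * g y')
        = (a - a') * g (y + v) + a' * p + a' * q + (f y - f y') * b + f y' * (b - b')"
      unfolding a_def b_def a'_def b'_def p_def q_def by (simp add: algebra_simps)
    have "\<bar>(f (y + v) * g (y + v) - f y * g y) - (f (y' + v') * g (y' + v') - f y' * g y')\<bar>
        \<le> K * ?e * M + (K * norm v * (M * norm (y - y')) + K * norm (v - v') * (2 * M)) + 2 * K * (M * norm (v - v'))
          + K * norm (y - y') * (M * norm v) + K * (M * ?e)"
    proof -
      have "\<bar>x1 + x2 + x3 + x4 + x5\<bar> \<le> b1 + b2 + b3 + b4 + b5"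
        if "\<bar>x1\<bar> \<le> b1" "\<bar>x2\<bar> \<le> b2" "\<bar>x3\<bar> \<le> b3" "\<bar>x4\<bar> \<le> b4" "\<bar>x5\<bar> \<le> b5"
        for x1 x2 x3 x4 x5 b1 b2 b3 b4 b5 :: real using that by linarith
      then show ?thesis unfolding eq using 1 6 5 3 4 by blast
    qed
    also have "\<dots> = (K * M) * (6 * norm (v - v') + 4 * (norm (y - y') * norm v))" by (simp add: algebra_simps)
    also have "\<dots> \<le> (K * M) * (9 * ?e)" using K(1) M(1) e by (intro mult_left_mono) auto
    also have "\<dots> = 9 * (K * M) * ?e" by simp
    finally show "\<bar>(f (y + v) * g (y + v) - f y * g y) - (f (y' + v') * g (y' + v') - f y' * g y')\<bar> \<le> 9 * (K * M) * ?e" .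
  qed
qed

lemma norm_axis_le: "norm (axis i x :: 'b::real_normed_vector ^ 'n) \<le> norm x"
proof -
  have "norm (axis i x :: 'b ^ 'n) \<le> (\<Sum>j\<in>UNIV. norm ((axis i x :: 'b ^ 'n) $ j))"
    unfolding norm_vec_def by (intro L2_set_le_sum) simp
  also have "\<dots> = norm x" by (simp add: axis_def if_distrib[of norm] cong: if_cong)
  finally show "norm (axis i x :: 'b ^ 'n) \<le> norm x" .
qed

lemma bounded_linear_axis: "bounded_linear (axis i :: 'b::real_normed_vector \<Rightarrow> 'b ^ 'n)"
proof (rule bounded_linear_intro[where K=1])
  show "norm (axis i x :: 'b ^ 'n) \<le> norm x * 1" for x by (simp add: norm_axis_le)
qed (auto simp: axis_def vec_eq_iff)

lemma tame_vec:
  fixes f :: "'a::real_normed_vector \<Rightarrow> 'b::real_normed_vector ^ 'n"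
  assumes "\<And>i. tame (\<lambda>y. f y $ i)"
  shows "tame f"
proof -
  have "f = (\<lambda>y. \<Sum>i\<in>UNIV. axis i (f y $ i))"
    by (auto simp: fun_eq_iff vec_eq_iff axis_def if_distrib cong: if_cong)
  moreover have "tame (\<lambda>y. \<Sum>i\<in>UNIV. axis i (f y $ i))"
    by (intro tame_sum tame_linear[OF assms] bounded_linear_axis)
  ultimately show ?thesis by simp
qed

lemma lipschitz_of_derivative:
  fixes f :: "'a::real_normed_vector \<Rightarrow> 'b::real_normed_vector" and D :: "'a \<Rightarrow> 'a \<Rightarrow>\<^sub>L 'b"
  assumes "\<And>x. (f has_derivative blinfun_apply (D x)) (at x)" "\<And>x. norm (D x) \<le> c"
  shows "norm (f y - f y') \<le> c * norm (y - y')"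
  by (rule differentiable_bound[where f'="\<lambda>x. blinfun_apply (D x)" and S=UNIV])
     (use assms in \<open>auto simp: norm_blinfun.rep_eq[symmetric] intro: has_derivative_at_withinI\<close>)

lemma has_derivative_shift:
  assumes "(f has_derivative f') (at (x + v))"
  shows "((\<lambda>x. f (x + v)) has_derivative f') (at x)"
proof -
  have "((\<lambda>x. x + v) has_derivative (\<lambda>h. h)) (at x)" by (auto intro!: derivative_eq_intros)
  from has_derivative_compose[OF this assms] show ?thesis by simp
qed

text \<open>For fixed \<open>v\<close> the map from \<open>x\<close> to
  \<open>f (x + v) - f x\<close> has derivative \<open>D (x + v) - D x\<close>, of size
  \<open>c * norm v\<close>. The mean value inequality moves the base point, and the Lipschitz bound
  then exchanges \<open>v\<close> for \<open>v'\<close>.\<close>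

lemma tame_of_derivatives:
  fixes f :: "'a::real_normed_vector \<Rightarrow> 'b::real_normed_vector" and D :: "'a \<Rightarrow> 'a \<Rightarrow>\<^sub>L 'b"
    and D' :: "'a \<Rightarrow> 'a \<Rightarrow>\<^sub>L 'a \<Rightarrow>\<^sub>L 'b"
  assumes f: "\<And>x. (f has_derivative blinfun_apply (D x)) (at x)"
    and D: "\<And>x. (D has_derivative blinfun_apply (D' x)) (at x)"
    and b: "bounded (range f)" "bounded (range D)" "bounded (range D')"
  shows "tame f"
proof -
  obtain c where c: "\<And>x. norm (f x) \<le> c" "\<And>x. norm (D x) \<le> c" "\<And>x. norm (D' x) \<le> c"
  proof -
    obtain c0 c1 c2 where "\<And>x. norm (f x) \<le> c0" "\<And>x. norm (D x) \<le> c1" "\<And>x. norm (D' x) \<le> c2"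
      using b unfolding bounded_iff by (metis rangeI)
    then show ?thesis by (intro that[of "max c0 (max c1 c2)"]) (auto simp: le_max_iff_disj)
  qed
  have c0: "0 \<le> c" using c(1) norm_ge_zero order_trans by blast
  note lip = lipschitz_of_derivative[OF f c(2)] and Dlip = lipschitz_of_derivative[OF D c(3)]
  show ?thesis unfolding tame_def
  proof (intro exI[of _ c] conjI allI)
    fix y v y' v'
    have "norm ((\<lambda>x. f (x + v) - f x) y - (\<lambda>x. f (x + v) - f x) y') \<le> c * norm v * norm (y - y')"
    proof (rule lipschitz_of_derivative)
      show "((\<lambda>x. f (x + v) - f x) has_derivative blinfun_apply (D (x + v) - D x)) (at x)" for x
        unfolding minus_blinfun.rep_eq
        using has_derivative_diff[OF has_derivative_shift[OF f] f, of v x] by (simp add: fun_diff_def)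
      show "norm (D (x + v) - D x) \<le> c * norm v" for x using Dlip[of "x + v" x] by simp
    qed
    moreover have "norm (f (y' + v) - f (y' + v')) \<le> c * norm (v - v')" using lip[of "y' + v" "y' + v'"] by simp
    moreover have "(f (y + v) - f y) - (f (y' + v') - f y') = ((f (y + v) - f y) - (f (y' + v) - f y')) + (f (y' + v) - f (y' + v'))"
      by simp
    ultimately show "norm ((f (y + v) - f y) - (f (y' + v') - f y')) \<le> c * (norm (v - v') + norm (y - y') * norm v)"
      by (simp only:) (intro norm_triangle_le, simp add: distrib_left mult_ac)
  qed (use c c0 lip in auto)
qed

text \<open>As a function of \<open>v\<close> the Taylor remainder at \<open>y\<close> has
  derivative \<open>D (y + v) - D y\<close>. The mean value inequality is applied in
  \<open>v\<close>, once to a single remainder and once to the difference of two; in the latter the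
  derivative is a second difference of \<open>D\<close>, which tameness controls.\<close>

lemma taylor_bounds:
  fixes f :: "'a::real_normed_vector \<Rightarrow> 'b::real_normed_vector" and D :: "'a \<Rightarrow> 'a \<Rightarrow>\<^sub>L 'b"
  assumes f: "\<And>x. (f has_derivative blinfun_apply (D x)) (at x)" and D: "tame D"
  shows "\<exists>K\<ge>0. (\<forall>y v. norm (f (y + v) - f y - D y v) \<le> K * (norm v)\<^sup>2) \<and>
     (\<forall>y v y' v'. norm ((f (y + v) - f y - D y v) - (f (y' + v') - f y' - D y' v'))
        \<le> K * ((norm v + norm v') * norm (v - v') + norm (y - y') * (norm v)\<^sup>2))"
proof -
  obtain K where K: "K \<ge> 0" "\<And>y y'. norm (D y - D y') \<le> K * norm (y - y')"
    "\<And>y v y' v'. norm ((D (y + v) - D y) - (D (y' + v') - D y')) \<le> K * (norm (v - v') + norm (y - y') * norm v)"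
    using D by (auto simp: tame_def)
  define R where "R y v = f (y + v) - f y - D y v" for y v
  have R: "(R y has_derivative blinfun_apply (D (y + v) - D y)) (at v)" for y v
  proof -
    have "((\<lambda>v. f (y + v)) has_derivative blinfun_apply (D (y + v))) (at v)"
      using has_derivative_shift[of f _ v y] f[of "v + y"] by (simp add: add.commute)
    then show ?thesis unfolding R_def[abs_def] minus_blinfun.rep_eq
      by (auto intro!: derivative_eq_intros bounded_linear_imp_has_derivative blinfun.bounded_linear_right)
  qed
  have R0: "R y 0 = 0" for y by (simp add: R_def)
  have Rv: "norm (R y v - R y v') \<le> K * (norm v + norm v') * norm (v - v')" for y v v'
  proof (rule differentiable_bound[where f'="\<lambda>x. blinfun_apply (D (y + x) - D y)" and S="cball 0 (norm v + norm v')"])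
    fix x :: 'a assume "x \<in> cball 0 (norm v + norm v')"
    then have "K * norm x \<le> K * (norm v + norm v')" using K(1) by (intro mult_left_mono) auto
    then show "onorm (blinfun_apply (D (y + x) - D y)) \<le> K * (norm v + norm v')"
      using K(2)[of "y + x" y] by (simp add: norm_blinfun.rep_eq[symmetric])
  qed (auto intro: has_derivative_at_withinI R)
  have Ry: "norm (R y v - R y' v) \<le> K * norm (y - y') * norm v * norm v" for y y' v
  proof -
    have "norm ((R y v - R y' v) - (R y 0 - R y' 0)) \<le> K * norm (y - y') * norm v * norm (v - 0)"
    proof (rule differentiable_bound[where f="\<lambda>v. R y v - R y' v" and f'="\<lambda>x. blinfun_apply ((D (y + x) - D y) - (D (y' + x) - D y'))" and S="cball 0 (norm v)"])
      fix x :: 'a assume "x \<in> cball 0 (norm v)"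
      then have "K * (norm (y - y') * norm x) \<le> K * (norm (y - y') * norm v)" using K(1) by (intro mult_left_mono) auto
      then show "onorm (blinfun_apply ((D (y + x) - D y) - (D (y' + x) - D y'))) \<le> K * norm (y - y') * norm v"
        using K(3)[of y x y' x] by (simp add: norm_blinfun.rep_eq[symmetric] mult.assoc)
    next
      fix x :: 'a show "((\<lambda>v. R y v - R y' v) has_derivative blinfun_apply ((D (y + x) - D y) - (D (y' + x) - D y'))) (at x within cball 0 (norm v))"
        unfolding minus_blinfun.rep_eq[of "D (y + x) - D y"]
        by (rule has_derivative_at_withinI[OF has_derivative_diff[OF R R, unfolded fun_diff_def]])
    qed auto
    then show ?thesis by (simp add: R0)
  qed
  have "norm (R y v) \<le> K * (norm v)\<^sup>2" for y v
    using Rv[of y v 0] by (simp add: R0 power2_eq_square mult_ac)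
  moreover have "norm (R y v - R y' v') \<le> K * ((norm v + norm v') * norm (v - v') + norm (y - y') * (norm v)\<^sup>2)" for y v y' v'
  proof -
    have "R y v - R y' v' = (R y v - R y' v) + (R y' v - R y' v')" by simp
    then show ?thesis using Ry[of y v y'] Rv[of y' v v']
      by (simp only:) (intro norm_triangle_le, simp add: power2_eq_square distrib_left mult_ac)
  qed
  ultimately show ?thesis using K(1) unfolding R_def by blast
qed

text \<open>The Gubinelli derivative of \<sigma>(y) when that of y is \<sigma>(y) itself: the
  components are the \<open>sig_zeta\<close> of the individual columns for this choice of
  derivative.\<close>

definition Gub :: "(real^'d \<Rightarrow> real^'d^'n) \<Rightarrow> real^'d \<Rightarrow> ((real^'n^'n)^'d)" where
  "Gub \<sigma> y = (\<chi> j. \<sigma> y ** transpose (Dcol \<sigma> j y))"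

lemma Dcol_component:
  assumes "(\<sigma> has_derivative blinfun_apply D) (at y)"
  shows "Dcol \<sigma> j y $ k $ l = blinfun_apply D (axis l 1) $ k $ j"
  using frechet_derivative_at[OF assms] by (simp add: Dcol_def matrix_def column_def)

lemma Dcol_works:
  assumes "(\<sigma> has_derivative blinfun_apply D) (at y)"
  shows "Dcol \<sigma> j y *v v = column j (blinfun_apply D v)"
proof -
  have "linear (\<lambda>v. column j (blinfun_apply D v))"
    by (rule linearI) (auto simp: column_def vec_eq_iff blinfun.add_right blinfun.scaleR_right)
  from matrix_works[OF this[unfolded linear_matrix_vector_mul_eq[symmetric]]] show ?thesis
    using frechet_derivative_at[OF assms] by (simp add: Dcol_def)
qed

text \<open>The third derivative enters through \<open>tame D\<close>, which takes two derivatives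
  of \<open>D\<close>. The entries of \<open>Gub\<close> are sums of products of entries of \<sigma>
  and \<open>D\<close>, so they inherit tameness.\<close>

lemma C3b_estimates:
  fixes \<sigma> :: "real^'d \<Rightarrow> real^'d^'n"
  assumes "C3b \<sigma>"
  obtains D :: "real^'d \<Rightarrow> (real^'d) \<Rightarrow>\<^sub>L (real^'d^'n)" where
    "\<And>y. (\<sigma> has_derivative blinfun_apply (D y)) (at y)" "tame \<sigma>" "tame D" "tame (Gub \<sigma>)"
proof -
  from assms[unfolded C3b_def] obtain D D2 D3 where
    D: "\<And>y. (\<sigma> has_derivative blinfun_apply (D y)) (at y)" "\<And>y. (D has_derivative blinfun_apply (D2 y)) (at y)"
      "\<And>y. (D2 has_derivative blinfun_apply (D3 y)) (at y)"
    and b: "bounded (range \<sigma>)" "bounded (range D)" "bounded (range D2)" "bounded (range D3)"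
    by blast
  have t: "tame \<sigma>" "tame D"
    using tame_of_derivatives[OF D(1,2) b(1-3)] tame_of_derivatives[OF D(2,3) b(2-4)] by auto
  have "tame (\<lambda>y. Gub \<sigma> y $ j $ i $ k)" for j i k
  proof -
    have "Gub \<sigma> y $ j $ i $ k = (\<Sum>l\<in>UNIV. \<sigma> y $ i $ l * blinfun_apply (D y) (axis l 1) $ k $ j)" for y
      by (simp add: Gub_def matrix_matrix_mult_def transpose_def Dcol_component[OF D(1)])
    moreover have "tame (\<lambda>y. \<sigma> y $ i $ l)" for l
      by (intro tame_linear[OF tame_linear[OF t(1)]] bounded_linear_vec_nth)
    moreover have "tame (\<lambda>y. blinfun_apply (D y) (axis l 1) $ k $ j)" for l
      by (intro tame_linear[OF tame_linear[OF tame_linear[OF t(2)]]] bounded_linear_vec_nth blinfun.bounded_linear_left)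
    ultimately show ?thesis by (simp only:) (intro tame_sum tame_mult)
  qed
  then have "tame (Gub \<sigma>)" by (intro tame_vec)
  with D(1) t show ?thesis using that by blast
qed

section \<open>Bilinear actions and Hoelder bounds in the weighted space\<close>

lemma powr_le_powr_mult:
  fixes d T a b :: real
  assumes "0 \<le> d" "d \<le> T" "b \<le> a"
  shows "d powr a \<le> T powr (a - b) * d powr b"
proof -
  have "d powr a = d powr (a - b) * d powr b" by (simp add: powr_add[symmetric])
  also have "\<dots> \<le> T powr (a - b) * d powr b" using assms by (intro mult_right_mono powr_mono2) auto
  finally show ?thesis .
qed

lemma tC2_inL1: "tC2 phi I B \<Longrightarrow> t \<in> I \<Longrightarrow> s \<in> I \<Longrightarrow> s \<le> t \<Longrightarrow> inL1 phi (B t s)"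
  unfolding tC2_def by blast

lemma tC2mu_tC2: "tC2mu phi I \<mu> B \<Longrightarrow> tC2 phi I B"
  unfolding tC2mu_def by blast

context weighted
begin

text \<open>The drivers act on coefficients frequency by frequency through a fixed bilinear map. One
  treatment covers the vector-matrix product, the inner product and the two matrix
  contractions.\<close>

definition bcls :: "('v::{banach,second_countable_topology} \<Rightarrow> 'b \<Rightarrow> 'w::{banach,second_countable_topology})
    \<Rightarrow> (real \<Rightarrow> 'v) \<Rightarrow> 'b \<Rightarrow> 'w lone" where
  "bcls \<beta> g w = cls (\<lambda>\<xi>. \<beta> (g \<xi>) w)"

lemma inL1_bilinear:
  fixes \<beta> :: "'v::{banach,second_countable_topology} \<Rightarrow> 'b::real_normed_vector \<Rightarrow> 'w::{banach,second_countable_topology}"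
  assumes "bounded_bilinear \<beta>" "inL1 phi g"
  shows "inL1 phi (\<lambda>\<xi>. \<beta> (g \<xi>) w)"
  using inL1_linear'[OF bounded_bilinear.bounded_linear_left[OF assms(1)] assms(2)] .

lemma norm_bcls:
  fixes \<beta> :: "'v::{banach,second_countable_topology} \<Rightarrow> 'b::real_normed_vector \<Rightarrow> 'w::{banach,second_countable_topology}"
  assumes \<beta>: "bounded_bilinear \<beta>"
  obtains c where "0 \<le> c" "\<And>g w. inL1 phi g \<Longrightarrow> norm (bcls \<beta> g w) \<le> c * norm (cls g) * norm w"
proof -
  obtain c where c: "0 < c" "\<And>a b. norm (\<beta> a b) \<le> norm a * norm b * c"
    using bounded_bilinear.pos_bounded[OF \<beta>] by blast
  have "norm (bcls \<beta> g w) \<le> c * norm (cls g) * norm w" if "inL1 phi g" for g w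
    using inL1_linear(2)[OF bounded_bilinear.bounded_linear_left[OF \<beta>] that, of "norm w * c" w] c
    by (simp add: bcls_def mult_ac)
  then show ?thesis using c that by (metis less_imp_le)
qed

lemma bcls_linear:
  fixes \<beta> :: "'v::{banach,second_countable_topology} \<Rightarrow> 'b::real_normed_vector \<Rightarrow> 'w::{banach,second_countable_topology}"
  assumes \<beta>: "bounded_bilinear \<beta>" and g: "inL1 phi g"
  shows "linear (bcls \<beta> g)"
proof -
  interpret bounded_bilinear \<beta> by fact
  show ?thesis unfolding bcls_def
    by (rule linearI) (simp_all only: add_right scaleR_right inL1_add(2)[OF inL1_bilinear[OF \<beta> g] inL1_bilinear[OF \<beta> g]]
        inL1_scaleR(2)[OF inL1_bilinear[OF \<beta> g]])
qed

lemma bcls_add: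
  fixes \<beta> :: "'v::{banach,second_countable_topology} \<Rightarrow> 'b::real_normed_vector \<Rightarrow> 'w::{banach,second_countable_topology}"
  assumes \<beta>: "bounded_bilinear \<beta>" and f: "inL1 phi f" and g: "inL1 phi g"
  shows "bcls \<beta> (\<lambda>\<xi>. f \<xi> + g \<xi>) w = bcls \<beta> f w + bcls \<beta> g w"
    and "bcls \<beta> (\<lambda>\<xi>. f \<xi> - g \<xi>) w = bcls \<beta> f w - bcls \<beta> g w"
  unfolding bcls_def bounded_bilinear.add_left[OF \<beta>] bounded_bilinear.diff_left[OF \<beta>]
  by (rule inL1_add(2)[OF inL1_bilinear[OF \<beta> f] inL1_bilinear[OF \<beta> g]],
      rule inL1_diff(2)[OF inL1_bilinear[OF \<beta> f] inL1_bilinear[OF \<beta> g]])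

text \<open>The norm bound shows that an action sees only the class of its argument. This carries
  the Chen relations, which hold only up to null functions, over to the actions.\<close>

lemma bcls_cong:
  fixes \<beta> :: "'v::{banach,second_countable_topology} \<Rightarrow> 'b::real_normed_vector \<Rightarrow> 'w::{banach,second_countable_topology}"
  assumes \<beta>: "bounded_bilinear \<beta>" and f: "inL1 phi f" and g: "inL1 phi g" and "cls f = cls g"
  shows "bcls \<beta> f w = bcls \<beta> g w"
proof -
  obtain c where "0 \<le> c" "\<And>g w. inL1 phi g \<Longrightarrow> norm (bcls \<beta> g w) \<le> c * norm (cls g) * norm w"
    using norm_bcls[OF \<beta>] by blast
  from this(2)[OF inL1_diff(1)[OF f g], of w] show ?thesis
    using assms(4) by (simp add: bcls_add(2)[OF \<beta> f g] inL1_diff(2)[OF f g])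
qed

lemma bcls_cdelta2:
  fixes \<beta> :: "'v::{banach,second_countable_topology} \<Rightarrow> 'b::real_normed_vector \<Rightarrow> 'w::{banach,second_countable_topology}"
  assumes \<beta>: "bounded_bilinear \<beta>" and B: "inL1 phi (B t s)" "inL1 phi (B t u)" "inL1 phi (B u s)" "u \<le> t"
  shows "bcls \<beta> (cdelta2 B t u s) w = bcls \<beta> (B t s) w - bcls \<beta> (B t u) w - damp (t - u) (bcls \<beta> (B u s) w)"
proof -
  have "bcls \<beta> (cdelta2 B t u s) w = cls (cdelta2 (\<lambda>t s \<xi>. \<beta> (B t s \<xi>) w) t u s)"
    unfolding bcls_def cdelta2_def
    by (simp only: bounded_bilinear.diff_left[OF \<beta>] bounded_bilinear.scaleR_left[OF \<beta>])
  also have "\<dots> = bcls \<beta> (B t s) w - bcls \<beta> (B t u) w - damp (t - u) (bcls \<beta> (B u s) w)"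
    unfolding bcls_def
    by (rule inL1_cdelta2(2)[where B="\<lambda>t s \<xi>. \<beta> (B t s \<xi>) w",
          OF inL1_bilinear[OF \<beta> B(1)] inL1_bilinear[OF \<beta> B(2)] inL1_bilinear[OF \<beta> B(3)] B(4)])
  finally show ?thesis .
qed

lemma ell_bcls:
  fixes \<beta> :: "'v::{banach,second_countable_topology} \<Rightarrow> 'b::real_normed_vector \<Rightarrow> 'w::{banach,second_countable_topology}"
  assumes \<beta>: "bounded_bilinear \<beta>" and g: "inL1 phi g"
  shows "ell (bcls \<beta> g w) = \<beta> (phint phi g) w"
proof -
  interpret bounded_bilinear \<beta> by fact
  interpret L: bounded_linear "\<lambda>x. \<beta> x w" by (rule bounded_linear_left)
  let ?m = "\<lambda>\<xi>. indicator {0<..} \<xi> * (sgn (phi \<xi>) / (1 + \<xi>))"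
  have "ell (bcls \<beta> g w) = (LINT \<xi>|lborel. ?m \<xi> *\<^sub>R wt \<xi> *\<^sub>R \<beta> (g \<xi>) w)"
    unfolding bcls_def cls_def by (rule ell_abs_lone[OF inL1_integrable[OF inL1_bilinear[OF \<beta> g]]])
  also have "\<dots> = (LINT \<xi>|lborel. \<beta> (?m \<xi> *\<^sub>R wt \<xi> *\<^sub>R g \<xi>) w)" by (simp only: L.scaleR)
  also have "\<dots> = \<beta> (LINT \<xi>|lborel. ?m \<xi> *\<^sub>R wt \<xi> *\<^sub>R g \<xi>) w"
    by (rule integral_bounded_linear[OF bounded_linear_left ell_integrable[OF inL1_integrable[OF g]]])
  also have "(LINT \<xi>|lborel. ?m \<xi> *\<^sub>R wt \<xi> *\<^sub>R g \<xi>) = ell (cls g)"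
    unfolding cls_def by (rule ell_abs_lone[OF inL1_integrable[OF g], symmetric])
  finally show ?thesis by (simp only: ell_cls[OF g])
qed

lemma bcls_cont:
  fixes \<beta> :: "'v::{banach,second_countable_topology} \<Rightarrow> 'b::real_normed_vector \<Rightarrow> 'w::{banach,second_countable_topology}"
  assumes \<beta>: "bounded_bilinear \<beta>" and B: "tC2 phi {0..T} B" and le: "\<And>n. 0 \<le> b n \<and> b n \<le> a n \<and> a n \<le> T"
    and lim: "a \<longlonglongrightarrow> t" "b \<longlonglongrightarrow> s" and v: "v \<longlonglongrightarrow> w"
  shows "(\<lambda>n. bcls \<beta> (B (a n) (b n)) (v n)) \<longlonglongrightarrow> bcls \<beta> (B t s) w"
proof -
  obtain c where c: "0 \<le> c" "\<And>g w. inL1 phi g \<Longrightarrow> norm (bcls \<beta> g w) \<le> c * norm (cls g) * norm w"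
    using norm_bcls[OF \<beta>] by blast
  have t: "t \<in> {0..T}" "s \<in> {0..T}" "s \<le> t"
    using le lim by (auto intro: LIMSEQ_le LIMSEQ_le_const LIMSEQ_le_const2 order_trans)
  have inL: "inL1 phi (B t s)" if "t \<in> {0..T}" "s \<in> {0..T}" "s \<le> t" for t s
    using tC2_inL1[OF B that] .
  have i: "inL1 phi (B (a n) (b n))" "inL1 phi (B t s)" for n using inL le[of n] t by auto
  have "(\<lambda>n. bcls \<beta> (B (a n) (b n)) w - bcls \<beta> (B t s) w) \<longlonglongrightarrow> 0"
  proof (rule Lim_null_comparison)
    show "\<forall>\<^sub>F n in sequentially. norm (bcls \<beta> (B (a n) (b n)) w - bcls \<beta> (B t s) w) \<le> c * norm (cls (B (a n) (b n)) - cls (B t s)) * norm w"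
      using c(2)[OF inL1_diff(1)[OF i], of _ w] by (simp add: bcls_add(2)[OF \<beta> i] inL1_diff(2)[OF i])
    have "(\<lambda>n. c * norm (cls (B (a n) (b n)) - cls (B t s)) * norm w) \<longlonglongrightarrow> c * norm (cls (B t s) - cls (B t s)) * norm w"
      by (intro tendsto_intros tC2_cont[OF B le lim])
    then show "(\<lambda>n. c * norm (cls (B (a n) (b n)) - cls (B t s)) * norm w) \<longlonglongrightarrow> 0" by simp
  qed
  moreover have "(\<lambda>n. bcls \<beta> (B (a n) (b n)) (v n - w)) \<longlonglongrightarrow> 0"
  proof (rule Lim_null_comparison)
    show "\<forall>\<^sub>F n in sequentially. norm (bcls \<beta> (B (a n) (b n)) (v n - w)) \<le> c * norm (cls (B (a n) (b n))) * norm (v n - w)"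
      using c(2)[OF i(1)] by (intro always_eventually allI)
    have "(\<lambda>n. c * norm (cls (B (a n) (b n))) * norm (v n - w)) \<longlonglongrightarrow> c * norm (cls (B t s)) * norm (w - w)"
      by (intro tendsto_intros tC2_cont[OF B le lim] v)
    then show "(\<lambda>n. c * norm (cls (B (a n) (b n))) * norm (v n - w)) \<longlonglongrightarrow> 0" by simp
  qed
  ultimately have "(\<lambda>n. (bcls \<beta> (B (a n) (b n)) w - bcls \<beta> (B t s) w) + bcls \<beta> (B (a n) (b n)) (v n - w)) \<longlonglongrightarrow> 0 + 0"
    by (rule tendsto_add)
  then have "(\<lambda>n. bcls \<beta> (B (a n) (b n)) (v n) - bcls \<beta> (B t s) w) \<longlonglongrightarrow> 0"
    by (simp add: linear_diff[OF bcls_linear[OF \<beta> i(1)]])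
  from LIM_zero_cancel[OF this] show ?thesis .
qed

text \<open>The definition bounds strictly ordered times only. On the diagonal the class is a limit
  of classes at strictly ordered times, hence zero. The absolute value is taken because the constant
  in the definition may be negative.\<close>

lemma tC2mu_bound:
  fixes B :: "real \<Rightarrow> real \<Rightarrow> real \<Rightarrow> 'v::{banach,second_countable_topology}"
  assumes B: "tC2mu phi {0..T} \<mu> B" and T: "0 < T" and \<mu>: "0 < \<mu>"
  shows "\<exists>C\<ge>0. \<forall>s t. 0 \<le> s \<longrightarrow> s \<le> t \<longrightarrow> t \<le> T \<longrightarrow> norm (cls (B t s)) \<le> C * (t - s) powr \<mu>"
proof -
  obtain C where C: "\<forall>t\<in>{0..T}. \<forall>s\<in>{0..T}. s < t \<longrightarrow> L1N phi (B t s) \<le> ennreal (C * (t - s) powr \<mu>)"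
    using B unfolding tC2mu_def by blast
  have tC2: "tC2 phi {0..T} B" using B by (simp add: tC2mu_def)
  have inL: "inL1 phi (B t s)" if "t \<in> {0..T}" "s \<in> {0..T}" "s \<le> t" for t s
    using tC2_inL1[OF tC2 that] .
  have lt: "norm (cls (B t s)) \<le> \<bar>C\<bar> * (t - s) powr \<mu>" if "0 \<le> s" "s < t" "t \<le> T" for t s
  proof -
    have "ennreal (norm (cls (B t s))) \<le> ennreal (C * (t - s) powr \<mu>)"
      using C[rule_format, of t s] that inL[of t s] by (simp add: L1N_cls)
    also have "\<dots> \<le> ennreal (\<bar>C\<bar> * (t - s) powr \<mu>)" by (intro ennreal_leI mult_right_mono) auto
    finally show ?thesis by (subst (asm) ennreal_le_iff) auto
  qed
  have "cls (B t t) = 0" if t: "0 \<le> t" "t \<le> T" for t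
  proof -
    \<comment> \<open>Clipped times on both sides of \<open>t\<close>: they remain strictly ordered
      inside \<open>[0, T]\<close> even when \<open>t\<close> is an end point.\<close>
    define a b where "a n = min T (t + T / real (Suc n))" and "b n = max 0 (t - T / real (Suc n))" for n
    have z: "(\<lambda>n. T / real (Suc n)) \<longlonglongrightarrow> 0" using LIMSEQ_Suc[OF lim_const_over_n[of T]] .
    have "a \<longlonglongrightarrow> min T (t + 0)" "b \<longlonglongrightarrow> max 0 (t - 0)" unfolding a_def b_def
      by (intro tendsto_min tendsto_max tendsto_add tendsto_diff tendsto_const z)+
    then have lim: "a \<longlonglongrightarrow> t" "b \<longlonglongrightarrow> t" using t by (simp_all add: min_absorb2 max_absorb2)
    have "0 \<le> max 0 (t - x) \<and> max 0 (t - x) < min T (t + x) \<and> min T (t + x) \<le> T" if "0 < x" for x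
      using t T that by (auto simp: min_def max_def)
    then have ab: "0 \<le> b n \<and> b n < a n \<and> a n \<le> T" for n
      unfolding a_def b_def using divide_pos_pos[OF T, of "real (Suc n)"] of_nat_0_less_iff by blast
    then have ab': "0 \<le> b n \<and> b n \<le> a n \<and> a n \<le> T" for n by (meson less_imp_le)
    have "(\<lambda>n. cls (B (a n) (b n))) \<longlonglongrightarrow> 0"
    proof (rule Lim_null_comparison)
      show "\<forall>\<^sub>F n in sequentially. norm (cls (B (a n) (b n))) \<le> \<bar>C\<bar> * (a n - b n) powr \<mu>"
        using lt ab by (intro always_eventually allI) blast
      have "(\<lambda>n. \<bar>C\<bar> * (a n - b n) powr \<mu>) \<longlonglongrightarrow> \<bar>C\<bar> * (t - t) powr \<mu>"
        using ab' \<mu> by (intro tendsto_mult tendsto_const tendsto_powr' tendsto_diff lim) (auto intro!: always_eventually)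
      then show "(\<lambda>n. \<bar>C\<bar> * (a n - b n) powr \<mu>) \<longlonglongrightarrow> 0" by simp
    qed
    with tC2_cont[OF tC2 ab' lim] show ?thesis by (rule LIMSEQ_unique)
  qed
  then show ?thesis using lt \<mu>
    by (intro exI[of _ "\<bar>C\<bar>"] conjI allI impI) (auto simp: le_less)
qed

lemma tC2muI:
  fixes B :: "real \<Rightarrow> real \<Rightarrow> real \<Rightarrow> 'v::{banach,second_countable_topology}"
  assumes B: "tC2 phi {0..T} B" and bd: "\<And>s t. 0 \<le> s \<Longrightarrow> s \<le> t \<Longrightarrow> t \<le> T \<Longrightarrow> norm (cls (B t s)) \<le> C * (t - s) powr \<mu>"
  shows "tC2mu phi {0..T} \<mu> B"
proof -
  have inL: "inL1 phi (B t s)" if "t \<in> {0..T}" "s \<in> {0..T}" "s \<le> t" for t s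
    using tC2_inL1[OF B that] .
  show ?thesis unfolding tC2mu_def using B bd inL by (auto simp: L1N_cls ennreal_leI intro!: exI[of _ C])
qed

lemma inL1_sum:
  fixes f :: "'i \<Rightarrow> real \<Rightarrow> 'v::{banach,second_countable_topology}"
  assumes "\<And>i. i \<in> I \<Longrightarrow> inL1 phi (f i)"
  shows "inL1 phi (\<lambda>\<xi>. \<Sum>i\<in>I. f i \<xi>)" and "cls (\<lambda>\<xi>. \<Sum>i\<in>I. f i \<xi>) = (\<Sum>i\<in>I. cls (f i))"
proof -
  have "inL1 phi (\<lambda>\<xi>. \<Sum>i\<in>I. f i \<xi>) \<and> cls (\<lambda>\<xi>. \<Sum>i\<in>I. f i \<xi>) = (\<Sum>i\<in>I. cls (f i))"
    using assms by (induction I rule: infinite_finite_induct) (simp_all add: inL1_zero inL1_add)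
  then show "inL1 phi (\<lambda>\<xi>. \<Sum>i\<in>I. f i \<xi>)" and "cls (\<lambda>\<xi>. \<Sum>i\<in>I. f i \<xi>) = (\<Sum>i\<in>I. cls (f i))" by auto
qed

text \<open>The splitting argument needs only the total length, so every product of powers of
  \<open>t - u\<close> and \<open>u - s\<close> is enlarged to \<open>(t - s) powr \<mu>\<close> and
  the decomposition collapses into a single constant.\<close>

lemma tC3mu_bound:
  fixes h :: "real \<Rightarrow> real \<Rightarrow> real \<Rightarrow> real \<Rightarrow> 'v::{banach,second_countable_topology}"
  assumes h: "tC3mu phi {0..T} \<mu> h"
  shows "\<exists>C\<ge>0. \<forall>s u t. 0 \<le> s \<longrightarrow> s < u \<longrightarrow> u < t \<longrightarrow> t \<le> T \<longrightarrow> norm (cls (h t u s)) \<le> C * (t - s) powr \<mu>"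
proof -
  obtain m :: nat and hs \<rho> where
    eq: "\<forall>t\<in>{0..T}. \<forall>u\<in>{0..T}. \<forall>s\<in>{0..T}. s \<le> u \<and> u \<le> t \<longrightarrow> (\<forall>\<xi>. h t u s \<xi> = (\<Sum>i<m. hs i t u s \<xi>))"
    and hs0: "\<forall>i<m. 0 < \<rho> i \<and> \<rho> i < \<mu> \<and> tC3 phi {0..T} (hs i) \<and>
           (\<exists>C. \<forall>t\<in>{0..T}. \<forall>u\<in>{0..T}. \<forall>s\<in>{0..T}. s < u \<and> u < t \<longrightarrow>
              L1N phi (hs i t u s) \<le> ennreal (C * (t - u) powr \<rho> i * (u - s) powr (\<mu> - \<rho> i)))"
    using h unfolding tC3mu_def by blast
  note hs = hs0[rule_format]
  from hs0 have "\<forall>i\<in>{..<m}. \<exists>C. \<forall>t\<in>{0..T}. \<forall>u\<in>{0..T}. \<forall>s\<in>{0..T}. s < u \<and> u < t \<longrightarrow>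
              L1N phi (hs i t u s) \<le> ennreal (C * (t - u) powr \<rho> i * (u - s) powr (\<mu> - \<rho> i))" by blast
  then obtain C where C: "\<And>i t u s. i < m \<Longrightarrow> t \<in> {0..T} \<Longrightarrow> u \<in> {0..T} \<Longrightarrow> s \<in> {0..T} \<Longrightarrow> s < u \<Longrightarrow> u < t \<Longrightarrow>
              L1N phi (hs i t u s) \<le> ennreal (C i * (t - u) powr \<rho> i * (u - s) powr (\<mu> - \<rho> i))"
    by (metis lessThan_iff)
  show ?thesis
  proof (intro exI[of _ "\<Sum>i<m. \<bar>C i\<bar>"] conjI allI impI)
    fix s u t assume *: "0 \<le> s" "s < u" "u < t" "t \<le> T"
    have inL: "inL1 phi (hs i t u s)" if "i < m" for i using hs[OF that] * by (auto simp: tC3_def)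
    have bd: "norm (cls (hs i t u s)) \<le> \<bar>C i\<bar> * (t - s) powr \<mu>" if i: "i < m" for i
    proof -
      have "(t - u) powr \<rho> i * (u - s) powr (\<mu> - \<rho> i) \<le> (t - s) powr \<rho> i * (t - s) powr (\<mu> - \<rho> i)"
        using hs[OF i] * by (intro mult_mono powr_mono2) auto
      also have "\<dots> = (t - s) powr \<mu>" using * by (simp add: powr_add[symmetric])
      finally have "\<bar>C i\<bar> * ((t - u) powr \<rho> i * (u - s) powr (\<mu> - \<rho> i)) \<le> \<bar>C i\<bar> * (t - s) powr \<mu>" by (intro mult_left_mono) auto
      moreover have "C i * ((t - u) powr \<rho> i * (u - s) powr (\<mu> - \<rho> i)) \<le> \<bar>C i\<bar> * ((t - u) powr \<rho> i * (u - s) powr (\<mu> - \<rho> i))"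
        by (intro mult_right_mono) auto
      ultimately have "ennreal (C i * (t - u) powr \<rho> i * (u - s) powr (\<mu> - \<rho> i)) \<le> ennreal (\<bar>C i\<bar> * (t - s) powr \<mu>)"
        by (intro ennreal_leI) (simp add: mult.assoc)
      with C[OF i, of t u s] * have "ennreal (norm (cls (hs i t u s))) \<le> ennreal (\<bar>C i\<bar> * (t - s) powr \<mu>)"
        unfolding L1N_cls[OF inL[OF i]] by (meson atLeastAtMost_iff order_trans less_imp_le)
      then show ?thesis by (subst (asm) ennreal_le_iff) auto
    qed
    have "h t u s = (\<lambda>\<xi>. \<Sum>i<m. hs i t u s \<xi>)" using eq * by fastforce
    then have "norm (cls (h t u s)) \<le> (\<Sum>i<m. norm (cls (hs i t u s)))"
      using inL1_sum(2)[of "{..<m}" "\<lambda>i. hs i t u s"] inL by (simp add: norm_sum)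
    also have "\<dots> \<le> (\<Sum>i<m. \<bar>C i\<bar> * (t - s) powr \<mu>)" using bd by (intro sum_mono) auto
    finally show "norm (cls (h t u s)) \<le> (\<Sum>i<m. \<bar>C i\<bar>) * (t - s) powr \<mu>" by (simp add: sum_distrib_right)
  qed (auto intro: sum_nonneg)
qed

lemma inL1_vec:
  fixes f :: "'n::finite \<Rightarrow> real \<Rightarrow> real"
  assumes "\<And>j. inL1 phi (f j)"
  shows "inL1 phi (\<lambda>\<xi>. \<chi> j. f j \<xi>)" and "norm (cls (\<lambda>\<xi>. \<chi> j. f j \<xi>)) \<le> (\<Sum>j\<in>UNIV. norm (cls (f j)))"
proof -
  have ax: "norm (axis j x :: real ^ 'n) \<le> 1 * norm x" for j x by (simp add: norm_axis_le del: real_norm_def)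
  have e: "(\<lambda>\<xi>. \<chi> j. f j \<xi>) = (\<lambda>\<xi>. \<Sum>j\<in>UNIV. axis j (f j \<xi>))"
    by (auto simp: fun_eq_iff vec_eq_iff axis_def if_distrib cong: if_cong)
  note lin = inL1_linear[OF bounded_linear_axis assms zero_le_one ax]
  show "inL1 phi (\<lambda>\<xi>. \<chi> j. f j \<xi>)" unfolding e by (intro inL1_sum lin)
  have "norm (cls (\<lambda>\<xi>. \<chi> j. f j \<xi>)) \<le> (\<Sum>j\<in>UNIV. norm (cls (\<lambda>\<xi>. axis j (f j \<xi>) :: real ^ 'n)))"
    unfolding e by (subst inL1_sum(2)[OF lin(1)]) (rule norm_sum)
  also have "\<dots> \<le> (\<Sum>j\<in>UNIV. norm (cls (f j)))" using lin(2) by (intro sum_mono) simp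
  finally show "norm (cls (\<lambda>\<xi>. \<chi> j. f j \<xi>)) \<le> (\<Sum>j\<in>UNIV. norm (cls (f j)))" .
qed

lemma inL1_nth:
  fixes g :: "real \<Rightarrow> real ^ 'n"
  assumes "inL1 phi g"
  shows "inL1 phi (\<lambda>\<xi>. g \<xi> $ j)" and "norm (cls (\<lambda>\<xi>. g \<xi> $ j)) \<le> norm (cls g)"
  using inL1_linear[OF bounded_linear_vec_nth assms zero_le_one, of j] component_le_norm_cart by auto

text \<open>For fixed \<open>s\<close> the difference of the two, as a path in the later time,
  starts at zero. Equality of the convolutional increments makes its own increments of order \<mu> >
  1, so \<open>small_increments_zero\<close> applies.\<close>

lemma cdelta2_unique:
  fixes B B' :: "real \<Rightarrow> real \<Rightarrow> real \<Rightarrow> 'v::{banach,second_countable_topology}"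
  assumes B: "tC2mu phi {0..T} \<mu> B" "tC2mu phi {0..T} \<mu> B'" and \<mu>: "1 < \<mu>" and T: "0 < T"
    and eq: "\<And>s u t. 0 \<le> s \<Longrightarrow> s \<le> u \<Longrightarrow> u \<le> t \<Longrightarrow> t \<le> T \<Longrightarrow> cls (cdelta2 B t u s) = cls (cdelta2 B' t u s)"
    and st: "0 \<le> s" "s \<le> t" "t \<le> T"
  shows "cls (B t s) = cls (B' t s)"
proof -
  have \<mu>0: "0 < \<mu>" using \<mu> by simp
  obtain C C' where C: "\<And>s t. 0 \<le> s \<Longrightarrow> s \<le> t \<Longrightarrow> t \<le> T \<Longrightarrow> norm (cls (B t s)) \<le> C * (t - s) powr \<mu>"
     "\<And>s t. 0 \<le> s \<Longrightarrow> s \<le> t \<Longrightarrow> t \<le> T \<Longrightarrow> norm (cls (B' t s)) \<le> C' * (t - s) powr \<mu>"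
    using tC2mu_bound[OF B(1) T \<mu>0] tC2mu_bound[OF B(2) T \<mu>0] by blast
  have inL: "inL1 phi (B t s)" "inL1 phi (B' t s)" if "0 \<le> s" "s \<le> t" "t \<le> T" for t s
    using tC2_inL1[OF tC2mu_tC2[OF B(1)]] tC2_inL1[OF tC2mu_tC2[OF B(2)]] that by auto
  have "cls (B t s) - cls (B' t s) = 0"
  proof (rule damp.small_increments_zero[OF \<mu> st(2), of "\<lambda>u. cls (B u s) - cls (B' u s)" "C + C'"])
    show "cls (B s s) - cls (B' s s) = 0" using C[of s s] st by auto
    fix r u assume ru: "s \<le> r" "r \<le> u" "u \<le> t"
    have i: "inL1 phi (B u s)" "inL1 phi (B u r)" "inL1 phi (B r s)" "inL1 phi (B' u s)" "inL1 phi (B' u r)" "inL1 phi (B' r s)"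
      using inL st ru by auto
    have "cls (B u s) - cls (B' u s) - damp (u - r) (cls (B r s) - cls (B' r s)) = cls (B u r) - cls (B' u r)"
      using eq[of s r u] inL1_cdelta2(2)[OF i(1,2,3)] inL1_cdelta2(2)[OF i(4,5,6)] st ru
      by (simp add: damp.S_diff algebra_simps)
    then show "norm (cls (B u s) - cls (B' u s) - damp (u - r) (cls (B r s) - cls (B' r s))) \<le> (C + C') * (u - r) powr \<mu>"
      using C[of r u] norm_triangle_ineq4[of "cls (B u r)" "cls (B' u r)"] st ru by (simp add: distrib_right)
  qed
  then show ?thesis by simp
qed

lemma tC2_seqI:
  fixes B :: "real \<Rightarrow> real \<Rightarrow> real \<Rightarrow> 'v::{banach,second_countable_topology}"
  assumes inL: "\<And>t s. 0 \<le> s \<Longrightarrow> s \<le> t \<Longrightarrow> t \<le> T \<Longrightarrow> inL1 phi (B t s)"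
    and cont: "\<And>a b t s. (\<And>n. 0 \<le> b n \<and> b n \<le> a n \<and> a n \<le> T) \<Longrightarrow> 0 \<le> s \<Longrightarrow> s \<le> t \<Longrightarrow> t \<le> T \<Longrightarrow>
       a \<longlonglongrightarrow> t \<Longrightarrow> b \<longlonglongrightarrow> s \<Longrightarrow> (\<lambda>n. cls (B (a n) (b n))) \<longlonglongrightarrow> cls (B t s)"
  shows "tC2 phi {0..T} B"
proof (rule tC2_I)
  show "continuous_on {p. fst p \<in> {0..T} \<and> snd p \<in> {0..T} \<and> snd p \<le> fst p} (\<lambda>p. cls (B (fst p) (snd p)))"
    unfolding continuous_on_sequentially o_def
  proof (intro allI ballI impI)
    fix x and p :: "real \<times> real"
    assume p: "p \<in> {p. fst p \<in> {0..T} \<and> snd p \<in> {0..T} \<and> snd p \<le> fst p}"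
      and *: "(\<forall>n. x n \<in> {p. fst p \<in> {0..T} \<and> snd p \<in> {0..T} \<and> snd p \<le> fst p}) \<and> x \<longlonglongrightarrow> p"
    show "(\<lambda>n. cls (B (fst (x n)) (snd (x n)))) \<longlonglongrightarrow> cls (B (fst p) (snd p))"
      by (rule cont) (use p * in \<open>auto intro: tendsto_fst tendsto_snd\<close>)
  qed
qed (use inL in auto)

lemma tC1_inL1: "tC1 phi {0..T} f \<Longrightarrow> 0 \<le> t \<Longrightarrow> t \<le> T \<Longrightarrow> inL1 phi (f t)"
  unfolding tC1_def by simp

lemma tC1_cont:
  fixes f :: "real \<Rightarrow> real \<Rightarrow> 'v::{banach,second_countable_topology}"
  assumes "tC1 phi {0..T} f" "\<And>n. 0 \<le> a n \<and> a n \<le> T" "0 \<le> t" "t \<le> T" "a \<longlonglongrightarrow> t"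
  shows "(\<lambda>n. cls (f (a n))) \<longlonglongrightarrow> cls (f t)"
  using assms by (intro continuous_on_tendsto_compose[where f="\<lambda>t. cls (f t)" and s="{0..T}"]) (auto simp: tC1_iff)

lemma tC2_cdelta1_diff:
  fixes f :: "real \<Rightarrow> real \<Rightarrow> 'v::{banach,second_countable_topology}"
  assumes f: "tC1 phi {0..T} f" and G: "tC2 phi {0..T} G"
  shows "tC2 phi {0..T} (\<lambda>t s \<xi>. cdelta1 f t s \<xi> - G t s \<xi>)"
    and "0 \<le> s \<Longrightarrow> s \<le> t \<Longrightarrow> t \<le> T \<Longrightarrow>
      cls (\<lambda>\<xi>. cdelta1 f t s \<xi> - G t s \<xi>) = cls (f t) - damp (t - s) (cls (f s)) - cls (G t s)"
proof -
  have i: "inL1 phi (f t)" "inL1 phi (f s)" "inL1 phi (G t s)" if "0 \<le> s" "s \<le> t" "t \<le> T" for s t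
    using that tC1_inL1[OF f] tC2_inL1[OF G] by auto
  have inL: "inL1 phi (\<lambda>\<xi>. cdelta1 f t s \<xi> - G t s \<xi>)"
    and eq: "cls (\<lambda>\<xi>. cdelta1 f t s \<xi> - G t s \<xi>) = cls (f t) - damp (t - s) (cls (f s)) - cls (G t s)"
    if "0 \<le> s" "s \<le> t" "t \<le> T" for s t
    using inL1_diff[OF inL1_cdelta1(1)[OF i(1,2)[OF that] that(2)] i(3)[OF that]]
      inL1_cdelta1(2)[OF i(1,2)[OF that] that(2)] by simp_all
  show "tC2 phi {0..T} (\<lambda>t s \<xi>. cdelta1 f t s \<xi> - G t s \<xi>)"
  proof (rule tC2_seqI)
    fix a b :: "nat \<Rightarrow> real" and t s :: real
    assume le: "\<And>n. 0 \<le> b n \<and> b n \<le> a n \<and> a n \<le> T" and st: "0 \<le> s" "s \<le> t" "t \<le> T" and lim: "a \<longlonglongrightarrow> t" "b \<longlonglongrightarrow> s"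
    have "(\<lambda>n. cls (f (a n)) - damp (a n - b n) (cls (f (b n))) - cls (G (a n) (b n))) \<longlonglongrightarrow> cls (f t) - damp (t - s) (cls (f s)) - cls (G t s)"
      using le st by (intro tendsto_diff damp.tendsto_S tC1_cont[OF f] tC2_cont[OF G le] lim) (meson order_trans)+
    then show "(\<lambda>n. cls (\<lambda>\<xi>. cdelta1 f (a n) (b n) \<xi> - G (a n) (b n) \<xi>)) \<longlonglongrightarrow> cls (\<lambda>\<xi>. cdelta1 f t s \<xi> - G t s \<xi>)"
      using eq le st by simp
  qed (rule inL)
  show "0 \<le> s \<Longrightarrow> s \<le> t \<Longrightarrow> t \<le> T \<Longrightarrow>
      cls (\<lambda>\<xi>. cdelta1 f t s \<xi> - G t s \<xi>) = cls (f t) - damp (t - s) (cls (f s)) - cls (G t s)" by (rule eq)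
qed

text \<open>The convolutional increment of an increment vanishes by the semigroup law, so only
  \<open>G\<close> survives.\<close>

lemma cdelta2_cdelta1_diff:
  fixes f :: "real \<Rightarrow> real \<Rightarrow> 'v::{banach,second_countable_topology}"
  assumes f: "tC1 phi {0..T} f" and G: "tC2 phi {0..T} G" and st: "0 \<le> s" "s \<le> u" "u \<le> t" "t \<le> T"
  shows "cls (cdelta2 (\<lambda>t s \<xi>. cdelta1 f t s \<xi> - G t s \<xi>) t u s) = - cls (cdelta2 G t u s)"
proof -
  let ?R = "\<lambda>t s \<xi>. cdelta1 f t s \<xi> - G t s \<xi>"
  note R = tC2_cdelta1_diff(1)[OF f G]
  have eq: "cls (?R b a) = cls (f b) - damp (b - a) (cls (f a)) - cls (G b a)" if "0 \<le> a" "a \<le> b" "b \<le> T" for a b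
    using tC2_cdelta1_diff(2)[OF f G that] .
  have "cls (cdelta2 ?R t u s) = cls (?R t s) - cls (?R t u) - damp (t - u) (cls (?R u s))"
    using tC2_inL1[OF R] st by (intro inL1_cdelta2(2)) auto
  moreover have "cls (cdelta2 G t u s) = cls (G t s) - cls (G t u) - damp (t - u) (cls (G u s))"
    using tC2_inL1[OF G] st by (intro inL1_cdelta2(2)) auto
  moreover have "cls (?R t s) = cls (f t) - damp (t - s) (cls (f s)) - cls (G t s)"
    "cls (?R t u) = cls (f t) - damp (t - u) (cls (f u)) - cls (G t u)"
    "cls (?R u s) = cls (f u) - damp (u - s) (cls (f s)) - cls (G u s)"
    using st by (auto intro!: eq)
  ultimately show ?thesis using damp.S_S[of s u t "cls (f s)"] st by (simp add: damp.S_diff)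
qed

lemma tC1_unc:
  fixes Y :: "real \<Rightarrow> 'v::{banach,second_countable_topology} lone"
  assumes "continuous_on {0..T} Y"
  shows "tC1 phi {0..T} (\<lambda>t. unc (Y t))"
proof -
  have "dist (proj F) (proj G) \<le> 1 * dist F G" for F G :: "'v lone"
    using norm_proj[of "F - G"] by (simp add: dist_norm proj_diff)
  then have "continuous_on UNIV (proj :: 'v lone \<Rightarrow> _)"
    by (intro lipschitz_on_continuous_on[where L=1]) (auto simp: lipschitz_on_def)
  then have "continuous_on {0..T} (\<lambda>t. proj (Y t))" by (rule continuous_on_compose2[OF _ assms]) simp
  then show ?thesis unfolding tC1_iff by (simp add: inL1_unc proj_def)
qed

end

section \<open>The convolutional rough equation\<close>

text \<open>The second-order terms of all columns at once, so that the equation becomes a single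
  identity between vector-valued classes.\<close>

definition mdv :: "real^'n^'m \<Rightarrow> (real^'m^'n)^'d \<Rightarrow> real^'d" where
  "mdv x g = (\<chi> j. mdot x (transpose (g $ j)))"

definition mdt :: "real^'n^'m \<Rightarrow> real^'m^'n \<Rightarrow> real" where
  "mdt x \<zeta> = mdot x (transpose \<zeta>)"

lemma bounded_bilinear_vm: "bounded_bilinear (\<lambda>(x::real^'n) (w::real^'d^'n). x v* w)"
  unfolding bilinear_conv_bounded_bilinear[symmetric] bilinear_def
  by (auto intro!: linearI simp: vector_matrix_mult_def vec_eq_iff algebra_simps sum.distrib sum_distrib_left)

lemma bounded_bilinear_mdt: "bounded_bilinear (mdt :: real^'n^'m \<Rightarrow> _)"
  unfolding bilinear_conv_bounded_bilinear[symmetric] bilinear_def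
  by (auto intro!: linearI simp: mdt_def mdot_def transpose_def algebra_simps sum.distrib sum_distrib_left)

lemma bounded_bilinear_mdv: "bounded_bilinear (mdv :: real^'n^'m \<Rightarrow> (real^'m^'n)^'d \<Rightarrow> _)"
  unfolding bilinear_conv_bounded_bilinear[symmetric] bilinear_def
  by (auto intro!: linearI simp: mdv_def mdot_def transpose_def vec_eq_iff algebra_simps sum.distrib sum_distrib_left)

lemma mdt_outer: "mdt (outer x p) \<zeta> = x \<bullet> (p v* \<zeta>)"
  by (simp add: mdt_def mdot_def outer_def transpose_def inner_vec_def vector_matrix_mult_def sum_distrib_left mult_ac)

lemma vm_matrix: "p v* (M ** transpose N) = N *v (p v* M)" for p :: "real^'n"
  by (simp add: vector_matrix_mul_assoc[symmetric])

lemma vm_nth: "(x v* w) $ j = x \<bullet> column j w"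
  by (simp add: vector_matrix_mult_def inner_vec_def column_def mult.commute)

lemma norm_column_le: "norm (column j w) \<le> norm w" for w :: "real^'d^'n"
  by (rule norm_le_componentwise_cart) (simp add: column_def component_le_norm_cart)

lemma column_diff: "column j (w - w') = column j w - column j w'"
  and column_add: "column j (w + w') = column j w + column j w'"
  by (simp_all add: column_def vec_eq_iff)

text \<open>The chain rule in matrix form. It rewrites the tensor term of the Chen relation as the
  derivative of \<sigma> along an observed first-level increment, the shape that
  \<open>X_chen\<close> asks for.\<close>

lemma Gub_works:
  assumes "(\<sigma> has_derivative D) (at y)"
  shows "p v* (Gub \<sigma> y $ j) = column j (D (p v* \<sigma> y))"
proof -
  have "D = blinfun_apply (Blinfun D)"
    using assms by (simp add: bounded_linear_Blinfun_apply has_derivative_bounded_linear)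
  then show ?thesis
    using Dcol_works[of \<sigma> "Blinfun D" y j "p v* \<sigma> y"] assms by (simp add: Gub_def vm_matrix)
qed

locale rough_equation = weighted phi
  for phi :: "real \<Rightarrow> real" +
  fixes T \<gamma> \<kappa> :: real
    and x1 :: "real \<Rightarrow> real \<Rightarrow> real \<Rightarrow> real^'n"
    and x2 :: "real \<Rightarrow> real \<Rightarrow> real \<Rightarrow> real^'n^'n"
    and x3 :: "real \<Rightarrow> real \<Rightarrow> real \<Rightarrow> real \<Rightarrow> real^'n^'n"
    and a0 :: "real^'d" and \<sigma> :: "real^'d \<Rightarrow> real^'d^'n"
  assumes T: "0 < T" and \<gamma>: "1/3 < \<gamma>" "\<gamma> < 1/2" and \<kappa>: "1/3 < \<kappa>" "\<kappa> < \<gamma>"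
    and H: "hypH phi T \<gamma> x1 x2 x3" and C3b: "C3b \<sigma>"
begin

definition AA :: "real \<Rightarrow> real \<Rightarrow> real^'d^'n \<Rightarrow> (real^'d) lone" where
  "AA t s = bcls (\<lambda>x w. x v* w) (x1 t s)"

definition XX :: "real \<Rightarrow> real \<Rightarrow> (real^'n^'n)^'d \<Rightarrow> (real^'d) lone" where
  "XX t s = bcls mdv (x2 t s)"

definition ZZ :: "real \<Rightarrow> real \<Rightarrow> real \<Rightarrow> (real^'n^'n)^'d \<Rightarrow> (real^'d) lone" where
  "ZZ t u s = bcls mdv (x3 t u s)"

definition DF :: "real^'d \<Rightarrow> real^'d \<Rightarrow> real^'d^'n" where
  "DF y = frechet_derivative \<sigma> (at y)"

lemma x1: "tC2mu phi {0..T} \<gamma> x1" "tC2 phi {0..T} x1"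
  and x2: "tC2mu phi {0..T} (2 * \<gamma>) x2" "tC2 phi {0..T} x2"
  and x3: "tC3mu phi {0..T} (3 * \<gamma>) x3"
  using H by (simp_all add: hypH_def tC2mu_def)

lemma x1_inL1: "0 \<le> s \<Longrightarrow> s \<le> t \<Longrightarrow> t \<le> T \<Longrightarrow> inL1 phi (x1 t s)"
  and x2_inL1: "0 \<le> s \<Longrightarrow> s \<le> t \<Longrightarrow> t \<le> T \<Longrightarrow> inL1 phi (x2 t s)"
  using tC2_inL1[OF x1(2)] tC2_inL1[OF x2(2)] by auto

lemma x3_inL1: "0 \<le> s \<Longrightarrow> s \<le> u \<Longrightarrow> u \<le> t \<Longrightarrow> t \<le> T \<Longrightarrow> inL1 phi (x3 t u s)"
  using x3 unfolding tC3mu_def tC3_def by simp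

lemma x1_chen:
  assumes "0 \<le> s" "s \<le> u" "u \<le> t" "t \<le> T"
  shows "cls (cdelta2 x1 t u s) = 0" "inL1 phi (cdelta2 x1 t u s)"
proof -
  show i: "inL1 phi (cdelta2 x1 t u s)" using assms by (intro inL1_cdelta2(1) x1_inL1) auto
  have "L1N phi (cdelta2 x1 t u s) = 0" using H assms unfolding hypH_def by simp
  then show "cls (cdelta2 x1 t u s) = 0" by (rule L1N_zero_imp_cls[OF _ i])
qed

lemma inL1_outer: "inL1 phi f \<Longrightarrow> inL1 phi (\<lambda>\<xi>. outer (f \<xi>) p)" for f :: "real \<Rightarrow> real^'n" and p :: "real^'n"
  by (rule inL1_linear'[where L="\<lambda>x. outer x p"])
     (auto simp: linear_conv_bounded_linear[symmetric] outer_def vec_eq_iff algebra_simps intro!: linearI)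

lemma x2_chen:
  assumes "0 \<le> s" "s \<le> u" "u \<le> t" "t \<le> T"
  shows "cls (cdelta2 x2 t u s) = cls (\<lambda>\<xi>. outer (x1 t u \<xi>) (phint phi (x1 u s)) + x3 t u s \<xi>)"
    "inL1 phi (cdelta2 x2 t u s)" "inL1 phi (\<lambda>\<xi>. outer (x1 t u \<xi>) (phint phi (x1 u s)))"
proof -
  show i: "inL1 phi (cdelta2 x2 t u s)" using assms by (intro inL1_cdelta2(1) x2_inL1) auto
  show o: "inL1 phi (\<lambda>\<xi>. outer (x1 t u \<xi>) (phint phi (x1 u s)))" using assms by (intro inL1_outer x1_inL1) auto
  have j: "inL1 phi (\<lambda>\<xi>. outer (x1 t u \<xi>) (phint phi (x1 u s)) + x3 t u s \<xi>)"
    using assms by (intro inL1_add(1) o x3_inL1)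
  have "L1N phi (\<lambda>\<xi>. cdelta2 x2 t u s \<xi> - (outer (x1 t u \<xi>) (phint phi (x1 u s)) + x3 t u s \<xi>)) = 0"
    using H assms unfolding hypH_def by simp
  then show "cls (cdelta2 x2 t u s) = cls (\<lambda>\<xi>. outer (x1 t u \<xi>) (phint phi (x1 u s)) + x3 t u s \<xi>)"
    unfolding cls_eq_iff[OF i j] .
qed

lemma bcls_x1_chen:
  fixes \<beta> :: "real^'n \<Rightarrow> 'b::real_normed_vector \<Rightarrow> 'w::{banach,second_countable_topology}"
  assumes \<beta>: "bounded_bilinear \<beta>" and st: "0 \<le> s" "s \<le> u" "u \<le> t" "t \<le> T"
  shows "bcls \<beta> (x1 t s) w = bcls \<beta> (x1 t u) w + damp (t - u) (bcls \<beta> (x1 u s) w)"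
proof -
  have "bcls \<beta> (cdelta2 x1 t u s) w = bcls \<beta> (\<lambda>_. 0) w"
    using x1_chen[OF st] by (intro bcls_cong \<beta>) (auto simp: inL1_zero)
  also have "\<dots> = 0" using \<beta> by (simp add: bcls_def bounded_bilinear.zero_left inL1_zero)
  finally show ?thesis
    using bcls_cdelta2[OF \<beta>, of x1 t s u w] st x1_inL1 by (simp add: algebra_simps)
qed

lemma bcls_x2_chen:
  fixes \<beta> :: "real^'n^'n \<Rightarrow> 'b::real_normed_vector \<Rightarrow> 'w::{banach,second_countable_topology}"
  assumes \<beta>: "bounded_bilinear \<beta>" and st: "0 \<le> s" "s \<le> u" "u \<le> t" "t \<le> T"
  shows "bcls \<beta> (x2 t s) w = bcls \<beta> (x2 t u) w + damp (t - u) (bcls \<beta> (x2 u s) w)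
     + cls (\<lambda>\<xi>. \<beta> (outer (x1 t u \<xi>) (phint phi (x1 u s))) w) + bcls \<beta> (x3 t u s) w"
proof -
  note x3i = x3_inL1[OF st]
  have "bcls \<beta> (cdelta2 x2 t u s) w = bcls \<beta> (\<lambda>\<xi>. outer (x1 t u \<xi>) (phint phi (x1 u s)) + x3 t u s \<xi>) w"
    using x2_chen[OF st] x3i by (intro bcls_cong \<beta> inL1_add(1))
  also have "\<dots> = bcls \<beta> (\<lambda>\<xi>. outer (x1 t u \<xi>) (phint phi (x1 u s))) w + bcls \<beta> (x3 t u s) w"
    by (rule bcls_add(1)[OF \<beta> x2_chen(3)[OF st] x3i])
  finally show ?thesis
    using bcls_cdelta2[OF \<beta>, of x2 t s u w] st x2_inL1 by (simp add: algebra_simps bcls_def)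
qed

lemma \<sigma>_derivative: "(\<sigma> has_derivative DF y) (at y)"
proof -
  obtain D where "\<And>y. (\<sigma> has_derivative blinfun_apply (D y)) (at y)"
    using C3b_estimates[OF C3b] by blast
  then show ?thesis unfolding DF_def by (metis frechet_derivative_at)
qed

lemma rough_system_exists: "\<exists>K. rough_system damp ell AA XX ZZ \<sigma> DF (Gub \<sigma>) T K \<gamma>"
proof -
  obtain D where D: "\<And>y. (\<sigma> has_derivative blinfun_apply (D y)) (at y)"
    and t: "tame \<sigma>" "tame D" "tame (Gub \<sigma>)"
    using C3b_estimates[OF C3b] by blast
  have DF: "DF y = blinfun_apply (D y)" for y
    unfolding DF_def using frechet_derivative_at[OF D] by simp
  obtain k1 where k1: "0 \<le> k1" "\<And>y. norm (\<sigma> y) \<le> k1" "\<And>y y'. norm (\<sigma> y - \<sigma> y') \<le> k1 * norm (y - y')"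
    using t(1) unfolding tame_def by blast
  obtain k2 where k2: "0 \<le> k2" "\<And>y. norm (D y) \<le> k2" "\<And>y y'. norm (D y - D y') \<le> k2 * norm (y - y')"
    using t(2) unfolding tame_def by blast
  obtain k3 where k3: "0 \<le> k3" "\<And>y. norm (Gub \<sigma> y) \<le> k3" "\<And>y y'. norm (Gub \<sigma> y - Gub \<sigma> y') \<le> k3 * norm (y - y')"
    "\<And>y v y' v'. norm ((Gub \<sigma> (y + v) - Gub \<sigma> y) - (Gub \<sigma> (y' + v') - Gub \<sigma> y')) \<le> k3 * (norm (v - v') + norm (y - y') * norm v)"
    using t(3) unfolding tame_def by blast
  obtain k4 where k4: "0 \<le> k4" "\<And>y v. norm (\<sigma> (y + v) - \<sigma> y - D y v) \<le> k4 * (norm v)\<^sup>2"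
    "\<And>y v y' v'. norm ((\<sigma> (y + v) - \<sigma> y - D y v) - (\<sigma> (y' + v') - \<sigma> y' - D y' v'))
        \<le> k4 * ((norm v + norm v') * norm (v - v') + norm (y - y') * (norm v)\<^sup>2)"
    using taylor_bounds[OF D t(2)] by blast
  obtain c1 where c1: "0 \<le> c1" "\<And>s t. 0 \<le> s \<Longrightarrow> s \<le> t \<Longrightarrow> t \<le> T \<Longrightarrow> norm (cls (x1 t s)) \<le> c1 * (t - s) powr \<gamma>"
    using tC2mu_bound[OF x1(1) T] \<gamma> by auto
  obtain c2 where c2: "0 \<le> c2" "\<And>s t. 0 \<le> s \<Longrightarrow> s \<le> t \<Longrightarrow> t \<le> T \<Longrightarrow> norm (cls (x2 t s)) \<le> c2 * (t - s) powr (2 * \<gamma>)"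
    using tC2mu_bound[OF x2(1) T] \<gamma> by auto
  obtain c3 where c3: "0 \<le> c3" "\<And>s u t. 0 \<le> s \<Longrightarrow> s < u \<Longrightarrow> u < t \<Longrightarrow> t \<le> T \<Longrightarrow> norm (cls (x3 t u s)) \<le> c3 * (t - s) powr (3 * \<gamma>)"
    using tC3mu_bound[OF x3] by blast
  obtain b1 where b1: "0 \<le> b1" "\<And>g (w :: real^'d^'n). inL1 phi g \<Longrightarrow> norm (bcls (\<lambda>(x::real^'n) w. x v* w) g w) \<le> b1 * norm (cls g) * norm w"
    using norm_bcls[OF bounded_bilinear_vm] by blast
  obtain b2 where b2: "0 \<le> b2" "\<And>g (w :: (real^'n^'n)^'d). inL1 phi g \<Longrightarrow> norm (bcls mdv g w) \<le> b2 * norm (cls g) * norm w"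
    using norm_bcls[OF bounded_bilinear_mdv] by blast
  define K where "K = 1 + k1 + k2 + k3 + k4 + b1 * c1 + b2 * c2 + b2 * c3"
  have bc: "0 \<le> b1 * c1" "0 \<le> b2 * c2" "0 \<le> b2 * c3" using b1 b2 c1 c2 c3 by auto
  then have K: "1 \<le> K" "k1 \<le> K" "k2 \<le> K" "k3 \<le> K" "k4 \<le> K" "b1 * c1 \<le> K" "b2 * c2 \<le> K" "b2 * c3 \<le> K"
    using k1(1) k2(1) k3(1) k4(1) unfolding K_def by linarith+
  have up: "x \<le> K * b" if "x \<le> k * b" "k \<le> K" "0 \<le> b" for x k b
    using that mult_right_mono[of k K b] by linarith
  have three: "(x powr \<gamma>) ^ 3 = x powr (3 * \<gamma>)" for x :: real
    by (simp add: power3_eq_cube powr_add[symmetric])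
  have "rough_system damp ell AA XX ZZ \<sigma> DF (Gub \<sigma>) T K \<gamma>"
  proof (rule rough_system.intro[OF damp.contraction_semigroup_axioms rough_system_axioms.intro])
    show "0 < T" "1 \<le> K" "1/3 < \<gamma>" "\<gamma> < 1/2" by (rule T K \<gamma>)+
    show "linear (ell :: (real^'d) lone \<Rightarrow> _)" by (rule ell_linear)
    show "norm (ell x) \<le> norm x" for x :: "(real^'d) lone" by (rule norm_ell_le)
    show "norm (ell (damp t x) - ell x) \<le> t * norm x" if "0 \<le> t" for t and x :: "(real^'d) lone" by (rule ell_damp[OF that])
    show "linear (DF y)" for y using \<sigma>_derivative has_derivative_linear by blast
    show "norm (\<sigma> y) \<le> K" "norm (Gub \<sigma> y) \<le> K" for y using k1(2)[of y] k3(2)[of y] K by linarith+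
    show "norm (\<sigma> y - \<sigma> y') \<le> K * norm (y - y')" for y y' by (rule up[OF k1(3) K(2)]) simp
    show "norm (Gub \<sigma> y - Gub \<sigma> y') \<le> K * norm (y - y')" for y y' by (rule up[OF k3(3) K(4)]) simp
    show "norm (DF y v) \<le> K * norm v" for y v
      unfolding DF by (rule up[OF order_trans[OF norm_blinfun mult_right_mono[OF k2(2)]] K(3)]) simp_all
    show "norm (DF y v - DF y' v) \<le> K * norm (y - y') * norm v" for y y' v
    proof -
      have "norm (blinfun_apply (D y - D y') v) \<le> norm (D y - D y') * norm v" by (rule norm_blinfun)
      also have "\<dots> \<le> (K * norm (y - y')) * norm v" by (intro mult_right_mono up[OF k2(3) K(3)]) auto
      finally show ?thesis by (simp add: DF minus_blinfun.rep_eq)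
    qed
    show "norm (\<sigma> (y + v) - \<sigma> y - DF y v) \<le> K * (norm v)\<^sup>2" for y v
      unfolding DF by (rule up[OF k4(2) K(5)]) simp
    show "norm ((\<sigma> (y + v) - \<sigma> y - DF y v) - (\<sigma> (y' + v') - \<sigma> y' - DF y' v'))
        \<le> K * ((norm v + norm v') * norm (v - v') + norm (y - y') * (norm v)\<^sup>2)" for y v y' v'
      unfolding DF by (rule up[OF k4(3) K(5)]) simp
    show "norm ((Gub \<sigma> (y + v) - Gub \<sigma> y) - (Gub \<sigma> (y' + v') - Gub \<sigma> y')) \<le> K * (norm (v - v') + norm (y - y') * norm v)" for y v y' v'
      by (rule up[OF k3(4) K(4)]) simp
  next
    fix s t :: real assume st: "0 \<le> s" "s \<le> t" "t \<le> T"
    show "linear (AA t s)" "linear (XX t s)"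
      unfolding AA_def XX_def using x1_inL1[OF st] x2_inL1[OF st]
      by (auto intro: bcls_linear bounded_bilinear_vm bounded_bilinear_mdv)
    show "norm (AA t s w) \<le> K * (t - s) powr \<gamma> * norm w" for w
    proof -
      have "norm (AA t s w) \<le> b1 * norm (cls (x1 t s)) * norm w" unfolding AA_def by (rule b1(2)[OF x1_inL1[OF st]])
      also have "\<dots> \<le> b1 * (c1 * (t - s) powr \<gamma>) * norm w" using c1(2)[OF st] b1(1) by (intro mult_right_mono mult_left_mono) auto
      also have "\<dots> = (b1 * c1) * ((t - s) powr \<gamma> * norm w)" by simp
      also have "\<dots> \<le> K * ((t - s) powr \<gamma> * norm w)" using K(6) by (rule mult_right_mono) simp
      finally show ?thesis by simp
    qed
    show "norm (XX t s w) \<le> K * ((t - s) powr \<gamma>)\<^sup>2 * norm w" for w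
    proof -
      have "norm (XX t s w) \<le> b2 * norm (cls (x2 t s)) * norm w" unfolding XX_def by (rule b2(2)[OF x2_inL1[OF st]])
      also have "\<dots> \<le> b2 * (c2 * (t - s) powr (2 * \<gamma>)) * norm w" using c2(2)[OF st] b2(1) by (intro mult_right_mono mult_left_mono) auto
      also have "\<dots> = (b2 * c2) * (((t - s) powr \<gamma>)\<^sup>2 * norm w)" by (simp add: powr_square)
      also have "\<dots> \<le> K * (((t - s) powr \<gamma>)\<^sup>2 * norm w)" using K(7) by (rule mult_right_mono) simp
      finally show ?thesis by simp
    qed
  next
    fix s u t :: real assume st: "0 \<le> s" "s < u" "u < t" "t \<le> T"
    then have st': "0 \<le> s" "s \<le> u" "u \<le> t" "t \<le> T" by auto
    show "linear (ZZ t u s)" unfolding ZZ_def by (rule bcls_linear[OF bounded_bilinear_mdv x3_inL1[OF st']])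
    show "norm (ZZ t u s w) \<le> K * ((t - s) powr \<gamma>) ^ 3 * norm w" for w
    proof -
      have "norm (ZZ t u s w) \<le> b2 * norm (cls (x3 t u s)) * norm w" unfolding ZZ_def by (rule b2(2)[OF x3_inL1[OF st']])
      also have "\<dots> \<le> b2 * (c3 * (t - s) powr (3 * \<gamma>)) * norm w" using c3(2)[OF st] b2(1) by (intro mult_right_mono mult_left_mono) auto
      also have "\<dots> = (b2 * c3) * (((t - s) powr \<gamma>) ^ 3 * norm w)" by (simp add: three)
      also have "\<dots> \<le> K * (((t - s) powr \<gamma>) ^ 3 * norm w)" using K(8) by (rule mult_right_mono) simp
      finally show ?thesis by simp
    qed
    show "AA t s w = AA t u w + damp (t - u) (AA u s w)" for w
      unfolding AA_def by (rule bcls_x1_chen[OF bounded_bilinear_vm st'])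
    show "XX t s (Gub \<sigma> y) = XX t u (Gub \<sigma> y) + damp (t - u) (XX u s (Gub \<sigma> y)) + AA t u (DF y (ell (AA u s (\<sigma> y)))) + ZZ t u s (Gub \<sigma> y)" for y
    proof -
      \<comment> \<open>With \<open>p\<close> the observed increment of the first-level driver, this
        is the term \<open>AA t u (DF y (ell (AA u s (\<sigma> y))))\<close> frequency by
        frequency.\<close>
      have "mdv (outer x p) (Gub \<sigma> y) = x v* DF y (p v* \<sigma> y)" for x p
        by (simp add: vec_eq_iff mdv_def mdt_def[symmetric] mdt_outer vm_nth Gub_works[OF \<sigma>_derivative])
      moreover have "ell (AA u s (\<sigma> y)) = phint phi (x1 u s) v* \<sigma> y"
        unfolding AA_def using st by (intro ell_bcls[OF bounded_bilinear_vm] x1_inL1) auto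
      ultimately show ?thesis
        using bcls_x2_chen[OF bounded_bilinear_mdv st', of "Gub \<sigma> y"] unfolding XX_def AA_def ZZ_def
        by (simp add: bcls_def)
    qed
  next
    fix a b :: "nat \<Rightarrow> real" and t s :: real
    assume le: "\<And>n. 0 \<le> b n \<and> b n \<le> a n \<and> a n \<le> T" and lim: "a \<longlonglongrightarrow> t" "b \<longlonglongrightarrow> s"
    show "(\<lambda>n. AA (a n) (b n) w) \<longlonglongrightarrow> AA t s w" for w
      unfolding AA_def by (rule bcls_cont[OF bounded_bilinear_vm x1(2) le lim tendsto_const])
    show "(\<lambda>n. XX (a n) (b n) g) \<longlonglongrightarrow> XX t s g" for g
      unfolding XX_def by (rule bcls_cont[OF bounded_bilinear_mdv x2(2) le lim tendsto_const])
  qed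
  then show ?thesis ..
qed

text \<open>Fixing one admissible constant by choice makes the abstract theorems available through a
  sublocale, without a further parameter.\<close>

definition K :: real where "K = (SOME K. rough_system damp ell AA XX ZZ \<sigma> DF (Gub \<sigma>) T K \<gamma>)"

sublocale sys: rough_system damp ell AA XX ZZ \<sigma> DF "Gub \<sigma>" a0 T K \<gamma>
  unfolding K_def by (rule someI_ex[OF rough_system_exists])


section \<open>Scalar germs of the rough integral and their sewing\<close>

definition germ :: "(real \<Rightarrow> real^'n) \<Rightarrow> (real \<Rightarrow> real^'n^'n) \<Rightarrow> real \<Rightarrow> real \<Rightarrow> real \<Rightarrow> real" where
  "germ z \<zeta> t s \<xi> = x1 t s \<xi> \<bullet> z s + mdt (x2 t s \<xi>) (\<zeta> s)"

definition grem :: "(real \<Rightarrow> real^'n) \<Rightarrow> (real \<Rightarrow> real^'n^'n) \<Rightarrow> real \<Rightarrow> real \<Rightarrow> real^'n" where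
  "grem z \<zeta> u s = z u - z s - phint phi (x1 u s) v* \<zeta> s"

lemma germ_cls:
  assumes "0 \<le> s" "s \<le> t" "t \<le> T"
  shows "inL1 phi (germ z \<zeta> t s)"
    and "cls (germ z \<zeta> t s) = bcls (\<bullet>) (x1 t s) (z s) + bcls mdt (x2 t s) (\<zeta> s)"
proof -
  note i = inL1_bilinear[OF bounded_bilinear_inner x1_inL1[OF assms]] inL1_bilinear[OF bounded_bilinear_mdt x2_inL1[OF assms]]
  show "inL1 phi (germ z \<zeta> t s)" unfolding germ_def by (rule inL1_add(1)[OF i])
  show "cls (germ z \<zeta> t s) = bcls (\<bullet>) (x1 t s) (z s) + bcls mdt (x2 t s) (\<zeta> s)"
    unfolding germ_def bcls_def by (rule inL1_add(2)[OF i])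
qed

lemma germ_tC2:
  assumes "continuous_on {0..T} z" "continuous_on {0..T} \<zeta>"
  shows "tC2 phi {0..T} (germ z \<zeta>)"
proof (rule tC2_seqI)
  fix a b :: "nat \<Rightarrow> real" and t s :: real
  assume le: "\<And>n. 0 \<le> b n \<and> b n \<le> a n \<and> a n \<le> T" and st: "0 \<le> s" "s \<le> t" "t \<le> T" and lim: "a \<longlonglongrightarrow> t" "b \<longlonglongrightarrow> s"
  have b: "b n \<in> {0..T}" for n using le[of n] by auto
  have "(\<lambda>n. z (b n)) \<longlonglongrightarrow> z s" "(\<lambda>n. \<zeta> (b n)) \<longlonglongrightarrow> \<zeta> s"
    using assms b st lim by (auto intro!: continuous_on_tendsto_compose[where s="{0..T}"])
  then have "(\<lambda>n. bcls (\<bullet>) (x1 (a n) (b n)) (z (b n)) + bcls mdt (x2 (a n) (b n)) (\<zeta> (b n))) \<longlonglongrightarrow> bcls (\<bullet>) (x1 t s) (z s) + bcls mdt (x2 t s) (\<zeta> s)"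
    by (intro tendsto_add bcls_cont[OF bounded_bilinear_inner x1(2) le lim] bcls_cont[OF bounded_bilinear_mdt x2(2) le lim])
  then show "(\<lambda>n. cls (germ z \<zeta> (a n) (b n))) \<longlonglongrightarrow> cls (germ z \<zeta> t s)"
    using germ_cls(2) le st by simp
qed (rule germ_cls(1))

lemma Jh_cls:
  assumes st: "0 \<le> s" "s \<le> u" "u \<le> t" "t \<le> T"
  shows "inL1 phi (Jh x1 x2 x3 \<zeta> r t u s)"
    and "cls (Jh x1 x2 x3 \<zeta> r t u s) = bcls (\<bullet>) (x1 t u) (r u s) + bcls mdt (x2 t u) (\<zeta> u - \<zeta> s) - bcls mdt (x3 t u s) (\<zeta> s)"
proof -
  have ut: "0 \<le> u" "u \<le> t" "t \<le> T" using st by auto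
  note i = inL1_bilinear[OF bounded_bilinear_inner x1_inL1[OF ut]] inL1_bilinear[OF bounded_bilinear_mdt x2_inL1[OF ut]]
    inL1_bilinear[OF bounded_bilinear_mdt x3_inL1[OF st]]
  show "inL1 phi (Jh x1 x2 x3 \<zeta> r t u s)" unfolding Jh_def mdt_def[symmetric] by (intro inL1_diff(1) inL1_add(1) i)
  show "cls (Jh x1 x2 x3 \<zeta> r t u s) = bcls (\<bullet>) (x1 t u) (r u s) + bcls mdt (x2 t u) (\<zeta> u - \<zeta> s) - bcls mdt (x3 t u s) (\<zeta> s)"
    unfolding Jh_def mdt_def[symmetric] bcls_def
    by (simp only: inL1_diff(2)[OF inL1_add(1)[OF i(1,2)] i(3)] inL1_add(2)[OF i(1,2)])
qed

text \<open>The Chen relations cancel everything except the three terms of \<open>Jh\<close>. The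
  sign shows that an increment minus the germ has convolutional increment \<open>Jh\<close>, so it
  is a candidate for \<open>csew\<close>.\<close>

lemma germ_cdelta2:
  assumes st: "0 \<le> s" "s \<le> u" "u \<le> t" "t \<le> T"
  shows "cls (cdelta2 (germ z \<zeta>) t u s) = - cls (Jh x1 x2 x3 \<zeta> (grem z \<zeta>) t u s)"
proof -
  let ?p = "phint phi (x1 u s)"
  have tu: "0 \<le> u" "u \<le> t" "t \<le> T" and su: "0 \<le> s" "s \<le> u" "u \<le> T" and ts: "0 \<le> s" "s \<le> t" "t \<le> T" using st by auto
  note lin = bcls_linear[OF bounded_bilinear_inner x1_inL1[OF tu]] bcls_linear[OF bounded_bilinear_mdt x2_inL1[OF tu]]
  have "cls (cdelta2 (germ z \<zeta>) t u s) = cls (germ z \<zeta> t s) - cls (germ z \<zeta> t u) - damp (t - u) (cls (germ z \<zeta> u s))"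
    by (rule inL1_cdelta2(2)[OF germ_cls(1)[OF ts] germ_cls(1)[OF tu] germ_cls(1)[OF su] st(3)])
  moreover have "bcls (\<bullet>) (x1 t s) (z s) = bcls (\<bullet>) (x1 t u) (z s) + damp (t - u) (bcls (\<bullet>) (x1 u s) (z s))"
    by (rule bcls_x1_chen[OF bounded_bilinear_inner st])
  moreover have "bcls mdt (x2 t s) (\<zeta> s) = bcls mdt (x2 t u) (\<zeta> s) + damp (t - u) (bcls mdt (x2 u s) (\<zeta> s))
     + bcls (\<bullet>) (x1 t u) (?p v* \<zeta> s) + bcls mdt (x3 t u s) (\<zeta> s)"
    using bcls_x2_chen[OF bounded_bilinear_mdt st, of "\<zeta> s"] by (simp add: mdt_outer bcls_def)
  ultimately show ?thesis
    unfolding germ_cls(2)[OF ts] germ_cls(2)[OF tu] germ_cls(2)[OF su] Jh_cls(2)[OF st] grem_def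
    by (simp add: linear_diff[OF lin(1)] linear_add[OF lin(1)] linear_diff[OF lin(2)] damp.S_plus algebra_simps)
qed

lemma three_kappa_gt_1: "1 < 3 * \<kappa>" using \<kappa> by simp

text \<open>The chosen \<open>csew\<close> has its defining properties as soon as some element does.
  Here the residual of \<open>f\<close> against the germ is one, and uniqueness of sewing then
  identifies the choice with it up to null functions.\<close>

lemma csew_eq:
  fixes f :: "real \<Rightarrow> real \<Rightarrow> real"
  assumes z: "continuous_on {0..T} z" "continuous_on {0..T} \<zeta>"
    and f: "tC1 phi {0..T} f" and R: "tC2mu phi {0..T} (3 * \<kappa>) (\<lambda>t s \<xi>. cdelta1 f t s \<xi> - germ z \<zeta> t s \<xi>)"
  shows "tC2mu phi {0..T} (3 * \<kappa>) (csew phi {0..T} (3 * \<kappa>) (Jh x1 x2 x3 \<zeta> (grem z \<zeta>)))" (is "tC2mu _ _ _ ?\<Lambda>")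
    and "\<And>s t. 0 \<le> s \<Longrightarrow> s \<le> t \<Longrightarrow> t \<le> T \<Longrightarrow>
      cls (csew phi {0..T} (3 * \<kappa>) (Jh x1 x2 x3 \<zeta> (grem z \<zeta>)) t s) = cls (\<lambda>\<xi>. cdelta1 f t s \<xi> - germ z \<zeta> t s \<xi>)"
proof -
  let ?h = "Jh x1 x2 x3 \<zeta> (grem z \<zeta>)" and ?R = "\<lambda>t s \<xi>. cdelta1 f t s \<xi> - germ z \<zeta> t s \<xi>"
  let ?P = "\<lambda>B. tC2mu phi {0..T} (3 * \<kappa>) B \<and> (\<forall>t\<in>{0..T}. \<forall>u\<in>{0..T}. \<forall>s\<in>{0..T}. s \<le> u \<and> u \<le> t \<longrightarrow>
         L1N phi (\<lambda>\<xi>. cdelta2 B t u s \<xi> - ?h t u s \<xi>) = 0)"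
  have iff: "L1N phi (\<lambda>\<xi>. cdelta2 B t u s \<xi> - ?h t u s \<xi>) = 0 \<longleftrightarrow> cls (cdelta2 B t u s) = cls (?h t u s)"
    if B: "tC2mu phi {0..T} (3 * \<kappa>) B" and st: "0 \<le> s" "s \<le> u" "u \<le> t" "t \<le> T" for B t u s
  proof (rule cls_eq_iff[OF inL1_cdelta2(1) Jh_cls(1)[OF st]])
    have "t \<in> {0..T}" "u \<in> {0..T}" "s \<in> {0..T}" "s \<le> t" using st by auto
    then show "inL1 phi (B t s)" "inL1 phi (B t u)" "inL1 phi (B u s)" "u \<le> t"
      using st by (blast intro: tC2_inL1[OF tC2mu_tC2[OF B]])+
  qed
  have Rh: "cls (cdelta2 ?R t u s) = cls (?h t u s)" if "0 \<le> s" "s \<le> u" "u \<le> t" "t \<le> T" for t u s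
    using cdelta2_cdelta1_diff[OF f germ_tC2[OF z] that] germ_cdelta2[OF that, of z \<zeta>] by simp
  then have "?P ?R" using R iff[OF R] by simp
  then have "?P (SOME B. ?P B)" by (rule someI[where P="?P"])
  then have \<Lambda>: "?P ?\<Lambda>" unfolding csew_def .
  then show \<Lambda>1: "tC2mu phi {0..T} (3 * \<kappa>) ?\<Lambda>" ..
  show "cls (?\<Lambda> t s) = cls (?R t s)" if "0 \<le> s" "s \<le> t" "t \<le> T" for s t
  proof (rule cdelta2_unique[OF \<Lambda>1 R three_kappa_gt_1 T _ that])
    fix s u t assume st: "0 \<le> s" "s \<le> u" "u \<le> t" "t \<le> T"
    then have "L1N phi (\<lambda>\<xi>. cdelta2 ?\<Lambda> t u s \<xi> - ?h t u s \<xi>) = 0" using \<Lambda> by auto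
    then show "cls (cdelta2 ?\<Lambda> t u s) = cls (cdelta2 ?R t u s)"
      unfolding iff[OF \<Lambda>1 st] Rh[OF st] .
  qed
qed

text \<open>On a bounded interval lowering the exponent costs only a power of \<open>T\<close>.
  Integrands are controlled at order \<kappa>, so the driver is measured at that order too.\<close>

lemma driver_bounds:
  obtains C where "0 \<le> C"
    "\<And>s t. 0 \<le> s \<Longrightarrow> s \<le> t \<Longrightarrow> t \<le> T \<Longrightarrow> norm (cls (x1 t s)) \<le> C * (t - s) powr \<kappa>"
    "\<And>s t. 0 \<le> s \<Longrightarrow> s \<le> t \<Longrightarrow> t \<le> T \<Longrightarrow> norm (cls (x2 t s)) \<le> C * ((t - s) powr \<kappa>)\<^sup>2"
    "\<And>s u t. 0 \<le> s \<Longrightarrow> s < u \<Longrightarrow> u < t \<Longrightarrow> t \<le> T \<Longrightarrow> norm (cls (x3 t u s)) \<le> C * ((t - s) powr \<kappa>) ^ 3"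
proof -
  have lower: "\<exists>c'\<ge>0. \<forall>d x. 0 \<le> d \<longrightarrow> d \<le> T \<longrightarrow> x \<le> c * d powr (k * \<gamma>) \<longrightarrow> x \<le> c' * d powr (k * \<kappa>)" if "0 \<le> c" "0 \<le> k" for c k
  proof (intro exI[of _ "c * T powr (k * \<gamma> - k * \<kappa>)"] conjI allI impI)
    fix d x assume d: "0 \<le> d" "d \<le> T" and "x \<le> c * d powr (k * \<gamma>)"
    note this(3)
    also have "c * d powr (k * \<gamma>) \<le> c * (T powr (k * \<gamma> - k * \<kappa>) * d powr (k * \<kappa>))"
      using that d \<kappa> by (intro mult_left_mono powr_le_powr_mult) auto
    finally show "x \<le> c * T powr (k * \<gamma> - k * \<kappa>) * d powr (k * \<kappa>)" by simp
  qed (use that in simp)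
  obtain c1 where c1: "0 \<le> c1" "\<And>s t. 0 \<le> s \<Longrightarrow> s \<le> t \<Longrightarrow> t \<le> T \<Longrightarrow> norm (cls (x1 t s)) \<le> c1 * (t - s) powr (1 * \<gamma>)"
    using tC2mu_bound[OF x1(1) T] \<gamma> by auto
  obtain c2 where c2: "0 \<le> c2" "\<And>s t. 0 \<le> s \<Longrightarrow> s \<le> t \<Longrightarrow> t \<le> T \<Longrightarrow> norm (cls (x2 t s)) \<le> c2 * (t - s) powr (2 * \<gamma>)"
    using tC2mu_bound[OF x2(1) T] \<gamma> by auto
  obtain c3 where c3: "0 \<le> c3" "\<And>s u t. 0 \<le> s \<Longrightarrow> s < u \<Longrightarrow> u < t \<Longrightarrow> t \<le> T \<Longrightarrow> norm (cls (x3 t u s)) \<le> c3 * (t - s) powr (3 * \<gamma>)"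
    using tC3mu_bound[OF x3] by blast
  obtain d1 where d1: "0 \<le> d1" "\<And>d x. 0 \<le> d \<Longrightarrow> d \<le> T \<Longrightarrow> x \<le> c1 * d powr (1 * \<gamma>) \<Longrightarrow> x \<le> d1 * d powr (1 * \<kappa>)"
    using lower[of c1 1] c1 by auto
  obtain d2 where d2: "0 \<le> d2" "\<And>d x. 0 \<le> d \<Longrightarrow> d \<le> T \<Longrightarrow> x \<le> c2 * d powr (2 * \<gamma>) \<Longrightarrow> x \<le> d2 * d powr (2 * \<kappa>)"
    using lower[of c2 2] c2 by auto
  obtain d3 where d3: "0 \<le> d3" "\<And>d x. 0 \<le> d \<Longrightarrow> d \<le> T \<Longrightarrow> x \<le> c3 * d powr (3 * \<gamma>) \<Longrightarrow> x \<le> d3 * d powr (3 * \<kappa>)"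
    using lower[of c3 3] c3 by auto
  have up: "x \<le> (d1 + d2 + d3) * b" if "x \<le> k * b" "k \<le> d1 + d2 + d3" "0 \<le> b" for x k b
    using that mult_right_mono[of k "d1 + d2 + d3" b] by linarith
  show ?thesis
  proof (rule that[of "d1 + d2 + d3"])
    show "norm (cls (x1 t s)) \<le> (d1 + d2 + d3) * (t - s) powr \<kappa>" if "0 \<le> s" "s \<le> t" "t \<le> T" for s t
      using d1(2)[OF _ _ c1(2)[OF that]] that d1(1) d2(1) d3(1) by (intro up[of _ d1]) auto
    show "norm (cls (x2 t s)) \<le> (d1 + d2 + d3) * ((t - s) powr \<kappa>)\<^sup>2" if "0 \<le> s" "s \<le> t" "t \<le> T" for s t
      using d2(2)[OF _ _ c2(2)[OF that]] that d1(1) d2(1) d3(1) by (intro up[of _ d2]) (auto simp: powr_square)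
    show "norm (cls (x3 t u s)) \<le> (d1 + d2 + d3) * ((t - s) powr \<kappa>) ^ 3" if "0 \<le> s" "s < u" "u < t" "t \<le> T" for s u t
    proof -
      have "((t - s) powr \<kappa>) ^ 3 = (t - s) powr (3 * \<kappa>)" by (simp add: power3_eq_cube powr_add[symmetric])
      then show ?thesis using d3(2)[OF _ _ c3(2)[OF that]] that d1(1) d2(1) d3(1) by (intro up[of _ d3]) auto
    qed
  qed (use d1 d2 d3 in auto)
qed

text \<open>For a controlled integrand all three terms of \<open>Jh\<close> have order 3\<kappa> >
  1, so the abstract sewing theorem applies to the germ. Uniqueness depends on this: there
  \<open>csew\<close> must be known to be small before anything else is known about the
  equation.\<close>

lemma germ_sewing:
  assumes z: "continuous_on {0..T} z" "continuous_on {0..T} \<zeta>" and C: "0 \<le> C"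
    and bd: "\<And>s. 0 \<le> s \<Longrightarrow> s \<le> T \<Longrightarrow> norm (z s) \<le> C" "\<And>s. 0 \<le> s \<Longrightarrow> s \<le> T \<Longrightarrow> norm (\<zeta> s) \<le> C"
    and r: "\<And>s u. 0 \<le> s \<Longrightarrow> s \<le> u \<Longrightarrow> u \<le> T \<Longrightarrow> norm (grem z \<zeta> u s) \<le> C * ((u - s) powr \<kappa>)\<^sup>2"
    and \<zeta>: "\<And>s u. 0 \<le> s \<Longrightarrow> s \<le> u \<Longrightarrow> u \<le> T \<Longrightarrow> norm (\<zeta> u - \<zeta> s) \<le> C * (u - s) powr \<kappa>"
  shows "\<exists>f :: real \<Rightarrow> real \<Rightarrow> real. tC1 phi {0..T} f \<and> tC2mu phi {0..T} (3 * \<kappa>) (\<lambda>t s \<xi>. cdelta1 f t s \<xi> - germ z \<zeta> t s \<xi>)"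
proof -
  obtain Cx where Cx: "0 \<le> Cx"
    "\<And>s t. 0 \<le> s \<Longrightarrow> s \<le> t \<Longrightarrow> t \<le> T \<Longrightarrow> norm (cls (x1 t s)) \<le> Cx * (t - s) powr \<kappa>"
    "\<And>s t. 0 \<le> s \<Longrightarrow> s \<le> t \<Longrightarrow> t \<le> T \<Longrightarrow> norm (cls (x2 t s)) \<le> Cx * ((t - s) powr \<kappa>)\<^sup>2"
    "\<And>s u t. 0 \<le> s \<Longrightarrow> s < u \<Longrightarrow> u < t \<Longrightarrow> t \<le> T \<Longrightarrow> norm (cls (x3 t u s)) \<le> Cx * ((t - s) powr \<kappa>) ^ 3"
    using driver_bounds by blast
  obtain b1 where b1: "0 \<le> b1" "\<And>g (w :: real^'n). inL1 phi g \<Longrightarrow> norm (bcls (\<bullet>) g w) \<le> b1 * norm (cls g) * norm w"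
    using norm_bcls[OF bounded_bilinear_inner] by blast
  obtain b2 where b2: "0 \<le> b2" "\<And>g (w :: real^'n^'n). inL1 phi g \<Longrightarrow> norm (bcls (mdt :: real^'n^'n \<Rightarrow> _) g w) \<le> b2 * norm (cls g) * norm w"
    using norm_bcls[OF bounded_bilinear_mdt] by blast
  have three: "((x :: real) powr \<kappa>) ^ 3 = x powr (3 * \<kappa>)" for x by (simp add: power3_eq_cube powr_add[symmetric])
  have est: "b * norm (cls g) * norm w \<le> b * (Cx * p) * (C * q)"
    if "0 \<le> b" "norm (cls g) \<le> Cx * p" "norm w \<le> C * q" "0 \<le> p" for b p q and g :: "real \<Rightarrow> 'v::{banach,second_countable_topology}" and w :: "'b::real_normed_vector"
    using that Cx(1) by (intro mult_mono mult_left_mono) auto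
  define C1 where "C1 = Cx * C * (b1 + b2 * T powr \<kappa>)"
  have C1: "0 \<le> C1" using Cx C b1 b2 by (simp add: C1_def)
  have germ_bd: "norm (cls (germ z \<zeta> t s)) \<le> C1 * (t - s) powr \<kappa>" if st: "0 \<le> s" "s \<le> t" "t \<le> T" for s t
  proof -
    let ?w = "(t - s) powr \<kappa>"
    have wT: "?w \<le> T powr \<kappa>" using st \<kappa> by (intro powr_mono2) auto
    have "norm (bcls (\<bullet>) (x1 t s) (z s)) \<le> b1 * (Cx * ?w) * (C * 1)"
      using st bd(1)[of s] by (intro order_trans[OF b1(2)[OF x1_inL1] est] b1 Cx(2)) auto
    moreover have "norm (bcls mdt (x2 t s) (\<zeta> s)) \<le> b2 * (Cx * ?w\<^sup>2) * (C * 1)"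
      using st bd(2)[of s] by (intro order_trans[OF b2(2)[OF x2_inL1] est] b2 Cx(3)) auto
    moreover have "b2 * (Cx * ?w\<^sup>2) * (C * 1) \<le> b2 * (Cx * (T powr \<kappa> * ?w)) * (C * 1)"
      using b2 Cx C wT unfolding power2_eq_square by (intro mult_left_mono mult_right_mono) auto
    ultimately have "norm (cls (germ z \<zeta> t s)) \<le> b1 * (Cx * ?w) * (C * 1) + b2 * (Cx * (T powr \<kappa> * ?w)) * (C * 1)"
      unfolding germ_cls(2)[OF st] by (intro norm_triangle_le) linarith
    then show ?thesis by (simp add: C1_def algebra_simps)
  qed
  define C2 where "C2 = Cx * C * (b1 + 2 * b2)"
  have C2: "0 \<le> C2" using Cx C b1 b2 by (simp add: C2_def)
  have h_bd: "norm (cls (germ z \<zeta> t s) - cls (germ z \<zeta> t u) - damp (t - u) (cls (germ z \<zeta> u s))) \<le> C2 * (t - s) powr (3 * \<kappa>)"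
    if st: "0 \<le> s" "s < u" "u < t" "t \<le> T" for s u t
  proof -
    have st': "0 \<le> s" "s \<le> u" "u \<le> t" "t \<le> T" and tu: "0 \<le> u" "u \<le> t" "t \<le> T" using st by auto
    let ?w = "(t - s) powr \<kappa>"
    have w: "(t - u) powr \<kappa> \<le> ?w" "(u - s) powr \<kappa> \<le> ?w" "0 \<le> ?w" using st \<kappa> by (auto intro!: powr_mono2)
    have w2: "((t - u) powr \<kappa>)\<^sup>2 \<le> ?w\<^sup>2" "((u - s) powr \<kappa>)\<^sup>2 \<le> ?w\<^sup>2" using w by (auto intro!: power_mono)
    have sc: "Cx * x \<le> Cx * y" "C * x \<le> C * y" if "x \<le> y" for x y using that Cx(1) C by (auto intro: mult_left_mono)
    have "norm (bcls (\<bullet>) (x1 t u) (grem z \<zeta> u s)) \<le> b1 * (Cx * ?w) * (C * ?w\<^sup>2)"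
      using tu st' w w2 by (intro order_trans[OF b1(2)[OF x1_inL1] est] b1 order_trans[OF Cx(2) sc(1)] order_trans[OF r sc(2)]) auto
    moreover have "norm (bcls mdt (x2 t u) (\<zeta> u - \<zeta> s)) \<le> b2 * (Cx * ?w\<^sup>2) * (C * ?w)"
      using tu st' w w2 by (intro order_trans[OF b2(2)[OF x2_inL1] est] b2 order_trans[OF Cx(3) sc(1)] order_trans[OF \<zeta> sc(2)]) auto
    moreover have "norm (- bcls mdt (x3 t u s) (\<zeta> s)) \<le> b2 * (Cx * ?w ^ 3) * (C * 1)"
      unfolding norm_minus_cancel using st st' w bd(2)[of s]
      by (intro order_trans[OF b2(2)[OF x3_inL1[OF st']] est] b2 Cx(4)) auto
    ultimately have "norm (cls (Jh x1 x2 x3 \<zeta> (grem z \<zeta>) t u s)) \<le> b1 * (Cx * ?w) * (C * ?w\<^sup>2) + b2 * (Cx * ?w\<^sup>2) * (C * ?w) + b2 * (Cx * ?w ^ 3) * (C * 1)"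
      unfolding Jh_cls(2)[OF st'] diff_conv_add_uminus by (rule norm_add3_le)
    also have "\<dots> = C2 * (t - s) powr (3 * \<kappa>)"
      unfolding three[symmetric] by (simp add: C2_def power2_eq_square power3_eq_cube algebra_simps)
    finally have "norm (cls (cdelta2 (germ z \<zeta>) t u s)) \<le> C2 * (t - s) powr (3 * \<kappa>)"
      unfolding germ_cdelta2[OF st'] by simp
    moreover have "cls (cdelta2 (germ z \<zeta>) t u s) = cls (germ z \<zeta> t s) - cls (germ z \<zeta> t u) - damp (t - u) (cls (germ z \<zeta> u s))"
      using st' by (intro inL1_cdelta2(2) germ_cls(1)) auto
    ultimately show ?thesis by simp
  qed
  have \<kappa>0: "0 < \<kappa>" "0 \<le> T" using \<kappa> T by auto
  have "\<exists>I L. L \<ge> 0 \<and> (\<forall>s t. 0 \<le> s \<longrightarrow> s \<le> t \<longrightarrow> t \<le> T \<longrightarrow>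
      norm (I t - damp (t - s) (I s) - cls (germ z \<zeta> t s)) \<le> L * (t - s) powr (3 * \<kappa>))"
  proof (rule damp.sewing[OF three_kappa_gt_1 \<kappa>0(1) _ \<kappa>0(2)])
    show "0 \<le> C1 + C2" using C1 C2 by simp
    show "norm (cls (germ z \<zeta> t s)) \<le> (C1 + C2) * (t - s) powr \<kappa>" if "0 \<le> s" "s \<le> t" "t \<le> T" for s t
      using germ_bd[OF that] mult_nonneg_nonneg[OF C2, of "(t - s) powr \<kappa>"] by (simp add: distrib_right)
    show "norm (cls (germ z \<zeta> t s) - cls (germ z \<zeta> t u) - damp (t - u) (cls (germ z \<zeta> u s))) \<le> (C1 + C2) * (t - s) powr (3 * \<kappa>)"
      if "0 \<le> s" "s < u" "u < t" "t \<le> T" for s u t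
      using h_bd[OF that] mult_nonneg_nonneg[OF C1, of "(t - s) powr (3 * \<kappa>)"] by (simp add: distrib_right)
  qed (rule tC2_cont[OF germ_tC2[OF z]])
  then obtain I L where L: "0 \<le> L" and I: "\<And>s t. 0 \<le> s \<Longrightarrow> s \<le> t \<Longrightarrow> t \<le> T \<Longrightarrow>
      norm (I t - damp (t - s) (I s) - cls (germ z \<zeta> t s)) \<le> L * (t - s) powr (3 * \<kappa>)" by blast
  have "continuous_on {0..T} I"
  proof (rule damp.continuous_on_path[OF \<kappa>0(1)])
    fix s t assume st: "0 \<le> s" "s \<le> t" "t \<le> T"
    have "L * (t - s) powr (3 * \<kappa>) \<le> L * (T powr (3 * \<kappa> - \<kappa>) * (t - s) powr \<kappa>)"
      using st L \<kappa> by (intro mult_left_mono powr_le_powr_mult) auto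
    moreover have "I t - damp (t - s) (I s) = (I t - damp (t - s) (I s) - cls (germ z \<zeta> t s)) + cls (germ z \<zeta> t s)" by simp
    then have "norm (I t - damp (t - s) (I s)) \<le> norm (I t - damp (t - s) (I s) - cls (germ z \<zeta> t s)) + norm (cls (germ z \<zeta> t s))"
      using norm_triangle_ineq by metis
    ultimately show "norm (I t - damp (t - s) (I s)) \<le> (L * T powr (3 * \<kappa> - \<kappa>) + C1) * (t - s) powr \<kappa>"
      using I[OF st] germ_bd[OF st] unfolding distrib_right mult.assoc by linarith
  qed
  \<comment> \<open>The sewn path consists of classes; \<open>unc\<close> chooses functions. The
    projection that this introduces leaves the germ fixed and commutes with the semigroup, so it
    only shrinks the residual.\<close>
  then have f: "tC1 phi {0..T} (\<lambda>t. unc (I t))" by (rule tC1_unc)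
  have "tC2mu phi {0..T} (3 * \<kappa>) (\<lambda>t s \<xi>. cdelta1 (\<lambda>t. unc (I t)) t s \<xi> - germ z \<zeta> t s \<xi>)"
  proof (rule tC2muI[OF tC2_cdelta1_diff(1)[OF f germ_tC2[OF z]]])
    fix s t assume st: "0 \<le> s" "s \<le> t" "t \<le> T"
    have "cls (\<lambda>\<xi>. cdelta1 (\<lambda>t. unc (I t)) t s \<xi> - germ z \<zeta> t s \<xi>) = proj (I t - damp (t - s) (I s) - cls (germ z \<zeta> t s))"
      using tC2_cdelta1_diff(2)[OF f germ_tC2[OF z] st] proj_cls[OF germ_cls(1)[OF st], of z \<zeta>]
      by (simp add: proj_diff proj_damp proj_def[symmetric])
    then show "norm (cls (\<lambda>\<xi>. cdelta1 (\<lambda>t. unc (I t)) t s \<xi> - germ z \<zeta> t s \<xi>)) \<le> L * (t - s) powr (3 * \<kappa>)"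
      using order_trans[OF norm_proj I[OF st]] by simp
  qed
  with f show ?thesis by blast
qed


section \<open>From the integral equation to residuals and back\<close>

abbreviation traj :: "(real \<Rightarrow> real \<Rightarrow> real^'d) \<Rightarrow> real \<Rightarrow> real^'d" where
  "traj yt \<equiv> ypath phi a0 yt"

definition zcol :: "(real \<Rightarrow> real \<Rightarrow> real^'d) \<Rightarrow> 'd \<Rightarrow> real \<Rightarrow> real^'n" where
  "zcol yt j v = column j (\<sigma> (traj yt v))"

definition gcol :: "(real \<Rightarrow> real \<Rightarrow> real^'d) \<Rightarrow> 'd \<Rightarrow> real \<Rightarrow> real^'n^'n" where
  "gcol yt j v = Gub \<sigma> (traj yt v) $ j"

abbreviation sew :: "(real \<Rightarrow> real \<Rightarrow> real^'d) \<Rightarrow> 'd \<Rightarrow> real \<Rightarrow> real \<Rightarrow> real \<Rightarrow> real" where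
  "sew yt j \<equiv> csew phi {0..T} (3 * \<kappa>) (Jh x1 x2 x3 (gcol yt j) (grem (zcol yt j) (gcol yt j)))"

abbreviation vgerm :: "(real \<Rightarrow> real \<Rightarrow> real^'d) \<Rightarrow> real \<Rightarrow> real \<Rightarrow> real \<Rightarrow> real^'d" where
  "vgerm yt t s \<xi> \<equiv> (\<chi> j. germ (zcol yt j) (gcol yt j) t s \<xi>)"

lemma Jsig_eq:
  "Jsig phi T \<kappa> x1 x2 x3 a0 \<sigma> yt (\<lambda>v. \<sigma> (traj yt v)) t s \<xi> = (\<chi> j. germ (zcol yt j) (gcol yt j) t s \<xi> + sew yt j t s \<xi>)"
proof -
  have 1: "sig_zeta phi a0 \<sigma> yt (\<lambda>v. \<sigma> (traj yt v)) j = gcol yt j" for j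
    by (simp add: fun_eq_iff sig_zeta_def gcol_def Gub_def)
  have 2: "sig_rem phi a0 \<sigma> x1 yt (\<lambda>v. \<sigma> (traj yt v)) j = grem (zcol yt j) (gcol yt j)" for j
    unfolding fun_eq_iff sig_rem_def 1 grem_def zcol_def by simp
  have 3: "(\<lambda>v. column j (\<sigma> (traj yt v))) = zcol yt j" for j by (simp add: fun_eq_iff zcol_def)
  show ?thesis unfolding Jsig_def 1 2 3 Jint_def germ_def mdt_def by simp
qed

lemma traj_pt: "inL1 phi (yt v) \<Longrightarrow> traj yt v = sys.pt (cls (yt v))"
  by (simp add: ypath_def sys.pt_def ell_cls)

text \<open>The meeting point of the two formulations: the explicit part of the rough integral,
  assembled over the columns, is the step \<open>B\<close> of the abstract system.\<close>

lemma vgerm_cls: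
  assumes st: "0 \<le> s" "s \<le> t" "t \<le> T" and y: "inL1 phi (yt s)"
  shows "cls (vgerm yt t s) = sys.B t s (cls (yt s))"
proof -
  have "vgerm yt t s \<xi> = x1 t s \<xi> v* \<sigma> (traj yt s) + mdv (x2 t s \<xi>) (Gub \<sigma> (traj yt s))" for \<xi>
    by (simp add: vec_eq_iff germ_def zcol_def gcol_def vm_nth mdv_def mdt_def)
  then have "cls (vgerm yt t s) = bcls (\<lambda>x w. x v* w) (x1 t s) (\<sigma> (traj yt s)) + bcls mdv (x2 t s) (Gub \<sigma> (traj yt s))"
    unfolding bcls_def
    by (simp only: inL1_add(2)[OF inL1_bilinear[OF bounded_bilinear_vm x1_inL1[OF st]] inL1_bilinear[OF bounded_bilinear_mdv x2_inL1[OF st]]])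
  then show ?thesis by (simp add: sys.B_def AA_def XX_def traj_pt[of yt, OF y])
qed

lemma vgerm_inL1: "0 \<le> s \<Longrightarrow> s \<le> t \<Longrightarrow> t \<le> T \<Longrightarrow> inL1 phi (vgerm yt t s)"
  by (intro inL1_vec(1) germ_cls(1))

lemma col_continuous:
  assumes y: "tC1 phi {0..T} yt"
  shows "continuous_on {0..T} (traj yt)" "continuous_on {0..T} (\<lambda>v. \<sigma> (traj yt v))"
    "continuous_on {0..T} (zcol yt j)" "continuous_on {0..T} (gcol yt j)"
proof -
  have l: "bounded_linear (ell :: (real^'d) lone \<Rightarrow> _)"
    using ell_linear norm_ell_le by (auto simp: bounded_linear_def bounded_linear_axioms_def linear_def intro!: exI[of _ 1])
  have "continuous_on {0..T} (\<lambda>v. a0 + ell (cls (yt v)))"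
    using y unfolding tC1_iff by (intro continuous_intros bounded_linear.continuous_on[OF l]) auto
  moreover have "traj yt v = a0 + ell (cls (yt v))" if "v \<in> {0..T}" for v
    using y that by (simp add: ypath_def ell_cls tC1_iff)
  ultimately show p: "continuous_on {0..T} (traj yt)" by (subst continuous_on_cong[OF refl])
  have lip: "continuous_on UNIV \<sigma>" "continuous_on UNIV (Gub \<sigma>)"
    using sys.K sys.F_lip sys.G_lip by (auto intro!: lipschitz_on_continuous_on[where L=K] simp: lipschitz_on_def dist_norm)
  show s: "continuous_on {0..T} (\<lambda>v. \<sigma> (traj yt v))" by (rule continuous_on_compose2[OF lip(1) p]) simp
  have g: "continuous_on {0..T} (\<lambda>v. Gub \<sigma> (traj yt v))" by (rule continuous_on_compose2[OF lip(2) p]) simp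
  show "continuous_on {0..T} (zcol yt j)"
    unfolding zcol_def[abs_def] column_def using s by (intro continuous_intros) auto
  show "continuous_on {0..T} (gcol yt j)"
    unfolding gcol_def[abs_def] using g by (intro continuous_intros) auto
qed

lemma res_cls:
  assumes y: "tC1 phi {0..T} yt" and st: "0 \<le> s" "s \<le> t" "t \<le> T"
  shows "inL1 phi (\<lambda>\<xi>. cdelta1 yt t s \<xi> - vgerm yt t s \<xi>)"
    and "sys.res t s (cls (yt t)) (cls (yt s)) = cls (\<lambda>\<xi>. cdelta1 yt t s \<xi> - vgerm yt t s \<xi>)"
proof -
  have i: "inL1 phi (yt t)" "inL1 phi (yt s)" using tC1_inL1[OF y] st by auto
  note d = inL1_cdelta1[where f=yt, OF i st(2)] and g = vgerm_inL1[OF st, of yt]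
  show "inL1 phi (\<lambda>\<xi>. cdelta1 yt t s \<xi> - vgerm yt t s \<xi>)" by (rule inL1_diff(1)[OF d(1) g])
  show "sys.res t s (cls (yt t)) (cls (yt s)) = cls (\<lambda>\<xi>. cdelta1 yt t s \<xi> - vgerm yt t s \<xi>)"
    unfolding sys.res_def inL1_diff(2)[OF d(1) g] d(2) vgerm_cls[where yt=yt, OF st i(2)] ..
qed

text \<open>Observing the controlled decomposition adds the drift of the state. This is of first
  order in time, hence harmless at order 2\<kappa> < 1; the state itself is bounded by compactness
  of \<open>[0, T]\<close>.\<close>

lemma traj_increments:
  assumes y: "tC1 phi {0..T} yt"
    and rem: "tC2mu phi {0..T} (2 * \<kappa>) (\<lambda>t s \<xi>. cdelta1 yt t s \<xi> - x1 t s \<xi> v* \<sigma> (traj yt s))"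
  shows "\<exists>c\<ge>0. \<forall>s u. 0 \<le> s \<longrightarrow> s \<le> u \<longrightarrow> u \<le> T \<longrightarrow>
    norm (sys.rho u s (cls (yt u)) (cls (yt s))) \<le> c * ((u - s) powr \<kappa>)\<^sup>2 \<and>
    norm (ell (cls (yt u) - cls (yt s))) \<le> c * (u - s) powr \<kappa>"
proof -
  define Y where "Y t = cls (yt t)" for t
  have yi: "inL1 phi (yt t)" if "0 \<le> t" "t \<le> T" for t using tC1_inL1[OF y that] .
  have Yp: "traj yt t = sys.pt (Y t)" if "0 \<le> t" "t \<le> T" for t
    using traj_pt[of yt t, OF yi[OF that]] by (simp add: Y_def)
  have "0 < 2 * \<kappa>" using \<kappa> by simp
  from tC2mu_bound[OF rem T this] obtain Cr where Cr: "0 \<le> Cr"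
    "\<And>s t. 0 \<le> s \<Longrightarrow> s \<le> t \<Longrightarrow> t \<le> T \<Longrightarrow>
       norm (cls (\<lambda>\<xi>. cdelta1 yt t s \<xi> - x1 t s \<xi> v* \<sigma> (traj yt s))) \<le> Cr * (t - s) powr (2 * \<kappa>)" by blast
  have "compact (Y ` {0..T})" unfolding Y_def
    using y by (intro compact_continuous_image) (auto simp: tC1_iff)
  then obtain M where M: "0 < M" "\<And>t. 0 \<le> t \<Longrightarrow> t \<le> T \<Longrightarrow> norm (Y t) \<le> M"
    using compact_imp_bounded bounded_pos by (metis atLeastAtMost_iff imageI)
  have K: "0 \<le> K" "1 \<le> K" using sys.K by auto
  have pow2: "(x powr \<kappa>)\<^sup>2 = x powr (2 * \<kappa>)" for x :: real by (rule powr_square)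
  define c\<rho> where "c\<rho> = Cr + M * T powr (1 - 2 * \<kappa>)"
  define c\<delta> where "c\<delta> = K\<^sup>2 * T powr (\<gamma> - \<kappa>) + c\<rho> * T powr \<kappa>"
  have c: "0 \<le> c\<rho>" "0 \<le> c\<delta>" using Cr M by (auto simp: c\<rho>_def c\<delta>_def intro!: add_nonneg_nonneg mult_nonneg_nonneg)
  have rho: "norm (sys.rho u s (Y u) (Y s)) \<le> c\<rho> * ((u - s) powr \<kappa>)\<^sup>2" if su: "0 \<le> s" "s \<le> u" "u \<le> T" for s u
  proof -
    have s: "0 \<le> s" "s \<le> T" and u: "0 \<le> u" "u \<le> T" using su by auto
    have "cls (\<lambda>\<xi>. cdelta1 yt u s \<xi> - x1 u s \<xi> v* \<sigma> (traj yt s)) = Y u - damp (u - s) (Y s) - AA u s (\<sigma> (sys.pt (Y s)))"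
      using inL1_diff(2)[OF inL1_cdelta1(1)[where f=yt, OF yi[OF u] yi[OF s] su(2)] inL1_bilinear[OF bounded_bilinear_vm x1_inL1[OF su]], of "\<sigma> (traj yt s)"]
        inL1_cdelta1(2)[where f=yt, OF yi[OF u] yi[OF s] su(2)] Yp[OF s]
      by (simp add: AA_def bcls_def Y_def)
    then have "sys.rho u s (Y u) (Y s) = ell (cls (\<lambda>\<xi>. cdelta1 yt u s \<xi> - x1 u s \<xi> v* \<sigma> (traj yt s))) + (ell (damp (u - s) (Y s)) - ell (Y s))"
      by (simp add: sys.rho_def sys.ell_diff)
    moreover have "norm (ell (cls (\<lambda>\<xi>. cdelta1 yt u s \<xi> - x1 u s \<xi> v* \<sigma> (traj yt s)))) \<le> Cr * (u - s) powr (2 * \<kappa>)"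
      by (rule order_trans[OF norm_ell_le Cr(2)[OF su]])
    moreover have "norm (ell (damp (u - s) (Y s)) - ell (Y s)) \<le> (u - s) * M"
      using su M(2)[OF s] by (intro order_trans[OF ell_damp] mult_left_mono) auto
    moreover have "(u - s) * M \<le> T powr (1 - 2 * \<kappa>) * (u - s) powr (2 * \<kappa>) * M"
      using powr_le_powr_mult[of "u - s" T "2 * \<kappa>" 1] su \<kappa> \<gamma> M(1) by (intro mult_right_mono) auto
    ultimately have "norm (sys.rho u s (Y u) (Y s)) \<le> Cr * (u - s) powr (2 * \<kappa>) + T powr (1 - 2 * \<kappa>) * (u - s) powr (2 * \<kappa>) * M"
      using norm_triangle_mono by force
    then show ?thesis by (simp add: pow2 c\<rho>_def algebra_simps)
  qed
  have delta: "norm (ell (Y u - Y s)) \<le> c\<delta> * (u - s) powr \<kappa>" if su: "0 \<le> s" "s \<le> u" "u \<le> T" for s u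
  proof (cases "s = u")
    case True
    then show ?thesis by (simp add: linear_0[OF ell_linear])
  next
    case False
    let ?w = "(u - s) powr \<kappa>"
    have "norm (ell (Y u - Y s)) \<le> K\<^sup>2 * (u - s) powr \<gamma> + c\<rho> * ?w\<^sup>2"
      using sys.delta_bound[of s u "Y u" "Y s"] rho[OF su] False su by simp
    also have "\<dots> \<le> K\<^sup>2 * (T powr (\<gamma> - \<kappa>) * ?w) + c\<rho> * (T powr \<kappa> * ?w)"
    proof (intro add_mono mult_left_mono)
      show "(u - s) powr \<gamma> \<le> T powr (\<gamma> - \<kappa>) * ?w" using su \<kappa> by (intro powr_le_powr_mult) auto
      show "?w\<^sup>2 \<le> T powr \<kappa> * ?w" unfolding power2_eq_square using su \<kappa> by (intro mult_right_mono powr_mono2) auto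
    qed (use c in auto)
    finally show ?thesis by (simp add: c\<delta>_def algebra_simps)
  qed
  have up: "x \<le> (c\<rho> + c\<delta>) * b" if "x \<le> k * b" "k \<le> c\<rho> + c\<delta>" "0 \<le> b" for x k b
    using that mult_right_mono[of k "c\<rho> + c\<delta>" b] by linarith
  show ?thesis
    by (rule exI[of _ "c\<rho> + c\<delta>"])
       (use c in \<open>auto intro: up[OF rho[unfolded Y_def]] up[OF delta[unfolded Y_def]]\<close>)
qed

text \<open>\<sigma> of a controlled path is controlled. The first-level term is rewritten as
  observed increment minus observed remainder, so the remainder of a column becomes a Taylor
  remainder plus \<open>DF\<close> of the observed remainder, both of order 2\<kappa>.\<close>

lemma sew_bound:
  assumes y: "tC1 phi {0..T} yt"
    and rem: "tC2mu phi {0..T} (2 * \<kappa>) (\<lambda>t s \<xi>. cdelta1 yt t s \<xi> - x1 t s \<xi> v* \<sigma> (traj yt s))"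
  shows "\<exists>f :: real \<Rightarrow> real \<Rightarrow> real. tC1 phi {0..T} f \<and>
     tC2mu phi {0..T} (3 * \<kappa>) (\<lambda>t s \<xi>. cdelta1 f t s \<xi> - germ (zcol yt j) (gcol yt j) t s \<xi>)"
proof -
  define Y where "Y t = cls (yt t)" for t
  have Yp: "traj yt t = sys.pt (Y t)" if "0 \<le> t" "t \<le> T" for t
    using traj_pt[of yt t, OF tC1_inL1[OF y that]] by (simp add: Y_def)
  have K: "0 \<le> K" using sys.K by simp
  obtain c where c: "0 \<le> c" and inc: "\<forall>s u. 0 \<le> s \<longrightarrow> s \<le> u \<longrightarrow> u \<le> T \<longrightarrow>
      norm (sys.rho u s (cls (yt u)) (cls (yt s))) \<le> c * ((u - s) powr \<kappa>)\<^sup>2 \<and>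
      norm (ell (cls (yt u) - cls (yt s))) \<le> c * (u - s) powr \<kappa>"
    using traj_increments[OF y rem] by (elim exE conjE)
  have rho: "norm (sys.rho u s (Y u) (Y s)) \<le> c * ((u - s) powr \<kappa>)\<^sup>2"
    and delta: "norm (ell (Y u - Y s)) \<le> c * (u - s) powr \<kappa>" if "0 \<le> s" "s \<le> u" "u \<le> T" for s u
    using inc that by (simp_all add: Y_def)
  define C where "C = K + K * c + K * (c\<^sup>2 + c)"
  have C: "0 \<le> K * c" "0 \<le> K * (c\<^sup>2 + c)" using K c by auto
  then have CC: "K \<le> C" "K * c \<le> C" "K * (c\<^sup>2 + c) \<le> C" "0 \<le> C" using K by (auto simp: C_def)
  show ?thesis
  proof (rule germ_sewing[OF col_continuous(3,4)[OF y] CC(4)])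
    fix s assume s: "0 \<le> s" "s \<le> T"
    show "norm (zcol yt j s) \<le> C" unfolding zcol_def
      by (rule order_trans[OF norm_column_le order_trans[OF sys.F_bounded CC(1)]])
    show "norm (gcol yt j s) \<le> C" unfolding gcol_def
      by (rule order_trans[OF Finite_Cartesian_Product.norm_nth_le order_trans[OF sys.G_bounded CC(1)]])
  next
    fix s u assume su: "0 \<le> s" "s \<le> u" "u \<le> T"
    let ?w = "(u - s) powr \<kappa>" and ?\<delta> = "ell (Y u - Y s)" and ?\<rho> = "sys.rho u s (Y u) (Y s)"
    have p: "traj yt s = sys.pt (Y s)" "traj yt u = sys.pt (Y u)" using Yp su by auto
    have pd: "sys.pt (Y u) = sys.pt (Y s) + ?\<delta>" by (simp add: sys.pt_def sys.ell_diff)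
    have "norm (Gub \<sigma> (traj yt u) - Gub \<sigma> (traj yt s)) \<le> K * norm ?\<delta>"
      using sys.G_lip[of "traj yt u" "traj yt s"] unfolding p sys.pt_diff .
    also have "\<dots> \<le> K * (c * ?w)" using K delta[OF su] by (intro mult_left_mono) auto
    also have "\<dots> \<le> C * ?w" using CC(2) by (simp add: mult.assoc[symmetric] mult_right_mono)
    finally show "norm (gcol yt j u - gcol yt j s) \<le> C * ?w"
      unfolding gcol_def vector_minus_component[symmetric] by (rule order_trans[OF Finite_Cartesian_Product.norm_nth_le])
    have "phint phi (x1 u s) v* \<sigma> (traj yt s) = ?\<delta> - ?\<rho>"
      using ell_bcls[OF bounded_bilinear_vm x1_inL1[OF su], of "\<sigma> (traj yt s)"] by (simp add: sys.rho_def AA_def p)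
    then have "grem (zcol yt j) (gcol yt j) u s = column j (\<sigma> (traj yt u)) - column j (\<sigma> (traj yt s)) - column j (DF (traj yt s) (?\<delta> - ?\<rho>))"
      by (simp add: grem_def zcol_def gcol_def Gub_works[OF \<sigma>_derivative])
    also have "\<dots> = column j ((\<sigma> (sys.pt (Y s) + ?\<delta>) - \<sigma> (sys.pt (Y s)) - DF (sys.pt (Y s)) ?\<delta>) + DF (sys.pt (Y s)) ?\<rho>)"
      unfolding p(1) unfolding p(2) pd by (simp add: column_diff column_add linear_diff[OF sys.DF_linear])
    finally have "norm (grem (zcol yt j) (gcol yt j) u s) \<le> norm ((\<sigma> (sys.pt (Y s) + ?\<delta>) - \<sigma> (sys.pt (Y s)) - DF (sys.pt (Y s)) ?\<delta>) + DF (sys.pt (Y s)) ?\<rho>)"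
      using norm_column_le by simp
    also have "\<dots> \<le> K * (norm ?\<delta>)\<^sup>2 + K * norm ?\<rho>"
      by (rule norm_triangle_mono[OF sys.F_taylor sys.norm_DF])
    also have "\<dots> \<le> K * (c * ?w)\<^sup>2 + K * (c * ?w\<^sup>2)"
      using K delta[OF su] rho[OF su] by (intro add_mono mult_left_mono power_mono) auto
    also have "\<dots> = K * (c\<^sup>2 + c) * ?w\<^sup>2" by (simp add: power_mult_distrib algebra_simps)
    also have "\<dots> \<le> C * ?w\<^sup>2" using CC(3) by (rule mult_right_mono) simp
    finally show "norm (grem (zcol yt j) (gcol yt j) u s) \<le> C * ?w\<^sup>2" .
  qed
qed

text \<open>By the equation the residual is the vector of the sewn elements of the columns. These
  have order 3\<kappa> because \<open>sew_bound\<close> guarantees that the choice in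
  \<open>csew\<close> is not vacuous.\<close>

lemma solution_res:
  assumes sol: "is_solution phi T \<kappa> x1 x2 x3 a0 \<sigma> yt"
  shows "tC1 phi {0..T} yt" "cls (yt 0) = 0"
    "\<exists>L\<ge>0. \<forall>s t. 0 \<le> s \<longrightarrow> s \<le> t \<longrightarrow> t \<le> T \<longrightarrow> norm (sys.res t s (cls (yt t)) (cls (yt s))) \<le> L * (t - s) powr (3 * \<kappa>)"
proof -
  show y: "tC1 phi {0..T} yt" using sol by (simp add: is_solution_def tQ_def Let_def)
  have "L1N phi (yt 0) = 0" using sol by (simp add: is_solution_def Let_def)
  then show "cls (yt 0) = 0" using tC1_inL1[OF y] T by (intro L1N_zero_imp_cls) auto
  have rem: "tC2mu phi {0..T} (2 * \<kappa>) (\<lambda>t s \<xi>. cdelta1 yt t s \<xi> - x1 t s \<xi> v* \<sigma> (traj yt s))"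
    using sol by (simp add: is_solution_def tQ_def Let_def)
  have eqn: "L1N phi (\<lambda>\<xi>. cdelta1 yt t s \<xi> - Jsig phi T \<kappa> x1 x2 x3 a0 \<sigma> yt (\<lambda>v. \<sigma> (traj yt v)) t s \<xi>) = 0"
    if "0 \<le> s" "s \<le> t" "t \<le> T" for s t
    using sol that by (simp add: is_solution_def Let_def)
  have sew: "tC2mu phi {0..T} (3 * \<kappa>) (sew yt j)" for j
  proof -
    obtain f :: "real \<Rightarrow> real \<Rightarrow> real" where "tC1 phi {0..T} f"
      "tC2mu phi {0..T} (3 * \<kappa>) (\<lambda>t s \<xi>. cdelta1 f t s \<xi> - germ (zcol yt j) (gcol yt j) t s \<xi>)"
      using sew_bound[OF y rem] by blast
    then show ?thesis by (rule csew_eq(1)[OF col_continuous(3,4)[OF y]])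
  qed
  have "\<forall>j. \<exists>C\<ge>0. \<forall>s t. 0 \<le> s \<longrightarrow> s \<le> t \<longrightarrow> t \<le> T \<longrightarrow> norm (cls (sew yt j t s)) \<le> C * (t - s) powr (3 * \<kappa>)"
    using tC2mu_bound[OF sew T] three_kappa_gt_1 by simp
  then obtain C where C: "\<And>j. 0 \<le> C j"
    "\<And>j s t. 0 \<le> s \<Longrightarrow> s \<le> t \<Longrightarrow> t \<le> T \<Longrightarrow> norm (cls (sew yt j t s)) \<le> C j * (t - s) powr (3 * \<kappa>)" by metis
  show "\<exists>L\<ge>0. \<forall>s t. 0 \<le> s \<longrightarrow> s \<le> t \<longrightarrow> t \<le> T \<longrightarrow> norm (sys.res t s (cls (yt t)) (cls (yt s))) \<le> L * (t - s) powr (3 * \<kappa>)"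
  proof (intro exI[of _ "\<Sum>j\<in>UNIV. C j"] conjI allI impI)
    fix s t assume st: "0 \<le> s" "s \<le> t" "t \<le> T"
    have "t \<in> {0..T}" "s \<in> {0..T}" using st by auto
    then have si: "inL1 phi (sew yt j t s)" for j using tC2_inL1[OF tC2mu_tC2[OF sew]] st by blast
    note vi = inL1_vec[of "\<lambda>j. sew yt j t s", OF si]
    note gi = vgerm_inL1[OF st, of yt]
    have J: "Jsig phi T \<kappa> x1 x2 x3 a0 \<sigma> yt (\<lambda>v. \<sigma> (traj yt v)) t s \<xi> = vgerm yt t s \<xi> + (\<chi> j. sew yt j t s \<xi>)" for \<xi>
      unfolding Jsig_eq by (simp add: vec_eq_iff)
    have "L1N phi (\<lambda>\<xi>. (cdelta1 yt t s \<xi> - vgerm yt t s \<xi>) - (\<chi> j. sew yt j t s \<xi>)) = 0"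
      using eqn[OF st] unfolding J by (simp add: diff_diff_eq)
    then have "sys.res t s (cls (yt t)) (cls (yt s)) = cls (\<lambda>\<xi>. \<chi> j. sew yt j t s \<xi>)"
      unfolding cls_eq_iff[OF res_cls(1)[OF y st] vi(1)] res_cls(2)[OF y st] .
    then have "norm (sys.res t s (cls (yt t)) (cls (yt s))) \<le> (\<Sum>j\<in>UNIV. norm (cls (sew yt j t s)))" using vi(2) by simp
    also have "\<dots> \<le> (\<Sum>j\<in>UNIV. C j * (t - s) powr (3 * \<kappa>))" by (intro sum_mono C(2) st)
    finally show "norm (sys.res t s (cls (yt t)) (cls (yt s))) \<le> (\<Sum>j\<in>UNIV. C j) * (t - s) powr (3 * \<kappa>)"
      by (simp add: sum_distrib_right)
  qed (auto intro: sum_nonneg C)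
qed

text \<open>The driver terms are classes of functions and hence fixed by \<open>proj\<close>, and
  the discarded part of the state is not observed; so the residual commutes with the
  projection.\<close>

lemma res_proj:
  assumes st: "0 \<le> s" "s \<le> t" "t \<le> T"
  shows "sys.res t s (proj F) (proj G) = proj (sys.res t s F G)"
proof -
  have "sys.pt (proj G) = sys.pt G" by (simp add: sys.pt_def ell_proj)
  moreover have "proj (AA t s w) = AA t s w" for w
    unfolding AA_def bcls_def by (intro proj_cls inL1_bilinear[OF bounded_bilinear_vm x1_inL1[OF st]])
  moreover have "proj (XX t s g) = XX t s g" for g
    unfolding XX_def bcls_def by (intro proj_cls inL1_bilinear[OF bounded_bilinear_mdv x2_inL1[OF st]])
  ultimately show ?thesis
    by (simp add: sys.res_def sys.B_def proj_diff proj_damp diff_diff_eq[symmetric])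
qed

text \<open>The abstract path satisfies the equation because its residual has order 3\<kappa> and,
  by the Chen relations, the convolutional increment that characterizes the sewn element.\<close>

lemma solution_exists: "\<exists>yt. is_solution phi T \<kappa> x1 x2 x3 a0 \<sigma> yt"
proof -
  obtain Y0 L where L: "0 \<le> L" and Y00: "Y0 0 = 0"
    and R0: "\<And>s t. 0 \<le> s \<Longrightarrow> s \<le> t \<Longrightarrow> t \<le> T \<Longrightarrow> norm (sys.res t s (Y0 t) (Y0 s)) \<le> L * (t - s) powr (3 * \<gamma>)"
    using sys.existence by blast
  \<comment> \<open>Passing to functions replaces the abstract path by its projection;
    \<open>res_proj\<close> carries the residual bound over.\<close>
  define yt where "yt t = unc (Y0 t)" for t
  define Y where "Y t = cls (yt t)" for t
  have Yp: "Y t = proj (Y0 t)" for t by (simp add: Y_def yt_def proj_def)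
  have R: "norm (sys.res t s (Y t) (Y s)) \<le> L * (t - s) powr (3 * \<gamma>)" if "0 \<le> s" "s \<le> t" "t \<le> T" for s t
    unfolding Yp res_proj[OF that] by (rule order_trans[OF norm_proj R0[OF that]])
  define L\<kappa> where "L\<kappa> = L * T powr (3 * \<gamma> - 3 * \<kappa>)"
  have R\<kappa>: "norm (sys.res t s (Y t) (Y s)) \<le> L\<kappa> * (t - s) powr (3 * \<kappa>)" if st: "0 \<le> s" "s \<le> t" "t \<le> T" for s t
  proof -
    have "L * (t - s) powr (3 * \<gamma>) \<le> L * (T powr (3 * \<gamma> - 3 * \<kappa>) * (t - s) powr (3 * \<kappa>))"
      using st L \<kappa> by (intro mult_left_mono powr_le_powr_mult) auto
    then show ?thesis using R[OF st] by (simp add: L\<kappa>_def)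
  qed
  have Ld: "0 \<le> L\<kappa>" using L by (simp add: L\<kappa>_def)
  have KK: "0 \<le> K" "0 \<le> K * K" using sys.K by auto
  \<comment> \<open>Subtracting only the first-level term leaves the second-level term and the
    residual. Their orders 2\<gamma> and 3\<kappa> both exceed 2\<kappa>, which is what membership
    in the controlled space requires.\<close>
  have X\<kappa>: "norm (XX t s (Gub \<sigma> z) + sys.res t s (Y t) (Y s)) \<le> (K * K * T powr (2 * \<gamma> - 2 * \<kappa>) + L\<kappa> * T powr (3 * \<kappa> - 2 * \<kappa>)) * (t - s) powr (2 * \<kappa>)"
    if st: "0 \<le> s" "s \<le> t" "t \<le> T" for s t z
  proof -
    have "norm (XX t s (Gub \<sigma> z)) \<le> K * ((t - s) powr \<gamma>)\<^sup>2 * K"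
      using st by (intro sys.norm_X_le sys.G_bounded)
    also have "\<dots> = K * K * (t - s) powr (2 * \<gamma>)" by (simp add: powr_square)
    also have "\<dots> \<le> K * K * (T powr (2 * \<gamma> - 2 * \<kappa>) * (t - s) powr (2 * \<kappa>))"
      using st \<kappa> KK by (intro mult_left_mono powr_le_powr_mult) auto
    finally have 1: "norm (XX t s (Gub \<sigma> z)) \<le> K * K * (T powr (2 * \<gamma> - 2 * \<kappa>) * (t - s) powr (2 * \<kappa>))" .
    have "L\<kappa> * (t - s) powr (3 * \<kappa>) \<le> L\<kappa> * (T powr (3 * \<kappa> - 2 * \<kappa>) * (t - s) powr (2 * \<kappa>))"
      using st \<kappa> Ld by (intro mult_left_mono powr_le_powr_mult) auto
    then have 2: "norm (sys.res t s (Y t) (Y s)) \<le> L\<kappa> * (T powr (3 * \<kappa> - 2 * \<kappa>) * (t - s) powr (2 * \<kappa>))"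
      using R\<kappa>[OF st] by (rule order_trans[rotated])
    show ?thesis using norm_triangle_mono[OF 1 2] by (simp add: distrib_right mult.assoc)
  qed
  have \<kappa>0: "0 < \<kappa>" using \<kappa> by simp
  have cont: "continuous_on {0..T} Y0"
  proof (rule damp.continuous_on_path[OF \<kappa>0])
    fix s t assume st: "0 \<le> s" "s \<le> t" "t \<le> T"
    let ?w = "(t - s) powr \<kappa>"
    have "norm (sys.B t s (Y0 s)) \<le> K\<^sup>2 * ((t - s) powr \<gamma> + ((t - s) powr \<gamma>)\<^sup>2)" by (rule sys.B_bound[OF st])
    also have "\<dots> \<le> K\<^sup>2 * (T powr (\<gamma> - \<kappa>) * ?w + T powr (2 * \<gamma> - \<kappa>) * ?w)"
      unfolding powr_square using st \<kappa> by (intro mult_left_mono add_mono powr_le_powr_mult) auto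
    finally have 1: "norm (sys.B t s (Y0 s)) \<le> K\<^sup>2 * (T powr (\<gamma> - \<kappa>) * ?w + T powr (2 * \<gamma> - \<kappa>) * ?w)" .
    have "L * (t - s) powr (3 * \<gamma>) \<le> L * (T powr (3 * \<gamma> - \<kappa>) * ?w)"
      using st \<kappa> L by (intro mult_left_mono powr_le_powr_mult) auto
    then have 2: "norm (sys.res t s (Y0 t) (Y0 s)) \<le> L * (T powr (3 * \<gamma> - \<kappa>) * ?w)"
      using R0[OF st] by (rule order_trans[rotated])
    have "Y0 t - damp (t - s) (Y0 s) = sys.B t s (Y0 s) + sys.res t s (Y0 t) (Y0 s)" by (simp add: sys.res_def)
    then show "norm (Y0 t - damp (t - s) (Y0 s)) \<le> (K\<^sup>2 * (T powr (\<gamma> - \<kappa>) + T powr (2 * \<gamma> - \<kappa>)) + L * T powr (3 * \<gamma> - \<kappa>)) * ?w"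
      using norm_triangle_mono[OF 1 2] by (simp only: distrib_right distrib_left mult.assoc)
  qed
  have y: "tC1 phi {0..T} yt" unfolding yt_def[abs_def] by (rule tC1_unc[OF cont])
  have yi: "inL1 phi (yt t)" for t by (simp add: yt_def inL1_unc)
  have p: "traj yt t = sys.pt (Y t)" for t using traj_pt[of yt t, OF yi] by (simp add: Y_def)
  have vm: "cls (\<lambda>\<xi>. x1 t s \<xi> v* \<sigma> (traj yt s)) = AA t s (\<sigma> (sys.pt (Y s)))" for t s by (simp add: AA_def bcls_def p)
  have x1t: "tC2 phi {0..T} (\<lambda>t s \<xi>. x1 t s \<xi> v* \<sigma> (traj yt s))"
  proof (rule tC2_seqI)
    fix a b :: "nat \<Rightarrow> real" and t s :: real
    assume le: "\<And>n. 0 \<le> b n \<and> b n \<le> a n \<and> a n \<le> T" and st: "0 \<le> s" "s \<le> t" "t \<le> T" and lim: "a \<longlonglongrightarrow> t" "b \<longlonglongrightarrow> s"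
    have b: "b n \<in> {0..T}" for n using le[of n] by auto
    have "(\<lambda>n. \<sigma> (traj yt (b n))) \<longlonglongrightarrow> \<sigma> (traj yt s)"
      using b st lim by (intro continuous_on_tendsto_compose[OF col_continuous(2)[OF y]]) auto
    then show "(\<lambda>n. cls (\<lambda>\<xi>. x1 (a n) (b n) \<xi> v* \<sigma> (traj yt (b n)))) \<longlonglongrightarrow> cls (\<lambda>\<xi>. x1 t s \<xi> v* \<sigma> (traj yt s))"
      using bcls_cont[OF bounded_bilinear_vm x1(2) le lim] by (simp add: bcls_def)
  qed (rule inL1_bilinear[OF bounded_bilinear_vm x1_inL1])
  have rem: "tC2mu phi {0..T} (2 * \<kappa>) (\<lambda>t s \<xi>. cdelta1 yt t s \<xi> - x1 t s \<xi> v* \<sigma> (traj yt s))"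
  proof (rule tC2muI[OF tC2_cdelta1_diff(1)[OF y x1t]])
    fix s t assume st: "0 \<le> s" "s \<le> t" "t \<le> T"
    have "cls (\<lambda>\<xi>. cdelta1 yt t s \<xi> - x1 t s \<xi> v* \<sigma> (traj yt s)) = XX t s (Gub \<sigma> (sys.pt (Y s))) + sys.res t s (Y t) (Y s)"
      using tC2_cdelta1_diff(2)[OF y x1t st] unfolding vm by (simp add: Y_def sys.res_def sys.B_def)
    then show "norm (cls (\<lambda>\<xi>. cdelta1 yt t s \<xi> - x1 t s \<xi> v* \<sigma> (traj yt s))) \<le> (K * K * T powr (2 * \<gamma> - 2 * \<kappa>) + L\<kappa> * T powr (3 * \<kappa> - 2 * \<kappa>)) * (t - s) powr (2 * \<kappa>)"
      using X\<kappa>[OF st] by simp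
  qed
  have hold: "holder1 {0..T} \<kappa> (\<lambda>v. \<sigma> (traj yt v))"
  proof -
    obtain c where delta: "\<forall>s u. 0 \<le> s \<longrightarrow> s \<le> u \<longrightarrow> u \<le> T \<longrightarrow>
        norm (sys.rho u s (cls (yt u)) (cls (yt s))) \<le> c * ((u - s) powr \<kappa>)\<^sup>2 \<and>
        norm (ell (cls (yt u) - cls (yt s))) \<le> c * (u - s) powr \<kappa>"
      using traj_increments[OF y rem] by (elim exE conjE)
    have delta: "norm (ell (Y u - Y s)) \<le> c * (u - s) powr \<kappa>" if "0 \<le> s" "s \<le> u" "u \<le> T" for s u
      using delta that by (simp add: Y_def)
    have le: "norm (\<sigma> (traj yt u) - \<sigma> (traj yt s)) \<le> K * c * (u - s) powr \<kappa>" if "0 \<le> s" "s \<le> u" "u \<le> T" for s u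
    proof -
      have "norm (\<sigma> (traj yt u) - \<sigma> (traj yt s)) \<le> K * norm (ell (Y u - Y s))"
        using sys.F_lip[of "traj yt u" "traj yt s"] unfolding p sys.pt_diff .
      also have "\<dots> \<le> K * (c * (u - s) powr \<kappa>)" using delta[OF that] KK by (intro mult_left_mono) auto
      finally show ?thesis by simp
    qed
    show ?thesis unfolding holder1_def
    proof (intro exI[of _ "K * c"] ballI)
      fix t s assume "t \<in> {0..T}" "s \<in> {0..T}"
      then show "norm (\<sigma> (traj yt t) - \<sigma> (traj yt s)) \<le> K * c * \<bar>t - s\<bar> powr \<kappa>"
        using le[of s t] le[of t s] by (cases "s \<le> t") (auto simp: norm_minus_commute)
    qed
  qed
  have "L1N phi (\<lambda>\<xi>. cdelta1 yt t s \<xi> - Jsig phi T \<kappa> x1 x2 x3 a0 \<sigma> yt (\<lambda>v. \<sigma> (traj yt v)) t s \<xi>) = 0"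
    if st: "0 \<le> s" "s \<le> t" "t \<le> T" for s t
  proof -
    note ri = res_cls[OF y st]
    have comp: "(\<lambda>\<xi>. (cdelta1 yt t s \<xi> - vgerm yt t s \<xi>) $ j) = (\<lambda>\<xi>. cdelta1 (\<lambda>t \<xi>. yt t \<xi> $ j) t s \<xi> - germ (zcol yt j) (gcol yt j) t s \<xi>)" for t s j
      by (simp add: fun_eq_iff cdelta1_def)
    have "inL1 phi (sew yt j t s) \<and> cls (sew yt j t s) = cls (\<lambda>\<xi>. (cdelta1 yt t s \<xi> - vgerm yt t s \<xi>) $ j)" for j
    proof -
      have "dist (cls (\<lambda>\<xi>. yt t \<xi> $ j)) (cls (\<lambda>\<xi>. yt s \<xi> $ j)) \<le> dist (Y t) (Y s)" for t s
        using inL1_nth(2)[OF inL1_diff(1)[OF yi yi], of t s j] inL1_diff(2)[OF inL1_nth(1)[OF yi] inL1_nth(1)[OF yi], of t j s j]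
        by (simp add: dist_norm Y_def inL1_diff(2)[OF yi yi])
      then have f: "tC1 phi {0..T} (\<lambda>t \<xi>. yt t \<xi> $ j)"
        using y inL1_nth(1)[OF yi] unfolding tC1_iff continuous_on_iff Y_def[symmetric]
        by (meson order.strict_trans1)
      note g = germ_tC2[OF col_continuous(3,4)[OF y]]
      \<comment> \<open>Each component of the residual is itself the element that makes
        \<open>csew_eq\<close> applicable, so no separate sewing is needed here.\<close>
      have R: "tC2mu phi {0..T} (3 * \<kappa>) (\<lambda>t s \<xi>. cdelta1 (\<lambda>t \<xi>. yt t \<xi> $ j) t s \<xi> - germ (zcol yt j) (gcol yt j) t s \<xi>)"
      proof (rule tC2muI[OF tC2_cdelta1_diff(1)[OF f g]])
        fix s t assume st: "0 \<le> s" "s \<le> t" "t \<le> T"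
        show "norm (cls (\<lambda>\<xi>. cdelta1 (\<lambda>t \<xi>. yt t \<xi> $ j) t s \<xi> - germ (zcol yt j) (gcol yt j) t s \<xi>)) \<le> L\<kappa> * (t - s) powr (3 * \<kappa>)"
          using inL1_nth(2)[OF res_cls(1)[OF y st], of j] R\<kappa>[OF st] unfolding comp Y_def res_cls(2)[OF y st] by linarith
      qed
      have "t \<in> {0..T}" "s \<in> {0..T}" using st by auto
      then show ?thesis
        using tC2_inL1[OF tC2mu_tC2[OF csew_eq(1)[OF col_continuous(3,4)[OF y] f R]] _ _ st(2)]
          csew_eq(2)[OF col_continuous(3,4)[OF y] f R st] unfolding comp by simp
    qed
    then have sj: "\<And>j. inL1 phi (sew yt j t s)" "\<And>j. cls (sew yt j t s) = cls (\<lambda>\<xi>. (cdelta1 yt t s \<xi> - vgerm yt t s \<xi>) $ j)" by auto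
    have di: "inL1 phi (\<lambda>\<xi>. (cdelta1 yt t s \<xi> - vgerm yt t s \<xi>) $ j - sew yt j t s \<xi>)"
      "cls (\<lambda>\<xi>. (cdelta1 yt t s \<xi> - vgerm yt t s \<xi>) $ j - sew yt j t s \<xi>) = 0" for j
      using inL1_diff[OF inL1_nth(1)[OF ri(1)] sj(1), of j j] sj(2) by auto
    note v = inL1_vec[of "\<lambda>j \<xi>. (cdelta1 yt t s \<xi> - vgerm yt t s \<xi>) $ j - sew yt j t s \<xi>", OF di(1)]
    have "cls (\<lambda>\<xi>. \<chi> j. (cdelta1 yt t s \<xi> - vgerm yt t s \<xi>) $ j - sew yt j t s \<xi>) = 0"
      using v(2) unfolding di(2) by simp
    moreover have "(\<lambda>\<xi>. cdelta1 yt t s \<xi> - Jsig phi T \<kappa> x1 x2 x3 a0 \<sigma> yt (\<lambda>v. \<sigma> (traj yt v)) t s \<xi>)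
       = (\<lambda>\<xi>. \<chi> j. (cdelta1 yt t s \<xi> - vgerm yt t s \<xi>) $ j - sew yt j t s \<xi>)"
      unfolding Jsig_eq by (simp add: fun_eq_iff vec_eq_iff)
    ultimately show ?thesis using L1N_cls[OF v(1)] by simp
  qed
  moreover have "L1N phi (yt 0) = 0"
    using Yp[of 0] Y00 proj_diff[of "Y0 0" "Y0 0"] by (simp add: L1N_cls[OF yi] Y_def)
  ultimately have "is_solution phi T \<kappa> x1 x2 x3 a0 \<sigma> yt"
    using y rem hold by (simp add: is_solution_def tQ_def Let_def)
  then show ?thesis by (rule exI[of _ yt])
qed

text \<open>An arbitrary solution comes with a residual bound of order 3\<kappa> only. Since 1 <
  3\<kappa> < 3\<gamma>, the uniqueness theorem applies at this lower order; the sum of the two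
  constants serves both solutions.\<close>

lemma solution_unique:
  assumes "is_solution phi T \<kappa> x1 x2 x3 a0 \<sigma> yt" "is_solution phi T \<kappa> x1 x2 x3 a0 \<sigma> yt'" and t: "0 \<le> t" "t \<le> T"
  shows "L1N phi (\<lambda>\<xi>. yt t \<xi> - yt' t \<xi>) = 0"
proof -
  note s = solution_res[OF assms(1)] and s' = solution_res[OF assms(2)]
  obtain L where L: "0 \<le> L" "\<And>s t. 0 \<le> s \<Longrightarrow> s \<le> t \<Longrightarrow> t \<le> T \<Longrightarrow> norm (sys.res t s (cls (yt t)) (cls (yt s))) \<le> L * (t - s) powr (3 * \<kappa>)"
    using s(3) by blast
  obtain L' where L': "0 \<le> L'" "\<And>s t. 0 \<le> s \<Longrightarrow> s \<le> t \<Longrightarrow> t \<le> T \<Longrightarrow> norm (sys.res t s (cls (yt' t)) (cls (yt' s))) \<le> L' * (t - s) powr (3 * \<kappa>)"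
    using s'(3) by blast
  have "cls (yt t) = cls (yt' t)"
  proof (rule sys.uniqueness[OF three_kappa_gt_1 _ _ _ _ _ t, where Y="\<lambda>t. cls (yt t)" and Y'="\<lambda>t. cls (yt' t)" and L="L + L'"])
    show "norm (sys.res t s (cls (yt t)) (cls (yt s))) \<le> (L + L') * (t - s) powr (3 * \<kappa>)" if "0 \<le> s" "s \<le> t" "t \<le> T" for s t
      using L(2)[OF that] mult_nonneg_nonneg[OF L'(1), of "(t - s) powr (3 * \<kappa>)"] by (simp add: distrib_right)
    show "norm (sys.res t s (cls (yt' t)) (cls (yt' s))) \<le> (L + L') * (t - s) powr (3 * \<kappa>)" if "0 \<le> s" "s \<le> t" "t \<le> T" for s t
      using L'(2)[OF that] mult_nonneg_nonneg[OF L(1), of "(t - s) powr (3 * \<kappa>)"] by (simp add: distrib_right)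
  qed (use \<kappa> L(1) L'(1) s(2) s'(2) in auto)
  then show ?thesis using tC1_inL1[OF s(1) t] tC1_inL1[OF s'(1) t] by (simp add: cls_eq_iff)
qed

end

theorem theorem4p16:
  fixes phi :: "real \<Rightarrow> real" and T \<gamma> \<kappa> :: real
    and x1 :: "real \<Rightarrow> real \<Rightarrow> real \<Rightarrow> real^'n"
    and x2 :: "real \<Rightarrow> real \<Rightarrow> real \<Rightarrow> real^'n^'n"
    and x3 :: "real \<Rightarrow> real \<Rightarrow> real \<Rightarrow> real \<Rightarrow> real^'n^'n"
    and a0 :: "real^'d" and \<sigma> :: "real^'d \<Rightarrow> real^'d^'n"
  assumes "T > 0"
    and "set_borel_measurable lborel {0<..} phi"
    and "1/3 < \<gamma>" "\<gamma> < 1/2"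
    and "1/3 < \<kappa>" "\<kappa> < \<gamma>"
    and "hypH phi T \<gamma> x1 x2 x3"
    and "C3b \<sigma>"
  shows "\<exists>yt. is_solution phi T \<kappa> x1 x2 x3 a0 \<sigma> yt \<and>
           (\<forall>yt'. is_solution phi T \<kappa> x1 x2 x3 a0 \<sigma> yt' \<longrightarrow>
              (\<forall>t\<in>{0..T}. L1N phi (\<lambda>\<xi>. yt t \<xi> - yt' t \<xi>) = 0))"
proof -
  interpret rough_equation phi T \<gamma> \<kappa> x1 x2 x3 a0 \<sigma>
    by unfold_locales (fact assms)+
  show ?thesis using solution_exists solution_unique by (meson atLeastAtMost_iff)
qed

end
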